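(* Let $\mathbb{A}=\sum_{\alpha=1}^n\mathbb{A}_\alpha\partial_\alpha$ be a constant-coefficient differential operator on $\mathbb{R}^n$ with linear maps $\mathbb{A}_\alpha:\mathbb{R}^N\to\mathbb{R}^K$. The following are equivalent: (a) $\mathbb{A}$ has a finite dimensional nullspace, i.e. $\dim N(\mathbb{A})<\infty$. (b) $\mathbb{A}$ is $\mathbb{C}$-elliptic. (c) There exists $l\in\mathbb{N}$ with $N(\mathbb{A})\subset\mathscr{P}_l$, where $\mathscr{P}_l$ denotes the set of ($\mathbb{R}^N$-valued) polynomials on $\mathbb{R}^n$ of degree less than or equal to $l$.
   Context: $N(\mathbb{A}):=\{v\in\mathcal{D}'(\mathbb{R}^n;\mathbb{R}^N):\mathbb{A}v=0\}$ is the distributional kernel of $\mathbb{A}$. For $\xi\in\mathbb{C}^n$, $\eta\in\mathbb{C}^N$ put $\mathbb{A}[\xi]\eta:=\sum_\alpha\xi_\alpha\mathbb{A}_\alpha\eta$; $\mathbb{A}$ is $\mathbb{C}$-elliptic if $\mathbb{A}[\xi]:\mathbb{C}^N\to\mathbb{C}^K$ is injective for all $\xi\in\mathbb{C}^n\setminus\{0\}$. *)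

theory Defs
  imports "HOL-Analysis.Analysis"
begin

section \<open>Test functions\<close>

definition partial :: "'n::finite \<Rightarrow> (real^'n \<Rightarrow> real) \<Rightarrow> real^'n \<Rightarrow> real" where
  "partial i f x = frechet_derivative f (at x) (axis i 1)"

text \<open>Iterated partial derivatives are indexed by lists of directions instead of multi-indices,
  so that no order of differentiation has to be chosen.\<close>

definition partials :: "'n::finite list \<Rightarrow> (real^'n \<Rightarrow> real) \<Rightarrow> real^'n \<Rightarrow> real" where
  "partials is f = foldr partial is f"

text \<open>All iterated partial derivatives exist and are (totally) differentiable, hence continuous;
  this is \<open>C\<^sup>\<infinity>\<close>.\<close>

definition smooth :: "(real^'n::finite \<Rightarrow> real) \<Rightarrow> bool" where
  "smooth f \<longleftrightarrow> (\<forall>is. partials is f differentiable_on UNIV)"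

definition supp :: "(real^'n::finite \<Rightarrow> real) \<Rightarrow> (real^'n) set" where
  "supp f = closure (support_on UNIV f)"

lemma partials_Nil [simp]: "partials [] f = f"
  and partials_Cons: "partials (i # is) f = partial i (partials is f)"
  and partials_snoc: "partials (is @ [i]) f = partials is (partial i f)"
  by (simp_all add: partials_def)

lemma smooth_differentiable: "smooth f \<Longrightarrow> partials is f differentiable at x"
  by (auto simp: smooth_def differentiable_on_def)

lemma has_derivative_partials:
  "smooth f \<Longrightarrow> (partials is f has_derivative frechet_derivative (partials is f) (at x)) (at x)"
  by (simp add: smooth_differentiable flip: frechet_derivative_works)

lemma smooth_partial: "smooth f \<Longrightarrow> smooth (partial i f)"
  unfolding smooth_def partials_snoc[symmetric] by blast

lemma partials_zero: "partials is (\<lambda>x. 0) = (\<lambda>x. 0)"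
  by (induction "is") (simp_all add: partials_Cons partial_def[abs_def])

lemma partials_add:
  assumes "smooth f" "smooth g"
  shows "partials is (\<lambda>x. f x + g x) = (\<lambda>x. partials is f x + partials is g x)"
proof (induction "is")
  case (Cons i "is")
  have "frechet_derivative (\<lambda>x. partials is f x + partials is g x) (at x)
      = (\<lambda>h. frechet_derivative (partials is f) (at x) h + frechet_derivative (partials is g) (at x) h)" for x
    using assms by (intro frechet_derivative_at[symmetric] has_derivative_add has_derivative_partials)
  then show ?case
    by (auto simp: partials_Cons Cons partial_def fun_eq_iff)
qed simp

lemma partials_scale:
  assumes "smooth f"
  shows "partials is (\<lambda>x. c * f x) = (\<lambda>x. c * partials is f x)"
proof (induction "is")
  case (Cons i "is")
  have "frechet_derivative (\<lambda>x. c * partials is f x) (at x)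
      = (\<lambda>h. c * frechet_derivative (partials is f) (at x) h)" for x
    using assms by (intro frechet_derivative_at[symmetric] has_derivative_mult_right has_derivative_partials)
  then show ?case
    by (auto simp: partials_Cons Cons partial_def fun_eq_iff)
qed simp

lemma smooth_zero: "smooth (\<lambda>x. 0)"
  by (simp add: smooth_def partials_zero)

lemma smooth_add: "smooth f \<Longrightarrow> smooth g \<Longrightarrow> smooth (\<lambda>x. f x + g x)"
  by (simp add: smooth_def[of "\<lambda>x. f x + g x"] partials_add differentiable_on_def
      smooth_differentiable)

lemma smooth_scale: "smooth f \<Longrightarrow> smooth (\<lambda>x. c * f x)"
  by (simp add: smooth_def[of "\<lambda>x. c * f x"] partials_scale differentiable_on_def
      smooth_differentiable)

lemma supp_zero: "supp (\<lambda>x. 0) = {}"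
  by (simp add: supp_def support_on_def)

lemma supp_add: "supp (\<lambda>x. f x + g x) \<subseteq> supp f \<union> supp g"
  unfolding supp_def closure_Un[symmetric] by (rule closure_mono) (auto simp: support_on_def)

lemma supp_scale: "supp (\<lambda>x. c * f x) \<subseteq> supp f"
  unfolding supp_def by (rule closure_mono) (auto simp: support_on_def)

lemma notin_supp: "x \<notin> supp f \<Longrightarrow> f x = 0"
  using closure_subset[of "support_on UNIV f"] by (auto simp: supp_def support_on_def)

lemma partial_notin_supp:
  assumes "x \<notin> supp f"
  shows "partial i f x = 0"
proof -
  have "((\<lambda>_. 0) has_derivative (\<lambda>_. 0)) (at x)" by simp
  then have "(f has_derivative (\<lambda>_. 0)) (at x)"
  proof (rule has_derivative_transform_within_open)
    show "open (- supp f)" by (simp add: supp_def open_Compl)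
  qed (use assms notin_supp in auto)
  then have "frechet_derivative f (at x) = (\<lambda>_. 0)"
    by (rule frechet_derivative_at[symmetric])
  then show ?thesis by (simp add: partial_def)
qed

lemma supp_partial: "supp (partial i f) \<subseteq> supp f"
proof -
  have "support_on UNIV (partial i f) \<subseteq> supp f"
    using partial_notin_supp[of _ f i] by (auto simp: support_on_def)
  moreover have "closed (supp f)" by (simp add: supp_def)
  ultimately show ?thesis
    unfolding supp_def[of "partial i f"] by (rule closure_minimal)
qed

lemma supp_partials: "supp (partials is f) \<subseteq> supp f"
proof (induction "is")
  case (Cons i "is")
  then show ?case
    using order_trans[OF supp_partial] by (simp add: partials_Cons)
qed simp

lemma compact_supp_mono: "compact (supp f) \<Longrightarrow> supp g \<subseteq> supp f \<Longrightarrow> compact (supp g)"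
  using compact_Int_closed[of "supp f" "supp g"] by (simp add: Int_absorb1 supp_def)

text \<open>The space \<open>\<D>(\<real>\<^sup>n)\<close>.\<close>

typedef (overloaded) 'n test_function =
  "{\<phi> :: real^'n::finite \<Rightarrow> real. smooth \<phi> \<and> compact (supp \<phi>)}"
  morphisms apply_test Abs_test
  by (rule exI[of _ "\<lambda>x. 0"]) (simp add: smooth_zero supp_zero)

setup_lifting type_definition_test_function

instantiation test_function :: (finite) real_vector
begin

lift_definition zero_test_function :: "'a test_function" is "\<lambda>x. 0"
  by (simp add: smooth_zero supp_zero)

lift_definition plus_test_function :: "'a test_function \<Rightarrow> 'a test_function \<Rightarrow> 'a test_function"
  is "\<lambda>f g x. f x + g x"
proof (intro conjI; elim conjE)
  fix f g :: "real^'a \<Rightarrow> real"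
  assume *: "smooth f" "compact (supp f)" "smooth g" "compact (supp g)"
  show "smooth (\<lambda>x. f x + g x)" using * by (simp add: smooth_add)
  have "closed (supp (\<lambda>x. f x + g x))" by (simp add: supp_def)
  moreover have "compact (supp f \<union> supp g)" using * by (simp add: compact_Un)
  ultimately show "compact (supp (\<lambda>x. f x + g x))"
    using compact_Int_closed[of "supp f \<union> supp g" "supp (\<lambda>x. f x + g x)"] supp_add[of f g]
    by (simp add: Int_absorb1)
qed

lift_definition scaleR_test_function :: "real \<Rightarrow> 'a test_function \<Rightarrow> 'a test_function"
  is "\<lambda>c f x. c * f x"
  by (auto intro: compact_supp_mono[OF _ supp_scale] smooth_scale)

definition uminus_test_function :: "'a test_function \<Rightarrow> 'a test_function" where
  "uminus_test_function f = (-1) *\<^sub>R f"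

definition minus_test_function :: "'a test_function \<Rightarrow> 'a test_function \<Rightarrow> 'a test_function" where
  "minus_test_function f g = f + - g"

instance
proof
  fix f g h :: "'a test_function" and a b :: real
  show "f + g + h = f + (g + h)" by transfer (simp add: add.assoc)
  show "f + g = g + f" by transfer (simp add: add.commute)
  show "0 + f = f" by transfer simp
  show "- f + f = 0" unfolding uminus_test_function_def by transfer simp
  show "f - g = f + - g" by (rule minus_test_function_def)
  show "a *\<^sub>R (f + g) = a *\<^sub>R f + a *\<^sub>R g" by transfer (simp add: algebra_simps)
  show "(a + b) *\<^sub>R f = a *\<^sub>R f + b *\<^sub>R f" by transfer (simp add: algebra_simps)
  show "a *\<^sub>R b *\<^sub>R f = (a * b) *\<^sub>R f" by transfer (simp add: mult.assoc)
  show "1 *\<^sub>R f = f" by transfer simp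
qed

end

lift_definition partial_test :: "'n::finite \<Rightarrow> 'n test_function \<Rightarrow> 'n test_function" is partial
  by (auto intro: compact_supp_mono[OF _ supp_partial] smooth_partial)

definition test_seminorm :: "nat \<Rightarrow> 'n::finite test_function \<Rightarrow> real" where
  "test_seminorm m \<phi> = (\<Sum>is | length is \<le> m. SUP x. \<bar>partials is (apply_test \<phi>) x\<bar>)"

lemma finite_lists [simp]: "finite {is :: 'n::finite list. length is \<le> m}"
  using finite_lists_length_le[of "UNIV :: 'n set" m] by simp

lemma smooth_apply_test: "smooth (apply_test \<phi>)"
  and compact_supp_apply_test: "compact (supp (apply_test \<phi>))"
  using apply_test by auto

lemma continuous_on_partials_test: "continuous_on UNIV (partials is (apply_test \<phi>))"
  using smooth_apply_test by (auto simp: smooth_def intro: differentiable_imp_continuous_on)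

lemma bdd_above_partials_test: "bdd_above (range (\<lambda>x. \<bar>partials is (apply_test \<phi>) x\<bar>))"
proof -
  let ?g = "partials is (apply_test \<phi>)"
  have "compact (?g ` supp (apply_test \<phi>))"
    using compact_supp_apply_test continuous_on_partials_test
    by (metis compact_continuous_image continuous_on_subset subset_UNIV)
  then obtain B where B: "\<And>x. x \<in> supp (apply_test \<phi>) \<Longrightarrow> \<bar>?g x\<bar> \<le> B"
    by (force dest!: compact_imp_bounded simp: bounded_iff)
  have "\<bar>?g x\<bar> \<le> max B 0" for x
  proof (cases "x \<in> supp (apply_test \<phi>)")
    case False
    then have "?g x = 0" using supp_partials notin_supp by blast
    then show ?thesis by simp
  qed (use B[of x] in simp)
  then show ?thesis by (auto intro!: bdd_aboveI)
qed

lemma partials_test_le_SUP: "\<bar>partials is (apply_test \<phi>) x\<bar> \<le> (SUP x. \<bar>partials is (apply_test \<phi>) x\<bar>)"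
  by (rule cSUP_upper[OF UNIV_I bdd_above_partials_test])

lemma SUP_partials_nonneg: "0 \<le> (SUP x. \<bar>partials is (apply_test \<phi>) x\<bar>)"
  using partials_test_le_SUP[of "is" \<phi> 0] by linarith

lemma test_seminorm_nonneg: "0 \<le> test_seminorm m \<phi>"
  unfolding test_seminorm_def by (intro sum_nonneg SUP_partials_nonneg)

lemma test_seminorm_mono: "m \<le> m' \<Longrightarrow> test_seminorm m \<phi> \<le> test_seminorm m' \<phi>"
  unfolding test_seminorm_def by (intro sum_mono2 SUP_partials_nonneg) auto

lemma test_seminorm_partial: "test_seminorm m (partial_test i \<phi>) \<le> test_seminorm (Suc m) \<phi>"
proof -
  let ?F = "\<lambda>is. SUP x. \<bar>partials is (apply_test \<phi>) x\<bar>"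
  have "test_seminorm m (partial_test i \<phi>) = (\<Sum>is | length is \<le> m. ?F (is @ [i]))"
    by (simp add: test_seminorm_def partial_test.rep_eq partials_snoc)
  also have "\<dots> = sum ?F ((\<lambda>is. is @ [i]) ` {is. length is \<le> m})"
    by (subst sum.reindex) (auto simp: inj_on_def)
  also have "\<dots> \<le> test_seminorm (Suc m) \<phi>"
    unfolding test_seminorm_def by (intro sum_mono2 SUP_partials_nonneg) auto
  finally show ?thesis .
qed

lemma abs_test_le_seminorm: "\<bar>apply_test \<phi> x\<bar> \<le> test_seminorm 0 \<phi>"
  using partials_test_le_SUP[of "[]" \<phi> x] by (simp add: test_seminorm_def)


section \<open>Vector-valued distributions\<close>

text \<open>\<open>\<D>'(\<real>\<^sup>n; \<real>\<^sup>N)\<close> as the linear maps \<open>\<D>(\<real>\<^sup>n) \<rightarrow> \<real>\<^sup>N\<close> satisfying, on each compact set, a seminorm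
  estimate of finite order (equivalently: continuous for the usual topology of \<open>\<D>(\<real>\<^sup>n)\<close>).\<close>

definition is_distribution :: "('n::finite test_function \<Rightarrow> real^'m::finite) \<Rightarrow> bool" where
  "is_distribution T \<longleftrightarrow> linear T \<and>
    (\<forall>K. compact K \<longrightarrow> (\<exists>C m. \<forall>\<phi>. supp (apply_test \<phi>) \<subseteq> K \<longrightarrow>
       norm (T \<phi>) \<le> C * test_seminorm m \<phi>))"

lemma is_distributionI:
  assumes "linear T"
    and "\<And>K. compact K \<Longrightarrow> \<exists>C m. \<forall>\<phi>. supp (apply_test \<phi>) \<subseteq> K \<longrightarrow> norm (T \<phi>) \<le> C * test_seminorm m \<phi>"
  shows "is_distribution T"
  using assms by (simp add: is_distribution_def)

lemma is_distributionE:
  assumes "is_distribution T" "compact K"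
  obtains C m where "0 \<le> C"
    "\<And>\<phi>. supp (apply_test \<phi>) \<subseteq> K \<Longrightarrow> norm (T \<phi>) \<le> C * test_seminorm m \<phi>"
proof -
  obtain C m where "\<And>\<phi>. supp (apply_test \<phi>) \<subseteq> K \<Longrightarrow> norm (T \<phi>) \<le> C * test_seminorm m \<phi>"
    using assms unfolding is_distribution_def by meson
  then have "norm (T \<phi>) \<le> \<bar>C\<bar> * test_seminorm m \<phi>" if "supp (apply_test \<phi>) \<subseteq> K" for \<phi>
    using that by (meson abs_ge_self mult_right_mono order_trans test_seminorm_nonneg)
  then show ?thesis using that abs_ge_zero by blast
qed

lemma is_distribution_zero: "is_distribution (\<lambda>\<phi>. 0)"
  by (rule is_distributionI)
    (auto simp: linear_iff intro!: exI[of _ 0])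

lemma is_distribution_add:
  assumes "is_distribution S" "is_distribution T"
  shows "is_distribution (\<lambda>\<phi>. S \<phi> + T \<phi>)"
proof (rule is_distributionI)
  show "linear (\<lambda>\<phi>. S \<phi> + T \<phi>)"
    using assms by (intro linear_compose_add) (auto simp: is_distribution_def)
next
  fix K :: "(real^'a) set" assume K: "compact K"
  obtain C m where 1: "0 \<le> C" "\<And>\<phi>. supp (apply_test \<phi>) \<subseteq> K \<Longrightarrow> norm (S \<phi>) \<le> C * test_seminorm m \<phi>"
    using is_distributionE[OF assms(1) K] by blast
  obtain D k where 2: "0 \<le> D" "\<And>\<phi>. supp (apply_test \<phi>) \<subseteq> K \<Longrightarrow> norm (T \<phi>) \<le> D * test_seminorm k \<phi>"
    using is_distributionE[OF assms(2) K] by blast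
  have "norm (S \<phi> + T \<phi>) \<le> (C + D) * test_seminorm (max m k) \<phi>" if "supp (apply_test \<phi>) \<subseteq> K" for \<phi>
  proof -
    have "norm (S \<phi> + T \<phi>) \<le> C * test_seminorm m \<phi> + D * test_seminorm k \<phi>"
      using 1(2) 2(2) that by (intro norm_triangle_mono) auto
    also have "\<dots> \<le> C * test_seminorm (max m k) \<phi> + D * test_seminorm (max m k) \<phi>"
      using 1(1) 2(1) by (intro add_mono mult_left_mono test_seminorm_mono) auto
    finally show ?thesis by (simp add: algebra_simps)
  qed
  then show "\<exists>C m. \<forall>\<phi>. supp (apply_test \<phi>) \<subseteq> K \<longrightarrow> norm (S \<phi> + T \<phi>) \<le> C * test_seminorm m \<phi>"
    by blast
qed

lemma is_distribution_linear_comp: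
  assumes L: "linear (L :: real^'m::finite \<Rightarrow> real^'k::finite)" 
    and T: "is_distribution (T :: 'n::finite test_function \<Rightarrow> real^'m)"
  shows "is_distribution (\<lambda>\<phi>. L (T \<phi>))"
proof (rule is_distributionI)
  show "linear (\<lambda>\<phi>. L (T \<phi>))"
    using linear_compose[OF _ L, of T] T by (simp add: is_distribution_def o_def)
next
  fix K :: "(real^'n) set" assume K: "compact K"
  obtain C m where 1: "0 \<le> C" "\<And>\<phi>. supp (apply_test \<phi>) \<subseteq> K \<Longrightarrow> norm (T \<phi>) \<le> C * test_seminorm m \<phi>"
    using is_distributionE[OF T K] by blast
  obtain B where B: "0 < B" "\<And>y. norm (L y) \<le> B * norm y"
    using linear_bounded_pos[OF L] by blast
  have "norm (L (T \<phi>)) \<le> (B * C) * test_seminorm m \<phi>" if "supp (apply_test \<phi>) \<subseteq> K" for \<phi>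
  proof -
    have "norm (L (T \<phi>)) \<le> B * norm (T \<phi>)" by (rule B(2))
    also have "\<dots> \<le> B * (C * test_seminorm m \<phi>)"
      using B(1) 1(2) that by (intro mult_left_mono) auto
    finally show ?thesis by (simp add: mult.assoc)
  qed
  then show "\<exists>C m. \<forall>\<phi>. supp (apply_test \<phi>) \<subseteq> K \<longrightarrow> norm (L (T \<phi>)) \<le> C * test_seminorm m \<phi>"
    by blast
qed

lemma is_distribution_scaleR: "is_distribution T \<Longrightarrow> is_distribution (\<lambda>\<phi>. c *\<^sub>R T \<phi>)"
  by (rule is_distribution_linear_comp[OF linear_scale_self])

lemma linear_partial_test: "linear (partial_test i)"
proof (rule linearI)
  fix \<phi> \<psi> :: "'a test_function" and c :: real
  show "partial_test i (\<phi> + \<psi>) = partial_test i \<phi> + partial_test i \<psi>"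
    by transfer (use partials_add[of _ _ "[_]"] in \<open>auto simp: partials_Cons\<close>)
  show "partial_test i (c *\<^sub>R \<phi>) = c *\<^sub>R partial_test i \<phi>"
    by transfer (use partials_scale[of _ "[_]"] in \<open>auto simp: partials_Cons\<close>)
qed

lemma is_distribution_partial:
  assumes T: "is_distribution T"
  shows "is_distribution (\<lambda>\<phi>. - T (partial_test i \<phi>))"
proof (rule is_distributionI)
  have "linear (\<lambda>\<phi>. T (partial_test i \<phi>))"
    using linear_compose[OF linear_partial_test, of T] T by (simp add: is_distribution_def o_def)
  then show "linear (\<lambda>\<phi>. - T (partial_test i \<phi>))"
    by (rule linear_compose_neg)
next
  fix K :: "(real^'a) set" assume K: "compact K"
  obtain C m where 1: "0 \<le> C" "\<And>\<phi>. supp (apply_test \<phi>) \<subseteq> K \<Longrightarrow> norm (T \<phi>) \<le> C * test_seminorm m \<phi>"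
    using is_distributionE[OF T K] by blast
  have "norm (- T (partial_test i \<phi>)) \<le> C * test_seminorm (Suc m) \<phi>"
    if "supp (apply_test \<phi>) \<subseteq> K" for \<phi>
  proof -
    have "supp (apply_test (partial_test i \<phi>)) \<subseteq> K"
      using that supp_partial[of i "apply_test \<phi>"] by (auto simp: partial_test.rep_eq)
    then have "norm (- T (partial_test i \<phi>)) \<le> C * test_seminorm m (partial_test i \<phi>)"
      using 1(2) by simp
    also have "\<dots> \<le> C * test_seminorm (Suc m) \<phi>"
      using 1(1) test_seminorm_partial by (intro mult_left_mono) auto
    finally show ?thesis .
  qed
  then show "\<exists>C m. \<forall>\<phi>. supp (apply_test \<phi>) \<subseteq> K \<longrightarrow>
      norm (- T (partial_test i \<phi>)) \<le> C * test_seminorm m \<phi>"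
    by blast
qed

typedef (overloaded) ('n, 'm) distribution =
  "{T :: 'n::finite test_function \<Rightarrow> real^'m::finite. is_distribution T}"
  morphisms apply_dist Abs_dist
  using is_distribution_zero by blast

setup_lifting type_definition_distribution

instantiation distribution :: (finite, finite) real_vector
begin

lift_definition zero_distribution :: "('a, 'b) distribution" is "\<lambda>\<phi>. 0"
  by (rule is_distribution_zero)

lift_definition plus_distribution ::
    "('a, 'b) distribution \<Rightarrow> ('a, 'b) distribution \<Rightarrow> ('a, 'b) distribution"
  is "\<lambda>S T \<phi>. S \<phi> + T \<phi>"
  by (rule is_distribution_add)

lift_definition scaleR_distribution :: "real \<Rightarrow> ('a, 'b) distribution \<Rightarrow> ('a, 'b) distribution"
  is "\<lambda>c T \<phi>. c *\<^sub>R T \<phi>"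
  by (rule is_distribution_scaleR)

definition uminus_distribution :: "('a, 'b) distribution \<Rightarrow> ('a, 'b) distribution" where
  "uminus_distribution T = (-1) *\<^sub>R T"

definition minus_distribution ::
    "('a, 'b) distribution \<Rightarrow> ('a, 'b) distribution \<Rightarrow> ('a, 'b) distribution" where
  "minus_distribution S T = S + - T"

instance
proof
  fix f g h :: "('a, 'b) distribution" and a b :: real
  show "f + g + h = f + (g + h)" by transfer (simp add: add.assoc)
  show "f + g = g + f" by transfer (simp add: add.commute)
  show "0 + f = f" by transfer simp
  show "- f + f = 0" unfolding uminus_distribution_def by transfer simp
  show "f - g = f + - g" by (rule minus_distribution_def)
  show "a *\<^sub>R (f + g) = a *\<^sub>R f + a *\<^sub>R g" by transfer (simp add: algebra_simps)
  show "(a + b) *\<^sub>R f = a *\<^sub>R f + b *\<^sub>R f" by transfer (simp add: algebra_simps)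
  show "a *\<^sub>R b *\<^sub>R f = (a * b) *\<^sub>R f" by transfer (simp add: mult.assoc)
  show "1 *\<^sub>R f = f" by transfer simp
qed

end

lift_definition partial_dist :: "'n::finite \<Rightarrow> ('n, 'm::finite) distribution \<Rightarrow> ('n, 'm) distribution"
  is "\<lambda>i T \<phi>. - T (partial_test i \<phi>)"
  by (rule is_distribution_partial)

text \<open>Composition with a linear map on the values. The value for non-linear \<open>L\<close> is a dummy.\<close>

lift_definition comp_dist ::
    "(real^'m::finite \<Rightarrow> real^'k::finite) \<Rightarrow> ('n::finite, 'm) distribution \<Rightarrow> ('n, 'k) distribution"
  is "\<lambda>L T \<phi>. if linear L then L (T \<phi>) else 0"
  subgoal for L T
    by (cases "linear L") (simp_all add: is_distribution_linear_comp is_distribution_zero)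
  done


section \<open>Regular distributions and polynomials\<close>

definition locally_integrable :: "(real^'n::finite \<Rightarrow> real^'m::finite) \<Rightarrow> bool" where
  "locally_integrable f \<longleftrightarrow> (\<forall>K. compact K \<longrightarrow> set_integrable lborel K f)"

lemma integrable_test_scaleR:
  assumes f: "locally_integrable f" and K: "compact K" "supp (apply_test \<phi>) \<subseteq> K"
  shows "integrable lborel (\<lambda>x. apply_test \<phi> x *\<^sub>R f x)"
    and "norm (\<integral>x. apply_test \<phi> x *\<^sub>R f x \<partial>lborel)
      \<le> (\<integral>x. norm (indicator K x *\<^sub>R f x) \<partial>lborel) * test_seminorm 0 \<phi>"
proof -
  have eq: "apply_test \<phi> x *\<^sub>R f x = apply_test \<phi> x *\<^sub>R (indicator K x *\<^sub>R f x)" for x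
    using K(2) notin_supp[of x "apply_test \<phi>"] by (auto simp: indicator_def)
  have int: "integrable lborel (\<lambda>x. indicator K x *\<^sub>R f x)"
    using f K(1) by (simp add: locally_integrable_def set_integrable_def)
  have bound: "norm (apply_test \<phi> x *\<^sub>R f x) \<le> test_seminorm 0 \<phi> * norm (indicator K x *\<^sub>R f x)" for x
    unfolding eq norm_scaleR[of "apply_test \<phi> x"]
    by (intro mult_right_mono abs_test_le_seminorm) auto
  have [measurable]: "apply_test \<phi> \<in> borel_measurable lborel"
    using borel_measurable_continuous_onI[OF continuous_on_partials_test[of "[]" \<phi>]] by simp
  have [measurable]: "(\<lambda>x. indicator K x *\<^sub>R f x) \<in> borel_measurable lborel"
    using int by (rule borel_measurable_integrable)
  have int2: "integrable lborel (\<lambda>x. test_seminorm 0 \<phi> * norm (indicator K x *\<^sub>R f x))"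
    using int by (intro integrable_mult_right integrable_norm)
  show int3: "integrable lborel (\<lambda>x. apply_test \<phi> x *\<^sub>R f x)"
  proof (rule Bochner_Integration.integrable_bound[OF int2])
    show "(\<lambda>x. apply_test \<phi> x *\<^sub>R f x) \<in> borel_measurable lborel"
      unfolding eq by measurable
    show "AE x in lborel. norm (apply_test \<phi> x *\<^sub>R f x)
        \<le> norm (test_seminorm 0 \<phi> * norm (indicator K x *\<^sub>R f x))"
      using bound test_seminorm_nonneg[of 0 \<phi>] by (simp add: abs_mult)
  qed
  have "norm (\<integral>x. apply_test \<phi> x *\<^sub>R f x \<partial>lborel) \<le> (\<integral>x. norm (apply_test \<phi> x *\<^sub>R f x) \<partial>lborel)"
    by (rule integral_norm_bound)
  also have "\<dots> \<le> (\<integral>x. test_seminorm 0 \<phi> * norm (indicator K x *\<^sub>R f x) \<partial>lborel)"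
    using int3 int2 bound by (intro integral_mono integrable_norm)
  finally show "norm (\<integral>x. apply_test \<phi> x *\<^sub>R f x \<partial>lborel)
      \<le> (\<integral>x. norm (indicator K x *\<^sub>R f x) \<partial>lborel) * test_seminorm 0 \<phi>"
    by (simp add: mult.commute)
qed

text \<open>The distribution induced by a locally integrable function; a dummy for other functions.\<close>

lift_definition regular_dist :: "(real^'n::finite \<Rightarrow> real^'m::finite) \<Rightarrow> ('n, 'm) distribution"
  is "\<lambda>f \<phi>. if locally_integrable f then \<integral>x. apply_test \<phi> x *\<^sub>R f x \<partial>lborel else 0"
proof -
  fix f :: "real^'n \<Rightarrow> real^'m"
  show "is_distribution (\<lambda>\<phi>. if locally_integrable f then \<integral>x. apply_test \<phi> x *\<^sub>R f x \<partial>lborel else 0)"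
  proof (cases "locally_integrable f")
    case True
    note int = integrable_test_scaleR(1)[OF True compact_supp_apply_test subset_refl]
    have "is_distribution (\<lambda>\<phi>. \<integral>x. apply_test \<phi> x *\<^sub>R f x \<partial>lborel)"
    proof (rule is_distributionI)
      show "linear (\<lambda>\<phi>. \<integral>x. apply_test \<phi> x *\<^sub>R f x \<partial>lborel)"
        using int
        by (intro linearI) (simp_all add: plus_test_function.rep_eq scaleR_test_function.rep_eq
            scaleR_add_left flip: scaleR_scaleR)
    next
      fix K :: "(real^'n) set" assume "compact K"
      then show "\<exists>C m. \<forall>\<phi>. supp (apply_test \<phi>) \<subseteq> K \<longrightarrow>
          norm (\<integral>x. apply_test \<phi> x *\<^sub>R f x \<partial>lborel) \<le> C * test_seminorm m \<phi>"
        using integrable_test_scaleR(2)[OF True] by meson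
    qed
    then show ?thesis using True by simp
  qed (simp add: is_distribution_zero)
qed

text \<open>The \<open>\<real>\<^sup>N\<close>-valued polynomials on \<open>\<real>\<^sup>n\<close> of total degree at most \<open>l\<close>; \<open>\<beta>\<close> is a multi-index.\<close>

definition polynomials_upto :: "nat \<Rightarrow> (real^'n::finite \<Rightarrow> real^'m::finite) set" where
  "polynomials_upto l = {p. \<exists>c :: ('n \<Rightarrow> nat) \<Rightarrow> real^'m.
     p = (\<lambda>x. \<Sum>\<beta> | (\<Sum>i\<in>UNIV. \<beta> i) \<le> l. (\<Prod>i\<in>UNIV. (x $ i) ^ \<beta> i) *\<^sub>R c \<beta>)}"

lemma finite_multi_indices: "finite {\<beta> :: 'n::finite \<Rightarrow> nat. (\<Sum>i\<in>UNIV. \<beta> i) \<le> l}"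
proof (rule finite_subset)
  show "{\<beta> :: 'n \<Rightarrow> nat. (\<Sum>i\<in>UNIV. \<beta> i) \<le> l} \<subseteq> PiE UNIV (\<lambda>_. {..l})"
  proof
    fix \<beta> :: "'n \<Rightarrow> nat"
    assume "\<beta> \<in> {\<beta>. (\<Sum>i\<in>UNIV. \<beta> i) \<le> l}"
    moreover have "\<beta> i \<le> (\<Sum>i\<in>UNIV. \<beta> i)" for i
      by (rule member_le_sum) auto
    ultimately have "\<beta> i \<le> l" for i
      using order_trans by blast
    then show "\<beta> \<in> PiE UNIV (\<lambda>_. {..l})" by (simp add: PiE_iff)
  qed
qed (auto intro: finite_PiE)

lemma locally_integrable_polynomial:
  assumes "p \<in> polynomials_upto l"
  shows "locally_integrable p"
proof -
  obtain c where p: "p = (\<lambda>x. \<Sum>\<beta> | (\<Sum>i\<in>UNIV. \<beta> i) \<le> l. (\<Prod>i\<in>UNIV. (x $ i) ^ \<beta> i) *\<^sub>R c \<beta>)"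
    using assms by (auto simp: polynomials_upto_def)
  have "continuous_on K p" for K
    unfolding p by (intro continuous_intros)
  then show ?thesis
    by (auto simp: locally_integrable_def set_integrable_def intro!: borel_integrable_compact)
qed


section \<open>First-order constant-coefficient operators\<close>

text \<open>An operator \<open>\<Sum>i. A i \<partial>\<^sub>i\<close> is given by its family \<open>A\<close> of linear coefficient maps.\<close>

definition diff_op :: "('n::finite \<Rightarrow> real^'m::finite \<Rightarrow> real^'k::finite) \<Rightarrow>
    ('n, 'm) distribution \<Rightarrow> ('n, 'k) distribution" where
  "diff_op A v = (\<Sum>i\<in>UNIV. comp_dist (A i) (partial_dist i v))"

definition nullspace :: "('n::finite \<Rightarrow> real^'m::finite \<Rightarrow> real^'k::finite) \<Rightarrow>
    ('n, 'm) distribution set" where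
  "nullspace A = {v. diff_op A v = 0}"

text \<open>The library's \<open>dim\<close> is \<open>0\<close> on infinite-dimensional spaces, so finite dimensionality is stated
  via finite spanning sets.\<close>

definition finite_dimensional :: "'a::real_vector set \<Rightarrow> bool" where
  "finite_dimensional V \<longleftrightarrow> (\<exists>B. finite B \<and> span B = V)"

text \<open>The complex-linear extension \<open>L (Re \<eta>) + \<i> L (Im \<eta>)\<close> of a real-linear map \<open>L\<close>.\<close>

definition complexify :: "(real^'m::finite \<Rightarrow> real^'k::finite) \<Rightarrow> complex^'m \<Rightarrow> complex^'k" where
  "complexify L \<eta> = (\<chi> j. Complex (L (\<chi> i. Re (\<eta> $ i)) $ j) (L (\<chi> i. Im (\<eta> $ i)) $ j))"

definition symbol :: "('n::finite \<Rightarrow> real^'m::finite \<Rightarrow> real^'k::finite) \<Rightarrow>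
    complex^'n \<Rightarrow> complex^'m \<Rightarrow> complex^'k" where
  "symbol A \<xi> \<eta> = (\<Sum>i\<in>UNIV. (\<xi> $ i) *s complexify (A i) \<eta>)"

definition C_elliptic :: "('n::finite \<Rightarrow> real^'m::finite \<Rightarrow> real^'k::finite) \<Rightarrow> bool" where
  "C_elliptic A \<longleftrightarrow> (\<forall>\<xi>. \<xi> \<noteq> 0 \<longrightarrow> inj (symbol A \<xi>))"

end

theory Submission
  imports Defs "HOL-Library.Function_Algebras" "HOL-Library.Multiset"
    "HOL-Computational_Algebra.Fundamental_Theorem_Algebra"
begin

text \<open>(c) implies (a) because the polynomials of bounded degree form a finite dimensional space.
  If \<open>A\<close> is not \<open>\<complex>\<close>-elliptic, say \<open>\<A>[\<xi>]\<eta> = 0\<close>, then all the functions \<open>Re ((\<xi> \<cdot> x)\<^sup>k \<eta>)\<close>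
  solve the equation, and for suitably normalised \<open>\<xi>\<close>, \<open>\<eta>\<close> they are linearly independent; hence (a) implies (b).

  For (b) implies (c), the derivatives of order \<open>k\<close> of a solution, evaluated at a fixed test function,
  form the coefficient array of a homogeneous polynomial solution of degree \<open>k\<close>. These arrays vanish
  for large \<open>k\<close>, by induction on the number of variables: if there is no such solution in fewer
  variables, then \<open>\<partial>\<^sub>j\<close> is injective from degree \<open>k + 1\<close> to degree \<open>k\<close>, hence eventually bijective since
  dimensions decrease, and a common eigenvector of the commuting maps \<open>\<partial>\<^sub>i \<circ> \<partial>\<^sub>j\<inverse>\<close> yields \<open>\<xi> \<noteq> 0\<close>
  and \<open>\<eta> \<noteq> 0\<close> with \<open>\<A>[\<xi>]\<eta> = 0\<close>. So \<open>\<partial>\<^sub>i\<^sup>m v = 0\<close> for all \<open>i\<close> and some \<open>m\<close>. Since a test function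
  whose moments of order below \<open>m\<close> in the variable \<open>x\<^sub>i\<close> vanish is of the form \<open>\<partial>\<^sub>i\<^sup>m \<psi>\<close>, such a \<open>v\<close>
  depends on finitely many moments of the test function only, that is, \<open>v\<close> is a polynomial.\<close>

section \<open>Linear relations and common eigenvectors\<close>

text \<open>The terms \<open>f 0\<close>, ..., \<open>f (card B)\<close> are too many to be
  independent. The relation is indexed by \<open>k\<close> and not by the vectors because its
  coefficients become those of a polynomial in both applications; a repeated value, which the set of
  vectors would hide, gives a relation by itself.\<close>

lemma (in vector_space) ex_linear_relation:
  fixes f :: "nat \<Rightarrow> 'b"
  assumes "finite B" "\<And>k. f k \<in> span B"
  shows "\<exists>n c. (\<exists>k<n. c k \<noteq> 0) \<and> (\<Sum>k<n. scale (c k) (f k)) = 0"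
proof (cases "inj_on f {..card B}")
  case False
  then obtain a b where ab: "a < b" "f a = f b"
    by (auto simp: inj_on_def) (metis linorder_neqE_nat)
  let ?c = "\<lambda>k. if k = a then 1 else if k = b then - 1 else 0"
  have "(\<Sum>k<Suc b. scale (?c k) (f k)) = (\<Sum>k\<in>{a, b}. scale (?c k) (f k))"
    using ab by (intro sum.mono_neutral_right) auto
  also have "\<dots> = 0" using ab by simp
  finally show ?thesis using ab by (intro exI[of _ "Suc b"] exI[of _ ?c]) auto
next
  case True
  have "dependent (f ` {..card B})"
    using independent_span_bound[OF assms(1), of "f ` {..card B}"] assms(2)
    by (auto simp: card_image[OF True])
  then obtain u where u: "\<exists>v\<in>f ` {..card B}. u v \<noteq> 0" "(\<Sum>v\<in>f ` {..card B}. scale (u v) v) = 0"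
    by (auto simp: dependent_finite)
  have "(\<Sum>k<Suc (card B). scale (u (f k)) (f k)) = 0"
    using u(2) True by (simp add: sum.reindex lessThan_Suc_atMost)
  with u(1) show ?thesis
    by (intro exI[of _ "Suc (card B)"] exI[of _ "\<lambda>k. u (f k)"]) (auto simp: less_Suc_eq_le)
qed

lemma (in vector_space) subspace_eq_span:
  assumes "subspace V" "finite C" "V \<subseteq> span C"
  shows "\<exists>B. finite B \<and> independent B \<and> span B = V"
proof -
  obtain B where B: "B \<subseteq> V" "independent B" "V \<subseteq> span B"
    using maximal_independent_subset by blast
  then have "finite B" using independent_span_bound[OF assms(2), of B] assms(3) by auto
  with B assms(1) show ?thesis using span_subspace by blast
qed

text \<open>A basis of \<open>V\<close> stays independent under a map that is injective on
  \<open>V\<close>, which bounds its size by that of a basis of \<open>U\<close>. With equal sizes,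
  a vector of \<open>U\<close> outside the image could be added to the image of the basis and would
  give too many independent vectors.\<close>

lemma (in vector_space) dim_le_of_injective:
  assumes V: "subspace V" "finite B" "V \<subseteq> span B"
    and U: "subspace U" "finite C" "U \<subseteq> span C"
    and f: "Vector_Spaces.linear scale scale f" "inj_on f V" "f ` V \<subseteq> U"
  shows "dim V \<le> dim U" and "dim V = dim U \<Longrightarrow> f ` V = U"
proof -
  interpret f: Vector_Spaces.linear scale scale f by fact
  obtain B' where B': "finite B'" "independent B'" "span B' = V"
    using subspace_eq_span[OF V] by blast
  obtain C' where C': "finite C'" "independent C'" "span C' = U"
    using subspace_eq_span[OF U] by blast
  have dims: "dim V = card B'" "dim U = card C'"
    using B' C' dim_span_eq_card_independent by auto
  have ind: "independent (f ` B')"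
    using B' f(2) by (intro f.independent_injective_image) auto
  have card: "card (f ` B') = card B'"
    using B' f(2) by (metis card_image inj_on_subset span_superset)
  have sub: "f ` B' \<subseteq> span C'"
    using B' C' f(3) span_superset by blast
  show "dim V \<le> dim U"
    using independent_span_bound[OF C'(1) ind sub] by (simp add: dims card)
  show "f ` V = U" if "dim V = dim U"
  proof (rule ccontr)
    assume "f ` V \<noteq> U"
    then obtain u where u: "u \<in> U" "u \<notin> f ` V" using f(3) by blast
    have "span (f ` B') = f ` V" using B' f.span_image by auto
    then have "independent (insert u (f ` B'))" "u \<notin> f ` B'"
      using u ind independent_insertI[of u "f ` B'"] span_base[of u "f ` B'"] by auto
    then have "card (insert u (f ` B')) \<le> card C'"
      using independent_span_bound[OF C'(1), of "insert u (f ` B')"] sub u C' by auto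
    then show False using \<open>u \<notin> f ` B'\<close> card that dims B' by simp
  qed
qed

text \<open>Linearity is only asked on \<open>V\<close>: the map to which this is applied involves
  \<open>the_inv_into\<close> and is arbitrary elsewhere.\<close>

locale endomorphism_on = vector_space scale
  for scale :: "'a::field \<Rightarrow> 'b::ab_group_add \<Rightarrow> 'b" +
  fixes V :: "'b set" and T :: "'b \<Rightarrow> 'b"
  assumes subspace_V: "subspace V"
    and T_closed: "u \<in> V \<Longrightarrow> T u \<in> V"
    and T_add: "u \<in> V \<Longrightarrow> w \<in> V \<Longrightarrow> T (u + w) = T u + T w"
    and T_scale: "u \<in> V \<Longrightarrow> T (scale c u) = scale c (T u)"
begin

lemma T_zero: "T 0 = 0"
  using T_scale[OF subspace_0[OF subspace_V], of 0] by simp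

text \<open>The vector \<open>p(T) u\<close>, computed by Horner's scheme.\<close>

definition poly_action :: "'a poly \<Rightarrow> 'b \<Rightarrow> 'b" where
  "poly_action p u = fold_coeffs (\<lambda>a w. scale a u + T w) p 0"

lemma poly_action_0 [simp]: "poly_action 0 u = 0"
  by (simp add: poly_action_def)

text \<open>For \<open>a = 0\<close> and \<open>p = 0\<close> the coefficient list is empty and
  nothing is unfolded; the equation then rests on \<open>T 0 = 0\<close>.\<close>

lemma poly_action_pCons [simp]: "poly_action (pCons a p) u = scale a u + T (poly_action p u)"
  by (cases "p = 0"; cases "a = 0") (simp_all add: poly_action_def T_zero)

lemma poly_action_closed: "u \<in> V \<Longrightarrow> poly_action p u \<in> V"
  by (induction p) (auto intro: subspace_add subspace_scale subspace_0 T_closed subspace_V)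

lemma poly_action_add: "u \<in> V \<Longrightarrow> poly_action (p + q) u = poly_action p u + poly_action q u"
  by (induction p q rule: poly_induct2) (simp_all add: T_add poly_action_closed scale_left_distrib)

lemma poly_action_smult: "u \<in> V \<Longrightarrow> poly_action (smult c p) u = scale c (poly_action p u)"
  by (induction p) (simp_all add: T_scale poly_action_closed scale_right_distrib)

lemma poly_action_sum: "u \<in> V \<Longrightarrow> poly_action (\<Sum>k\<in>I. p k) u = (\<Sum>k\<in>I. poly_action (p k) u)"
  by (induction I rule: infinite_finite_induct) (simp_all add: poly_action_add)

lemma poly_action_monom: "u \<in> V \<Longrightarrow> poly_action (monom c k) u = scale c ((T ^^ k) u)"
proof (induction k)
  case (Suc k)
  have "(T ^^ k) u \<in> V" using Suc.prems by (induction k) (auto intro: T_closed)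
  with Suc show ?case by (simp add: monom_Suc T_scale)
qed (simp add: monom_0 T_zero)

end

text \<open>Take a polynomial \<open>p\<close> of least degree among the non-zero ones with
  \<open>p(T) u = 0\<close> for some non-zero \<open>u\<close> in \<open>V\<close>. A root
  \<open>z\<close> splits off a linear factor, \<open>p = (X - z) q\<close>, and
  \<open>q(T) u\<close>, non-zero by minimality, is an eigenvector for \<open>z\<close>.\<close>

lemma ex_eigenvector:
  fixes scale :: "complex \<Rightarrow> 'b::ab_group_add \<Rightarrow> 'b"
  assumes "endomorphism_on scale V T"
    and fin: "finite B" "V \<subseteq> module.span scale B" and V: "V \<noteq> {0}"
  shows "\<exists>u c. u \<in> V \<and> u \<noteq> 0 \<and> T u = scale c u"
proof -
  interpret endomorphism_on scale V T by fact
  obtain u0 where u0: "u0 \<in> V" "u0 \<noteq> 0" using V subspace_0[OF subspace_V] by blast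
  have "(T ^^ k) u0 \<in> V" for k using u0 by (induction k) (auto intro: T_closed)
  then obtain n c where nc: "\<exists>k<n. c k \<noteq> 0" "(\<Sum>k<n. scale (c k) ((T ^^ k) u0)) = 0"
    using ex_linear_relation[OF fin(1), of "\<lambda>k. (T ^^ k) u0"] fin(2) by blast
  \<comment> \<open>The relation among the iterates of \<open>u0\<close> is an annihilating
    polynomial, so the minimum below is taken over a non-empty set.\<close>
  define p0 where "p0 = (\<Sum>k<n. monom (c k) k)"
  have "coeff p0 k = (if k < n then c k else 0)" for k
    by (simp add: p0_def coeff_sum if_distrib cong: if_cong)
  with nc(1) have "p0 \<noteq> 0" by (metis coeff_0)
  moreover have "poly_action p0 u0 = 0"
    using nc(2) u0 by (simp add: p0_def poly_action_sum poly_action_monom)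
  ultimately have "\<exists>p. p \<noteq> 0 \<and> (\<exists>u\<in>V. u \<noteq> 0 \<and> poly_action p u = 0)" using u0 by blast
  then obtain p where p: "p \<noteq> 0" "\<exists>u\<in>V. u \<noteq> 0 \<and> poly_action p u = 0"
    and minimal: "\<And>q. q \<noteq> 0 \<Longrightarrow> \<exists>u\<in>V. u \<noteq> 0 \<and> poly_action q u = 0 \<Longrightarrow> degree p \<le> degree q"
    using ex_has_least_nat[of "\<lambda>p. p \<noteq> 0 \<and> (\<exists>u\<in>V. u \<noteq> 0 \<and> poly_action p u = 0)" _ degree] by metis
  obtain u where u: "u \<in> V" "u \<noteq> 0" "poly_action p u = 0" using p(2) by blast
  have "degree p \<noteq> 0"
  proof
    assume "degree p = 0"
    then obtain a where "p = [:a:]" by (auto elim: degree_eq_zeroE)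
    with u p(1) show False by (simp add: T_zero)
  qed
  then have "\<not> constant (poly p)" by (simp add: constant_degree)
  then obtain z where "poly p z = 0" using fundamental_theorem_of_algebra by blast
  then obtain q where q: "p = [:- z, 1:] * q" by (auto simp: poly_eq_0_iff_dvd elim: dvdE)
  with p(1) have "q \<noteq> 0" by auto
  then have "degree p = Suc (degree q)" unfolding q by (subst degree_mult_eq) auto
  then have w: "poly_action q u \<noteq> 0" using minimal[OF \<open>q \<noteq> 0\<close>] u by auto
  \<comment> \<open>Written this way, the product with \<open>X - z\<close> needs only the linearity
    of \<open>poly_action\<close> in the polynomial, not its multiplicativity.\<close>
  have "p = pCons 0 q + smult (- z) q" by (simp add: q)
  then have "T (poly_action q u) + scale (- z) (poly_action q u) = 0"
    using u by (simp add: poly_action_add poly_action_smult del: smult_minus_left)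
  then have "T (poly_action q u) = scale z (poly_action q u)" by (simp add: scale_minus_left)
  with w poly_action_closed[OF u(1)] show ?thesis by blast
qed

text \<open>An eigenspace of \<open>T i\<close> is mapped into itself by every map commuting with
  \<open>T i\<close>, so the induction continues inside it; hence \<open>V\<close> varies in the
  induction.\<close>

lemma ex_common_eigenvector:
  fixes scale :: "complex \<Rightarrow> 'b::ab_group_add \<Rightarrow> 'b"
  assumes "finite I" "finite B" "V \<subseteq> module.span scale B" "V \<noteq> {0}" "vector_space scale"
    and "module.subspace scale V"
    and "\<And>i. i \<in> I \<Longrightarrow> endomorphism_on scale V (T i)"
    and "\<And>i j u. i \<in> I \<Longrightarrow> j \<in> I \<Longrightarrow> u \<in> V \<Longrightarrow> T i (T j u) = T j (T i u)"
  shows "\<exists>u c. u \<in> V \<and> u \<noteq> 0 \<and> (\<forall>i\<in>I. T i u = scale (c i) u)"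
  using assms
proof (induction I arbitrary: V rule: finite_induct)
  case empty
  interpret vector_space scale by fact
  show ?case using empty subspace_0[of V] by blast
next
  case (insert i I)
  interpret endomorphism_on scale V "T i" using insert.prems by simp
  obtain u z where uz: "u \<in> V" "u \<noteq> 0" "T i u = scale z u"
    using ex_eigenvector[OF endomorphism_on_axioms insert.prems(1-3)] by blast
  define E where "E = {u\<in>V. T i u = scale z u}"
  have E: "subspace E"
    by (rule subspaceI) (auto simp: E_def T_zero T_add T_scale scale_right_distrib scale_left_commute
        intro: subspace_0 subspace_add subspace_scale subspace_V)
  have "\<exists>u c. u \<in> E \<and> u \<noteq> 0 \<and> (\<forall>i\<in>I. T i u = scale (c i) u)"
  proof (rule insert.IH)
    show "finite B" "vector_space scale" "module.subspace scale E" by fact+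
    show "E \<subseteq> span B" using insert.prems by (auto simp: E_def)
    show "E \<noteq> {0}" using uz by (auto simp: E_def)
    fix j assume j: "j \<in> I"
    then interpret j: endomorphism_on scale V "T j" using insert.prems by simp
    have "T j w \<in> E" if "w \<in> E" for w
      using that insert.prems(7)[of i j w] j by (auto simp: E_def j.T_closed j.T_scale)
    then show "endomorphism_on scale E (T j)"
      using E by unfold_locales (auto simp: E_def j.T_add j.T_scale)
    fix k w assume "k \<in> I" "w \<in> E"
    then show "T j (T k w) = T k (T j w)" using insert.prems(7) j by (auto simp: E_def)
  qed
  then obtain w c where w: "w \<in> E" "w \<noteq> 0" "\<forall>i\<in>I. T i w = scale (c i) w" by blast
  then show ?case using insert.hyps
    by (intro exI[of _ w] exI[of _ "c(i := z)"]) (auto simp: E_def)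
qed

text \<open>The least value is attained and, as the sequence decreases, never left again.\<close>

lemma antimono_nat_eventually_const:
  fixes f :: "nat \<Rightarrow> nat"
  assumes "\<And>k. k \<ge> k0 \<Longrightarrow> f (Suc k) \<le> f k"
  shows "\<exists>k1\<ge>k0. \<forall>k\<ge>k1. f k = f k1"
proof -
  obtain k1 where k1: "k1 \<ge> k0" "\<And>k. k \<ge> k0 \<Longrightarrow> f k1 \<le> f k"
    using ex_has_least_nat[of "\<lambda>k. k \<ge> k0" k0 f] by blast
  have "f k \<le> f k1" if "k \<ge> k1" for k
    using that by (induction k rule: dec_induct) (use assms k1(1) in \<open>auto intro: order_trans\<close>)
  then show ?thesis using k1 by (metis order_antisym order_trans)
qed

section \<open>Homogeneous polynomial solutions\<close>

text \<open>Eigenvectors are guaranteed over complex scalars, so arrays carry this structure rather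
  than the real one.\<close>

definition fscale :: "complex \<Rightarrow> ('x \<Rightarrow> complex^'m::finite) \<Rightarrow> 'x \<Rightarrow> complex^'m" where
  "fscale c w = (\<lambda>x. c *s w x)"

interpretation fscale: vector_space "fscale :: complex \<Rightarrow> ('x \<Rightarrow> complex^'m::finite) \<Rightarrow> _"
  by unfold_locales (simp_all add: fscale_def fun_eq_iff vector_add_ldistrib vector_sadd_rdistrib)

lemma sum_fun_apply: "sum f S y = (\<Sum>x\<in>S. f x y)"
  by (induction S rule: infinite_finite_induct) simp_all

lemma functions_on_finite_set_fin_dim:
  assumes X: "finite X"
  shows "\<exists>B. finite B \<and> {w :: 'x \<Rightarrow> complex^'m::finite. \<forall>x. w x \<noteq> 0 \<longrightarrow> x \<in> X} \<subseteq> fscale.span B"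
proof -
  define d :: "'x \<times> 'm \<Rightarrow> 'x \<Rightarrow> complex^'m" where "d = (\<lambda>(x, j) y. if y = x then axis j 1 else (0 :: complex^'m))"
  have "w \<in> fscale.span (d ` (X \<times> UNIV))" if w: "\<forall>x. w x \<noteq> 0 \<longrightarrow> x \<in> X" for w :: "'x \<Rightarrow> complex^'m"
  proof -
    have "w y = (\<Sum>p\<in>X \<times> UNIV. fscale (w (fst p) $ snd p) (d p)) y" for y
    proof -
      have "(\<Sum>p\<in>X \<times> UNIV. fscale (w (fst p) $ snd p) (d p)) y
          = (\<Sum>p\<in>X \<times> UNIV. fscale (w (fst p) $ snd p) (d p) y)"
        by (rule sum_fun_apply)
      also have "\<dots> = (\<Sum>x\<in>X. \<Sum>j\<in>UNIV. if y = x then (w x $ j) *s axis j 1 else 0)"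
        by (subst sum.cartesian_product) (auto intro!: sum.cong simp: fscale_def d_def)
      also have "\<dots> = (\<Sum>x\<in>X. if y = x then w x else 0)"
        by (intro sum.cong refl) (simp add: basis_expansion)
      also have "\<dots> = w y" using w X by (auto simp: sum.delta')
      finally show ?thesis by simp
    qed
    then have "w = (\<Sum>p\<in>X \<times> UNIV. fscale (w (fst p) $ snd p) (d p))" by blast
    then show ?thesis
      by (metis (no_types, lifting) fscale.span_base fscale.span_scale fscale.span_sum image_eqI)
  qed
  then show ?thesis using X by (intro exI[of _ "d ` (X \<times> UNIV)"]) auto
qed

section \<open>Complex linear extension of real linear maps\<close>

lemma complexify_add:
  assumes "linear L"
  shows "complexify L (\<eta> + \<zeta>) = complexify L \<eta> + complexify L \<zeta>"
proof -
  have "(\<chi> i. Re ((\<eta> + \<zeta>) $ i)) = (\<chi> i. Re (\<eta> $ i)) + (\<chi> i. Re (\<zeta> $ i))"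
    "(\<chi> i. Im ((\<eta> + \<zeta>) $ i)) = (\<chi> i. Im (\<eta> $ i)) + (\<chi> i. Im (\<zeta> $ i))"
    by (simp_all add: vec_eq_iff)
  then show ?thesis
    unfolding complexify_def using assms by (simp only: linear_add) (simp add: vec_eq_iff complex_eq_iff)
qed

lemma complexify_scale:
  assumes "linear L"
  shows "complexify L (c *s \<eta>) = c *s complexify L \<eta>"
proof -
  have "(\<chi> i. Re ((c *s \<eta>) $ i)) = Re c *\<^sub>R (\<chi> i. Re (\<eta> $ i)) - Im c *\<^sub>R (\<chi> i. Im (\<eta> $ i))"
    "(\<chi> i. Im ((c *s \<eta>) $ i)) = Re c *\<^sub>R (\<chi> i. Im (\<eta> $ i)) + Im c *\<^sub>R (\<chi> i. Re (\<eta> $ i))"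
    by (simp_all add: vec_eq_iff)
  then show ?thesis
    unfolding complexify_def using assms
    by (simp only: linear_add linear_diff linear_scale) (simp add: vec_eq_iff complex_eq_iff)
qed

lemma complexify_zero: "linear L \<Longrightarrow> complexify L 0 = 0"
  using complexify_scale[of L 0 0] by simp

text \<open>Coefficient arrays of the homogeneous polynomial solutions of degree \<open>k\<close> in the variables \<open>J\<close>;
  \<open>w M\<close> stands for the derivative of order \<open>M\<close>, so that \<open>shift i\<close> is \<open>\<partial>\<^sub>i\<close>.\<close>

definition homogeneous_solutions ::
    "('n::finite \<Rightarrow> real^'N::finite \<Rightarrow> real^'K::finite) \<Rightarrow> 'n set \<Rightarrow> nat \<Rightarrow> ('n multiset \<Rightarrow> complex^'N) set" where
  "homogeneous_solutions A J k = {w. (\<forall>M. w M \<noteq> 0 \<longrightarrow> size M = k \<and> set_mset M \<subseteq> J) \<and>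
    (\<forall>M. (\<Sum>i\<in>UNIV. complexify (A i) (w (add_mset i M))) = 0)}"

definition shift :: "'n \<Rightarrow> ('n multiset \<Rightarrow> 'v) \<Rightarrow> 'n multiset \<Rightarrow> 'v" where
  "shift i w = (\<lambda>M. w (add_mset i M))"

lemma shift_commute: "shift i (shift j w) = shift j (shift i w)"
  by (simp add: shift_def add_mset_commute)

lemma linear_shift: "Vector_Spaces.linear fscale fscale (shift i)"
  by unfold_locales (simp_all add: shift_def fscale_def fun_eq_iff vector_add_ldistrib vector_sadd_rdistrib)

lemma shift_add: "shift i (u + w) = shift i u + shift i w"
  and shift_fscale: "shift i (fscale c w) = fscale c (shift i w)"
  by (simp_all add: shift_def fscale_def fun_eq_iff)

lemma shift_homogeneous_solutions:
  "w \<in> homogeneous_solutions A J (Suc k) \<Longrightarrow> shift i w \<in> homogeneous_solutions A J k"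
proof -
  assume w: "w \<in> homogeneous_solutions A J (Suc k)"
  have "(\<Sum>j\<in>UNIV. complexify (A j) (w (add_mset i (add_mset j M)))) = 0" for M
    using w by (subst add_mset_commute) (simp add: homogeneous_solutions_def)
  moreover have "size M = k \<and> set_mset M \<subseteq> J" if "w (add_mset i M) \<noteq> 0" for M
    using w that unfolding homogeneous_solutions_def by (metis (mono_tags, lifting) insert_subset
      mem_Collect_eq nat.inject set_mset_add_mset_insert size_add_mset)
  ultimately show ?thesis by (simp add: homogeneous_solutions_def shift_def)
qed

lemma subspace_homogeneous_solutions:
  assumes A: "\<And>i. linear (A i)"
  shows "fscale.subspace (homogeneous_solutions A J k)"
proof (rule fscale.subspaceI)
  show "0 \<in> homogeneous_solutions A J k"
    by (simp add: homogeneous_solutions_def complexify_zero A)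
next
  fix u w assume uw: "u \<in> homogeneous_solutions A J k" "w \<in> homogeneous_solutions A J k"
  have "u M \<noteq> 0 \<or> w M \<noteq> 0" if "(u + w) M \<noteq> 0" for M using that by auto
  moreover have "(\<Sum>i\<in>UNIV. complexify (A i) ((u + w) (add_mset i M))) = 0" for M
    using uw by (simp add: homogeneous_solutions_def complexify_add A sum.distrib)
  ultimately show "u + w \<in> homogeneous_solutions A J k"
    using uw unfolding homogeneous_solutions_def by blast
next
  fix c u assume u: "u \<in> homogeneous_solutions A J k"
  have "(\<Sum>i\<in>UNIV. complexify (A i) (fscale c u (add_mset i M)))
      = c *s (\<Sum>i\<in>UNIV. complexify (A i) (u (add_mset i M)))" for M
    by (simp add: complexify_scale A fscale_def vec.scale_sum_right)
  moreover have "u M \<noteq> 0" if "fscale c u M \<noteq> 0" for M using that by (auto simp: fscale_def)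
  ultimately show "fscale c u \<in> homogeneous_solutions A J k"
    using u unfolding homogeneous_solutions_def by auto
qed

lemma fin_dim_homogeneous_solutions:
  fixes A :: "'n::finite \<Rightarrow> real^'N::finite \<Rightarrow> real^'K::finite"
  shows "\<exists>B. finite B \<and> homogeneous_solutions A J k \<subseteq> fscale.span B"
proof -
  have fin: "finite {M :: 'n multiset. size M = k}"
    using finite_multisets_of_size[OF finite[of UNIV], where n = k] by (simp add: multisets_of_size_def)
  obtain B :: "('n multiset \<Rightarrow> complex^'N) set"
    where B: "finite B \<and> {w. \<forall>M. w M \<noteq> 0 \<longrightarrow> M \<in> {M. size M = k}} \<subseteq> fscale.span B"
    using functions_on_finite_set_fin_dim[where 'm = 'N, OF fin] by (elim exE)
  have "homogeneous_solutions A J k \<subseteq> {w. \<forall>M. w M \<noteq> 0 \<longrightarrow> M \<in> {M. size M = k}}"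
    by (auto simp: homogeneous_solutions_def)
  with B show ?thesis by (meson order_trans)
qed

text \<open>A polynomial whose derivative in the variable \<open>j\<close> vanishes does not contain
  that variable.\<close>

lemma kernel_shift:
  assumes "w \<in> homogeneous_solutions A (insert j J) k" "shift j w = 0"
  shows "w \<in> homogeneous_solutions A J k"
proof -
  have "w M = 0" if "j \<in># M" for M
    using assms(2) multi_member_split[OF that] by (auto simp: shift_def fun_eq_iff)
  then show ?thesis using assms(1) unfolding homogeneous_solutions_def by blast
qed

text \<open>The hypothesis lets every index of an entry be traded for \<open>j\<close> at the cost
  of a factor, so \<open>w\<close> is the array of derivatives of a multiple of
  \<open>(\<xi> . x)^(k+1) \<eta>\<close> with \<open>\<xi> $ j = 1\<close>. The equation for
  \<open>w\<close> at \<open>k\<close> copies of \<open>j\<close> then reads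
  \<open>symbol A \<xi> \<eta> = 0\<close>.\<close>

lemma homogeneous_solution_eigenvector:
  assumes A: "\<And>i. linear (A i)"
    and w: "w \<in> homogeneous_solutions A J (Suc k)" "w \<noteq> 0"
    and j: "j \<in> J" and eig: "\<And>i. i \<in> J \<Longrightarrow> shift i w = fscale (c i) (shift j w)"
  shows "\<not> C_elliptic A"
proof
  assume ell: "C_elliptic A"
  have cj: "shift j w \<noteq> 0 \<Longrightarrow> c j = 1"
    using eig[OF j] fscale.scale_cancel_right[of 1 "shift j w" "c j"] by auto
  have J: "w M = 0" if "\<not> set_mset M \<subseteq> J" for M
    using w(1) that by (auto simp: homogeneous_solutions_def)
  \<comment> \<open>Entries with an index outside \<open>J\<close> vanish, which matches a component
    0 of \<open>\<xi>\<close> there.\<close>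
  define \<xi> where "\<xi> = (\<chi> i. if i \<in> J then c i else 0)"
  define \<eta> where "\<eta> = w (replicate_mset (Suc k) j)"
  have move: "w (add_mset i M) = \<xi> $ i *s w (add_mset j M)" for i M
  proof (cases "i \<in> J")
    case True
    then show ?thesis using fun_cong[OF eig[OF True], of M] by (simp add: shift_def fscale_def \<xi>_def)
  qed (simp add: \<xi>_def J)
  \<comment> \<open>Only the existence of the factor is needed: if \<open>\<eta>\<close> were 0, all
    entries of \<open>w\<close> would be.\<close>
  have mult: "\<exists>z. w (M + replicate_mset m j) = z *s w (replicate_mset (size M + m) j)" for M m
  proof (induction M arbitrary: m)
    case empty
    show ?case by (intro exI[of _ 1]) simp
  next
    case (add i M)
    obtain z where "w (M + replicate_mset (Suc m) j) = z *s w (replicate_mset (size M + Suc m) j)"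
      using add by blast
    then show ?case
      using move[of i "M + replicate_mset m j"] by (intro exI[of _ "\<xi> $ i * z"]) simp
  qed
  have "\<eta> \<noteq> 0"
  proof
    assume "\<eta> = 0"
    have "w M = 0" for M
    proof (cases "size M = Suc k")
      case True
      then show ?thesis using mult[of M 0] \<open>\<eta> = 0\<close> by (auto simp: \<eta>_def)
    next
      case False
      then show ?thesis using w(1) by (auto simp: homogeneous_solutions_def)
    qed
    with w(2) show False by (auto simp: fun_eq_iff)
  qed
  have "shift j w (replicate_mset k j) = \<eta>" by (simp add: shift_def \<eta>_def)
  with \<open>\<eta> \<noteq> 0\<close> have "shift j w \<noteq> 0" by auto
  with cj j have "\<xi> $ j = 1" by (simp add: \<xi>_def)
  then have "\<xi> \<noteq> 0" by auto
  have "symbol A \<xi> \<eta> = (\<Sum>i\<in>UNIV. complexify (A i) (w (add_mset i (replicate_mset k j))))"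
    unfolding symbol_def by (subst move) (simp add: \<eta>_def complexify_scale A)
  also have "\<dots> = 0" using w(1) by (simp add: homogeneous_solutions_def)
  also have "0 = symbol A \<xi> 0" by (simp add: symbol_def complexify_zero A)
  finally show False
    using ell \<open>\<xi> \<noteq> 0\<close> \<open>\<eta> \<noteq> 0\<close> unfolding C_elliptic_def inj_def by blast
qed

lemma homogeneous_solutions_eventually_zero:
  fixes A :: "'n::finite \<Rightarrow> real^'N::finite \<Rightarrow> real^'K::finite"
  assumes A: "\<And>i. linear (A i)" and ell: "C_elliptic A"
  shows "\<exists>k0. \<forall>k\<ge>k0. homogeneous_solutions A J k = {0}"
proof (induction J rule: infinite_finite_induct)
  case (infinite J)
  then show ?case by simp
next
  case empty
  \<comment> \<open>Without variables only the constants of degree 0 are left, hence the bound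
    1.\<close>
  have "w = 0" if "w \<in> homogeneous_solutions A {} k" "k \<ge> 1" for w k
    using that by (auto simp: homogeneous_solutions_def fun_eq_iff)
  then have "\<forall>k\<ge>1. homogeneous_solutions A {} k = {0}"
    using fscale.subspace_0[OF subspace_homogeneous_solutions[of A "{}"]] A by blast
  then show ?case by blast
next
  case (insert j J)
  let ?N = "homogeneous_solutions A (insert j J)"
  let ?s = "shift j :: ('n multiset \<Rightarrow> complex^'N) \<Rightarrow> _"
  note sub = subspace_homogeneous_solutions[of A "insert j J", OF A]
  obtain k0 where k0: "\<And>k. k \<ge> k0 \<Longrightarrow> homogeneous_solutions A J k = {0}" using insert by blast
  \<comment> \<open>Two arrays with the same derivative along \<open>j\<close> differ by a solution
    in the variables \<open>J\<close>, of degree \<open>Suc k\<close>, which is 0.\<close>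
  have inj: "inj_on ?s (?N (Suc k))" if "k \<ge> k0" for k
  proof (rule inj_onI)
    fix u w assume uw: "u \<in> ?N (Suc k)" "w \<in> ?N (Suc k)" "?s u = ?s w"
    have "u - w \<in> ?N (Suc k)" using fscale.subspace_diff[OF sub] uw by blast
    moreover have "?s (u - w) = 0" using uw(3) by (auto simp: shift_def fun_eq_iff)
    ultimately have "u - w \<in> homogeneous_solutions A J (Suc k)" by (rule kernel_shift)
    then have "u - w \<in> {0}" using k0[of "Suc k"] that by simp
    then show "u = w" by simp
  qed
  have le: "fscale.dim (?N (Suc k)) \<le> fscale.dim (?N k)"
    and onto: "fscale.dim (?N (Suc k)) = fscale.dim (?N k) \<Longrightarrow> ?s ` ?N (Suc k) = ?N k" if "k \<ge> k0" for k
  proof -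
    obtain B C where "finite B" "?N (Suc k) \<subseteq> fscale.span B" "finite C" "?N k \<subseteq> fscale.span C"
      using fin_dim_homogeneous_solutions by metis
    moreover have "?s ` ?N (Suc k) \<subseteq> ?N k" using shift_homogeneous_solutions by blast
    ultimately show "fscale.dim (?N (Suc k)) \<le> fscale.dim (?N k)"
      "fscale.dim (?N (Suc k)) = fscale.dim (?N k) \<Longrightarrow> ?s ` ?N (Suc k) = ?N k"
      using fscale.dim_le_of_injective[OF sub _ _ sub _ _ linear_shift inj[OF that], of B C] by simp_all
  qed
  \<comment> \<open>From \<open>k1\<close> on the dimensions agree, so that differentiation along
    \<open>j\<close> is bijective at every degree.\<close>
  obtain k1 where k1: "k1 \<ge> k0" "\<And>k. k \<ge> k1 \<Longrightarrow> fscale.dim (?N k) = fscale.dim (?N k1)"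
    using antimono_nat_eventually_const[of k0 "\<lambda>k. fscale.dim (?N k)"] le by blast
  have bij: "bij_betw ?s (?N (Suc k)) (?N k)" if "k \<ge> k1" for k
    unfolding bij_betw_def
  proof
    have "k \<ge> k0" using that k1(1) by simp
    then show "inj_on ?s (?N (Suc k))" by (rule inj)
    show "?s ` ?N (Suc k) = ?N k"
      using k1(2)[OF that] k1(2)[of "Suc k"] that by (intro onto[OF \<open>k \<ge> k0\<close>]) simp
  qed
  have "?N k = {0}" if k: "k \<ge> k1" for k
  proof (rule ccontr)
    assume ne: "?N k \<noteq> {0}"
    \<comment> \<open>Integration along \<open>j\<close>, from degree \<open>k\<close> to degree
      \<open>Suc k\<close>.\<close>
    define g where "g = the_inv_into (?N (Suc k)) ?s"
    have g: "g u \<in> ?N (Suc k)" "?s (g u) = u" if "u \<in> ?N k" for u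
      using that bij[OF k] the_inv_into_into[of ?s "?N (Suc k)" u "?N (Suc k)"]
        f_the_inv_into_f[of ?s "?N (Suc k)" u]
      unfolding g_def bij_betw_def by auto
    have gs: "g (?s w) = w" if "w \<in> ?N (Suc k)" for w
      using that bij[OF k] unfolding g_def bij_betw_def by (auto intro: the_inv_into_f_f)
    obtain B where B: "finite B" "?N k \<subseteq> fscale.span B"
      using fin_dim_homogeneous_solutions by metis
    have endo: "endomorphism_on fscale (?N k) (\<lambda>u. shift i (g u))" for i
    proof
      show "fscale.subspace (?N k)" by (rule sub)
      fix u w c assume u: "u \<in> ?N k"
      show "shift i (g u) \<in> ?N k" using g u shift_homogeneous_solutions by blast
      have "g (fscale c u) = g (?s (fscale c (g u)))" using u g by (simp add: shift_fscale)
      also have "\<dots> = fscale c (g u)" by (intro gs fscale.subspace_scale[OF sub] g u)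
      finally show "shift i (g (fscale c u)) = fscale c (shift i (g u))" by (simp add: shift_fscale)
      assume w: "w \<in> ?N k"
      have "g (u + w) = g (?s (g u + g w))" using u w g by (simp add: shift_add)
      also have "\<dots> = g u + g w" by (intro gs fscale.subspace_add[OF sub] g u w)
      finally show "shift i (g (u + w)) = shift i (g u) + shift i (g w)" by (simp add: shift_add)
    qed
    \<comment> \<open>Integrating once more reduces this to the commutation of shifts: with
      \<open>w\<close> of degree \<open>k + 2\<close> such that \<open>shift j w = g u\<close>, both
      sides are second derivatives of \<open>w\<close>.\<close>
    have comm: "shift i (g (shift l (g u))) = shift l (g (shift i (g u)))" if u: "u \<in> ?N k" for u i l
    proof -
      obtain w where w: "w \<in> ?N (Suc (Suc k))" "?s w = g u"
        using bij[of "Suc k"] k g(1)[of u] u unfolding bij_betw_def by (metis imageE le_Suc_eq)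
      have "shift i (g (shift l (g u))) = shift i (shift l w)" for i l
        using gs[OF shift_homogeneous_solutions[OF w(1)], of l] w(2) shift_commute[of l j w] by simp
      then show ?thesis using shift_commute by metis
    qed
    obtain u c where u: "u \<in> ?N k" "u \<noteq> 0" "\<And>i. shift i (g u) = fscale (c i) u"
      using ex_common_eigenvector[OF _ B ne fscale.vector_space_axioms sub, of UNIV "\<lambda>i u. shift i (g u)"]
        endo comm by auto
    \<comment> \<open>For the array \<open>g u\<close> the eigenvector equations say that all its
      derivatives are multiples of the one along \<open>j\<close>.\<close>
    have "\<not> C_elliptic A"
    proof (rule homogeneous_solution_eigenvector[OF A])
      show "g u \<in> ?N (Suc k)" by (rule g(1)[OF u(1)])
      show "g u \<noteq> 0"
      proof
        assume "g u = 0"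
        then have "?s 0 = u" using g(2)[OF u(1)] by simp
        with u(2) show False by (auto simp: shift_def)
      qed
      show "shift i (g u) = fscale (c i) (shift j (g u))" for i
        by (simp only: u(3)[of i] g(2)[OF u(1)])
    qed simp
    with ell show False by simp
  qed
  then show ?case by blast
qed

section \<open>Smooth functions and fiber integrals\<close>

lemma partial_eqI: "(f has_derivative f') (at x) \<Longrightarrow> partial i f x = f' (axis i 1)"
  by (simp add: partial_def frechet_derivative_at[symmetric])

text \<open>Serves to prove smoothness by exhibiting a family \<open>S\<close> around
  \<open>f\<close>, without computing iterated partial derivatives.\<close>

lemma smooth_coinduct:
  assumes "f \<in> S" "\<And>f. f \<in> S \<Longrightarrow> f differentiable_on UNIV" "\<And>f i. f \<in> S \<Longrightarrow> partial i f \<in> S"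
  shows "smooth f"
proof -
  have "partials is f \<in> S" for "is"
    by (induction "is") (use assms in \<open>auto simp: partials_Cons\<close>)
  then show ?thesis using assms(2) by (auto simp: smooth_def)
qed

lemma smooth_imp_differentiable: "smooth f \<Longrightarrow> f differentiable at x"
  using smooth_differentiable[of f "[]"] by simp

lemma smooth_has_derivative:
  assumes "smooth f"
  shows "(f has_derivative (\<lambda>h. \<Sum>j\<in>UNIV. h $ j * partial j f x)) (at x)"
proof -
  have D: "(f has_derivative frechet_derivative f (at x)) (at x)"
    using has_derivative_partials[OF assms, of "[]"] by simp
  have "frechet_derivative f (at x) h = (\<Sum>j\<in>UNIV. h $ j * partial j f x)" for h
  proof -
    have "frechet_derivative f (at x) h = frechet_derivative f (at x) (\<Sum>j\<in>UNIV. h $ j *\<^sub>R axis j 1)"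
      by (simp add: basis_expansion flip: scalar_mult_eq_scaleR)
    also have "\<dots> = (\<Sum>j\<in>UNIV. h $ j * partial j f x)"
      using has_derivative_linear[OF D] by (simp add: linear_sum linear_scale partial_def)
    finally show ?thesis .
  qed
  then have "frechet_derivative f (at x) = (\<lambda>h. \<Sum>j\<in>UNIV. h $ j * partial j f x)" by blast
  with D show ?thesis by simp
qed

lemma smooth_continuous: "smooth f \<Longrightarrow> continuous_on S f"
  using smooth_imp_differentiable differentiable_imp_continuous_within
  by (metis continuous_at_imp_continuous_on)

lemma smooth_const: "smooth (\<lambda>x. c)"
proof (rule smooth_coinduct[of _ "range (\<lambda>c x. c)"])
  fix f :: "real^'a \<Rightarrow> real" and i assume "f \<in> range (\<lambda>c x. c)"
  then have "partial i f = (\<lambda>x. 0)" by (auto simp: partial_def)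
  then show "partial i f \<in> range (\<lambda>c x. c)" by blast
qed auto

lemma smooth_nth: "smooth (\<lambda>x. x $ i)"
proof (rule smooth_coinduct[of _ "insert (\<lambda>x. x $ i) (Collect smooth)"])
  fix f :: "real^'a \<Rightarrow> real" and j assume f: "f \<in> insert (\<lambda>x. x $ i) (Collect smooth)"
  have D: "((\<lambda>x. x $ i) has_derivative (\<lambda>h. h $ i)) (at x)" for x :: "real^'a"
    by (rule bounded_linear_imp_has_derivative[OF bounded_linear_vec_nth])
  have "partial j (\<lambda>x. x $ i) = (\<lambda>x. axis j 1 $ i)"
    by (rule ext) (rule partial_eqI[OF D])
  moreover have "(\<lambda>x. x $ i) differentiable at x" for x :: "real^'a"
    by (rule differentiableI[OF D])
  ultimately have "partial j (\<lambda>x. x $ i) = (\<lambda>x. axis j 1 $ i)"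
    "\<And>x :: real^'a. (\<lambda>x. x $ i) differentiable at x" by auto
  with f show "partial j f \<in> insert (\<lambda>x. x $ i) (Collect smooth)" "f differentiable_on UNIV"
    by (auto simp: smooth_partial smooth_const intro: smooth_imp_differentiable differentiable_at_imp_differentiable_on)
qed simp

text \<open>The product rule leads out of the set of products of smooth functions, but not out of
  the set of their finite sums. This is the family for the coinduction in
  \<open>smooth_mult\<close>.\<close>

inductive_set smooth_products :: "(real^'n::finite \<Rightarrow> real) set" where
  mult: "smooth f \<Longrightarrow> smooth g \<Longrightarrow> (\<lambda>x. f x * g x) \<in> smooth_products"
| add: "f \<in> smooth_products \<Longrightarrow> g \<in> smooth_products \<Longrightarrow> (\<lambda>x. f x + g x) \<in> smooth_products"

lemma partial_add:
  "f differentiable at x \<Longrightarrow> g differentiable at x \<Longrightarrow>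
    partial i (\<lambda>x. f x + g x) x = partial i f x + partial i g x"
  unfolding partial_def frechet_derivative_works
  by (subst frechet_derivative_at[OF has_derivative_add, symmetric]) auto

lemma partial_mult:
  "f differentiable at x \<Longrightarrow> g differentiable at x \<Longrightarrow>
    partial i (\<lambda>x. f x * g x) x = f x * partial i g x + partial i f x * g x"
  unfolding partial_def frechet_derivative_works
  by (subst frechet_derivative_at[OF has_derivative_mult, symmetric]) auto

lemma smooth_mult:
  assumes "smooth f" "smooth g"
  shows "smooth (\<lambda>x. f x * g x)"
proof (rule smooth_coinduct[of _ smooth_products])
  show "(\<lambda>x. f x * g x) \<in> smooth_products" by (rule smooth_products.mult[OF assms])
  have diff: "f differentiable at x" if "f \<in> smooth_products" for f :: "real^'a \<Rightarrow> real" and x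
    using that by induction (auto intro: differentiable_mult differentiable_add smooth_imp_differentiable)
  then show "f differentiable_on UNIV" if "f \<in> smooth_products" for f :: "real^'a \<Rightarrow> real"
    using that by (auto intro: differentiable_at_imp_differentiable_on)
  show "partial i f \<in> smooth_products" if "f \<in> smooth_products" for f :: "real^'a \<Rightarrow> real" and i
    using that
  proof induction
    case (mult f g)
    then have "partial i (\<lambda>x. f x * g x) = (\<lambda>x. f x * partial i g x + partial i f x * g x)"
      by (auto simp: partial_mult smooth_imp_differentiable)
    with mult show ?case by (auto intro!: smooth_products.intros smooth_partial)
  next
    case (add f g)
    then have "partial i (\<lambda>x. f x + g x) = (\<lambda>x. partial i f x + partial i g x)"
      by (auto simp: partial_add diff)
    with add show ?case by (auto intro!: smooth_products.intros)
  qed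
qed

lemma smooth_power: "smooth f \<Longrightarrow> smooth (\<lambda>x. f x ^ k)"
  by (induction k) (simp_all add: smooth_const smooth_mult)

lemma smooth_prod: "(\<And>i. i \<in> I \<Longrightarrow> smooth (f i)) \<Longrightarrow> smooth (\<lambda>x. \<Prod>i\<in>I. f i x)"
  by (induction I rule: infinite_finite_induct) (simp_all add: smooth_const smooth_mult)

lemma smooth_sum: "(\<And>i. i \<in> I \<Longrightarrow> smooth (f i)) \<Longrightarrow> smooth (\<lambda>x. \<Sum>i\<in>I. f i x)"
  by (induction I rule: infinite_finite_induct) (simp_all add: smooth_const smooth_add)

lemma smooth_diff: "smooth f \<Longrightarrow> smooth g \<Longrightarrow> smooth (\<lambda>x. f x - g x)"
  using smooth_add[OF _ smooth_scale[of g "-1"], of f] by simp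

section \<open>Test functions as a predicate on functions\<close>

definition is_test :: "(real^'n::finite \<Rightarrow> real) \<Rightarrow> bool" where
  "is_test f \<longleftrightarrow> smooth f \<and> compact (supp f)"

lemma is_test_apply_test [simp]: "is_test (apply_test \<phi>)"
  by (simp add: is_test_def smooth_apply_test compact_supp_apply_test)

lemma apply_Abs_test [simp]: "is_test f \<Longrightarrow> apply_test (Abs_test f) = f"
  by (simp add: is_test_def Abs_test_inverse)

text \<open>Supports are easier to control through a bound for the points with
  \<open>f x \<noteq> 0\<close>; in a Euclidean space compactness of the closure amounts to
  this.\<close>

lemma is_test_iff: "is_test f \<longleftrightarrow> smooth f \<and> (\<exists>R. \<forall>x. f x \<noteq> 0 \<longrightarrow> norm x \<le> R)"
proof -
  have "bounded (support_on UNIV f) \<longleftrightarrow> (\<exists>R. \<forall>x. f x \<noteq> 0 \<longrightarrow> norm x \<le> R)"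
    by (auto simp: bounded_iff support_on_def)
  then show ?thesis
    by (simp add: is_test_def supp_def compact_closure)
qed

lemma is_testE:
  assumes "is_test f"
  obtains R where "0 < R" "\<And>x. f x \<noteq> 0 \<Longrightarrow> norm x \<le> R"
proof -
  obtain R where "\<And>x. f x \<noteq> 0 \<Longrightarrow> norm x \<le> R" using assms by (auto simp: is_test_iff)
  then show ?thesis using that[of "max R 1"] by (simp add: le_max_iff_disj)
qed

lemma is_test_smooth: "is_test f \<Longrightarrow> smooth f"
  by (simp add: is_test_def)

lemma is_test_mult: "smooth g \<Longrightarrow> is_test f \<Longrightarrow> is_test (\<lambda>x. g x * f x)"
  by (auto simp: is_test_iff smooth_mult)

lemma is_test_partial: "is_test f \<Longrightarrow> is_test (partial i f)"
  by (auto simp: is_test_def smooth_partial intro: compact_supp_mono[OF _ supp_partial])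

lemma is_test_zero: "is_test (\<lambda>x. 0)"
  by (simp add: is_test_iff smooth_const)

lemma is_test_add:
  assumes "is_test f" "is_test g"
  shows "is_test (\<lambda>x. f x + g x)"
  using is_test_apply_test[of "Abs_test f + Abs_test g"] assms by (simp add: plus_test_function.rep_eq)

lemma is_test_sum: "(\<And>i. i \<in> I \<Longrightarrow> is_test (f i)) \<Longrightarrow> is_test (\<lambda>x. \<Sum>i\<in>I. f i x)"
  by (induction I rule: infinite_finite_induct) (simp_all add: is_test_zero is_test_add)

lemma is_test_diff: "is_test f \<Longrightarrow> is_test g \<Longrightarrow> is_test (\<lambda>x. f x - g x)"
  using is_test_add[of f "\<lambda>x. - 1 * g x"] is_test_mult[OF smooth_const, of g "-1"] by simp

lemma integrable_continuous_bounded_support: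
  fixes f :: "'a::euclidean_space \<Rightarrow> real"
  assumes "continuous_on UNIV f" "\<And>x. f x \<noteq> 0 \<Longrightarrow> norm x \<le> R"
  shows "integrable lborel f"
proof -
  have "integrable lborel (\<lambda>x. indicator (cball 0 R) x *\<^sub>R f x)"
    using assms(1) by (intro borel_integrable_compact) (auto intro: continuous_on_subset)
  also have "(\<lambda>x. indicator (cball 0 R) x *\<^sub>R f x) = f"
    using assms(2) by (fastforce simp: indicator_def)
  finally show ?thesis .
qed

lemma integrable_test: "is_test f \<Longrightarrow> integrable lborel f"
  by (metis is_testE is_test_smooth integrable_continuous_bounded_support smooth_continuous)

text \<open>The set \<open>S\<close> is either the whole line, or the half line that yields the antiderivative
  vanishing at \<open>-\<infinity>\<close>.\<close>

definition fiber_integral :: "real set \<Rightarrow> 'n::finite \<Rightarrow> (real^'n \<Rightarrow> real) \<Rightarrow> real^'n \<Rightarrow> real" where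
  "fiber_integral S i f x = (LBINT s:S. f (x + s *\<^sub>R axis i 1))"

text \<open>Reduces integrals over the line or a half line to compact intervals, on which the
  fundamental theorem and differentiation under the integral are applied. Both sets of interest meet
  \<open>{-r..r}\<close> in an interval starting at \<open>-r\<close>.\<close>

lemma set_integral_eq_integral_Icc:
  fixes g :: "real \<Rightarrow> real"
  assumes "continuous_on UNIV g" "\<And>s. g s \<noteq> 0 \<Longrightarrow> \<bar>s\<bar> \<le> r" "S \<inter> {-r..r} = {-r..b}"
  shows "(LBINT s:S. g s) = integral {-r..b} g"
proof -
  have "indicator S s *\<^sub>R g s = indicator {-r..b} s *\<^sub>R g s" for s
  proof (cases "g s = 0")
    case False
    then have "s \<in> S \<longleftrightarrow> s \<in> S \<inter> {-r..r}" using assms(2)[of s] by auto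
    then show ?thesis unfolding assms(3) by (simp add: indicator_def)
  qed simp
  then have "(LBINT s:S. g s) = (LBINT s:{-r..b}. g s)"
    unfolding set_lebesgue_integral_def by presburger
  also have "\<dots> = integral {-r..b} g"
    using assms(1) by (intro set_borel_integral_eq_integral borel_integrable_atLeastAtMost')
      (auto intro: continuous_on_subset)
  finally show ?thesis .
qed

lemma continuous_on_line: "continuous_on UNIV f \<Longrightarrow> continuous_on S (\<lambda>s. f (x + s *\<^sub>R (axis i 1 :: real^'n::finite)))"
  by (rule continuous_on_compose2[of UNIV f]) (auto intro!: continuous_intros)

text \<open>One interval works for all \<open>x\<close> with \<open>norm x + R \<le> r\<close>,
  hence on a whole ball, where the integral can be differentiated.\<close>

lemma fiber_integral_eq_integral:
  assumes "is_test f" "\<And>x. f x \<noteq> 0 \<Longrightarrow> norm x \<le> R" "norm x + R \<le> r" "S \<inter> {-r..r} = {-r..b}"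
  shows "fiber_integral S i f x = integral {-r..b} (\<lambda>s. f (x + s *\<^sub>R axis i 1))"
  unfolding fiber_integral_def
proof (rule set_integral_eq_integral_Icc[OF _ _ assms(4)])
  show "continuous_on UNIV (\<lambda>s. f (x + s *\<^sub>R axis i 1))"
    using assms(1) by (intro continuous_on_line smooth_continuous is_test_smooth)
  fix s assume "f (x + s *\<^sub>R axis i 1) \<noteq> 0"
  then have "norm (x + s *\<^sub>R axis i 1) \<le> R" by (rule assms(2))
  moreover have "norm (s *\<^sub>R axis i 1 :: real^'a) \<le> norm (x + s *\<^sub>R axis i 1) + norm x"
    by (metis add_diff_cancel_left' norm_triangle_ineq4)
  ultimately show "\<bar>s\<bar> \<le> r" using assms(3) by simp
qed

abbreviation ray :: "real set \<Rightarrow> bool" where "ray S \<equiv> S = UNIV \<or> S = {..0}"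

lemma ray_Int:
  assumes "ray S" "0 \<le> r"
  obtains b where "S \<inter> {-r..r} = {-r..b}"
proof -
  have "S \<inter> {-r..r} = {-r..r} \<or> S \<inter> {-r..r} = {-r..0}" using assms by auto
  with that show ?thesis by blast
qed

text \<open>Near \<open>x\<close> the fiber integral is an integral over a fixed compact interval,
  and the Leibniz rule differentiates it under the integral sign.\<close>

lemma fiber_integral_has_derivative:
  assumes f: "is_test f" and S: "ray S"
  shows "(fiber_integral S i f has_derivative (\<lambda>h. \<Sum>j\<in>UNIV. h $ j * fiber_integral S i (partial j f) x)) (at x)"
proof -
  obtain R where R: "0 < R" "\<And>x. f x \<noteq> 0 \<Longrightarrow> norm x \<le> R" using is_testE[OF f] by blast
  have Rp: "norm x \<le> R" if "partial j f x \<noteq> 0" for j x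
  proof (rule ccontr)
    assume "\<not> norm x \<le> R"
    then have "x \<notin> cball 0 R" by simp
    moreover have "supp f \<subseteq> cball 0 R"
      unfolding supp_def by (rule closure_minimal) (use R(2) in \<open>auto simp: support_on_def\<close>)
    ultimately show False using that partial_notin_supp by blast
  qed
  \<comment> \<open>The summand 1 lets the same interval serve for all points of the ball
    \<open>U\<close>, an open neighbourhood of \<open>x\<close>.\<close>
  define r where "r = norm x + 1 + R"
  have "0 \<le> r" using R by (simp add: r_def add_nonneg_nonneg)
  then obtain b where b: "S \<inter> {-r..r} = {-r..b}" using ray_Int[OF S] by blast
  define U where "U = ball (0 :: real^'a) (norm x + 1)"
  have U: "open U" "convex U" "x \<in> U" by (auto simp: U_def)
  \<comment> \<open>The Leibniz rule wants the derivative as a bounded linear function depending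
    continuously on \<open>(y, s)\<close>; it is assembled from the coordinate functionals.\<close>
  define B where "B j = Blinfun (\<lambda>h :: real^'a. h $ j)" for j
  have B: "blinfun_apply (B j) h = h $ j" for j h
    unfolding B_def by (simp add: bounded_linear_Blinfun_apply bounded_linear_vec_nth)
  let ?D = "\<lambda>y s. \<Sum>j\<in>UNIV. partial j f (y + s *\<^sub>R axis i 1) *\<^sub>R B j"
  have sm: "smooth f" "\<And>j. smooth (partial j f)" using f by (auto simp: is_test_def smooth_partial)
  have cont: "continuous_on T (\<lambda>(y, s). ?D y s)" for T
    unfolding split_beta
    by (intro continuous_intros continuous_on_compose2[OF smooth_continuous[OF sm(2), where S = UNIV]]) auto
  have cont1: "continuous_on T (?D y)" for y T
    by (intro continuous_intros continuous_on_compose2[OF smooth_continuous[OF sm(2), where S = UNIV]]) auto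
  have "((\<lambda>y. integral (cbox (-r) b) (\<lambda>s. f (y + s *\<^sub>R axis i 1))) has_derivative
      blinfun_apply (integral (cbox (-r) b) (?D x))) (at x within U)"
  proof (rule leibniz_rule)
    fix y s
    have "((\<lambda>y. f (y + s *\<^sub>R axis i 1)) has_derivative
        (\<lambda>h. \<Sum>j\<in>UNIV. h $ j * partial j f (y + s *\<^sub>R axis i 1))) (at y within U)"
      by (rule has_derivative_compose[OF _ smooth_has_derivative[OF sm(1)]]) (auto intro!: derivative_eq_intros)
    moreover have "blinfun_apply (?D y s) = (\<lambda>h. \<Sum>j\<in>UNIV. h $ j * partial j f (y + s *\<^sub>R axis i 1))"
      by (simp add: fun_eq_iff blinfun.sum_left blinfun.scaleR_left B mult.commute)
    ultimately show "((\<lambda>y. f (y + s *\<^sub>R axis i 1)) has_derivative blinfun_apply (?D y s)) (at y within U)"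
      by simp
    show "(\<lambda>s. f (y + s *\<^sub>R axis i 1)) integrable_on cbox (- r) b"
      by (intro integrable_continuous continuous_on_line smooth_continuous sm)
  qed (use U cont in auto)
  moreover have deriv: "blinfun_apply (integral (cbox (-r) b) (?D x)) h
      = (\<Sum>j\<in>UNIV. h $ j * fiber_integral S i (partial j f) x)" for h
  proof -
    have "blinfun_apply (integral (cbox (-r) b) (?D x)) h
        = integral (cbox (-r) b) (\<lambda>s. blinfun_apply (?D x s) h)"
      by (rule blinfun_apply_integral[OF integrable_continuous[OF cont1]])
    also have "\<dots> = integral (cbox (-r) b) (\<lambda>s. \<Sum>j\<in>UNIV. h $ j * partial j f (x + s *\<^sub>R axis i 1))"
      by (simp add: blinfun.sum_left blinfun.scaleR_left B mult.commute[of "_ $ _"])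
    also have "\<dots> = (\<Sum>j\<in>UNIV. h $ j * integral (cbox (-r) b) (\<lambda>s. partial j f (x + s *\<^sub>R axis i 1)))"
      by (subst integral_sum) (auto intro!: integrable_continuous_real continuous_on_mult
          continuous_on_const continuous_on_line smooth_continuous smooth_scale sm)
    also have "\<dots> = (\<Sum>j\<in>UNIV. h $ j * fiber_integral S i (partial j f) x)"
      using fiber_integral_eq_integral[OF is_test_partial[OF f] Rp _ b, where x = x and i = i]
      by (simp add: r_def)
    finally show ?thesis .
  qed
  ultimately have "((\<lambda>y. integral (cbox (-r) b) (\<lambda>s. f (y + s *\<^sub>R axis i 1))) has_derivative
      (\<lambda>h. \<Sum>j\<in>UNIV. h $ j * fiber_integral S i (partial j f) x)) (at x within U)"
    by (simp only: deriv[THEN ext])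
  then have "((\<lambda>y. integral (cbox (-r) b) (\<lambda>s. f (y + s *\<^sub>R axis i 1))) has_derivative
      (\<lambda>h. \<Sum>j\<in>UNIV. h $ j * fiber_integral S i (partial j f) x)) (at x)"
    by (simp only: at_within_open[OF U(3,1)])
  then show ?thesis
  proof (rule has_derivative_transform_within_open[OF _ U(1,3)])
    fix y assume "y \<in> U"
    then show "integral (cbox (-r) b) (\<lambda>s. f (y + s *\<^sub>R axis i 1)) = fiber_integral S i f y"
      using fiber_integral_eq_integral[OF f R(2) _ b, where x = y and i = i] by (simp add: U_def r_def)
  qed
qed

lemma partial_fiber_integral:
  assumes "is_test f" "ray S"
  shows "partial j (fiber_integral S i f) = fiber_integral S i (partial j f)"
proof
  fix x
  have "partial j (fiber_integral S i f) x = (\<Sum>k\<in>UNIV. axis j 1 $ k * fiber_integral S i (partial k f) x)"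
    by (rule partial_eqI[OF fiber_integral_has_derivative[OF assms]])
  also have "\<dots> = (\<Sum>k\<in>UNIV. if k = j then fiber_integral S i (partial k f) x else 0)"
    by (intro sum.cong) (auto simp: axis_def)
  finally show "partial j (fiber_integral S i f) x = fiber_integral S i (partial j f) x" by simp
qed

lemma smooth_fiber_integral:
  assumes "is_test f" and S: "ray S"
  shows "smooth (fiber_integral S i f)"
proof (rule smooth_coinduct[of _ "fiber_integral S i ` Collect is_test"])
  fix g and j assume g: "g \<in> fiber_integral S i ` Collect is_test"
  show "g differentiable_on UNIV"
    using g differentiableI[OF fiber_integral_has_derivative[OF _ S]]
    by (auto intro!: differentiable_at_imp_differentiable_on)
  show "partial j g \<in> fiber_integral S i ` Collect is_test"
    using g is_test_partial[of _ j] by (force simp: partial_fiber_integral S)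
qed (use assms in auto)

text \<open>The fundamental theorem along a line: the boundary terms at both far ends vanish, while
  the half line ends at \<open>x\<close> itself.\<close>

lemma fiber_integral_partial_self:
  assumes f: "is_test f"
  shows "fiber_integral {..0} i (partial i f) = f"
    and "fiber_integral UNIV i (partial i f) = (\<lambda>x. 0)"
proof -
  have sm: "smooth f" "smooth (partial i f)" using f by (auto simp: is_test_def smooth_partial)
  obtain R where R: "0 < R" "\<And>x. f x \<noteq> 0 \<Longrightarrow> norm x \<le> R" using is_testE[OF f] by blast
  obtain R' where R': "0 < R'" "\<And>x. partial i f x \<noteq> 0 \<Longrightarrow> norm x \<le> R'"
    using is_testE[OF is_test_partial[OF f]] by blast
  have FTC: "integral {a..b} (\<lambda>s. partial i f (x + s *\<^sub>R axis i 1)) = f (x + b *\<^sub>R axis i 1) - f (x + a *\<^sub>R axis i 1)"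
    if "a \<le> b" for x a b
  proof (intro integral_unique fundamental_theorem_of_calculus that)
    fix s
    have "((\<lambda>s. f (x + s *\<^sub>R axis i 1)) has_derivative
       (\<lambda>t. \<Sum>j\<in>UNIV. (t *\<^sub>R axis i 1) $ j * partial j f (x + s *\<^sub>R axis i 1))) (at s within {a..b})"
      by (rule has_derivative_compose[OF _ smooth_has_derivative[OF sm(1)]]) (auto intro!: derivative_eq_intros)
    moreover have "(\<Sum>j\<in>UNIV. (t *\<^sub>R axis i 1) $ j * partial j f (x + s *\<^sub>R axis i 1))
        = t * partial i f (x + s *\<^sub>R axis i 1)" for t
    proof -
      have "(\<Sum>j\<in>UNIV. (t *\<^sub>R axis i 1) $ j * partial j f (x + s *\<^sub>R axis i 1))
          = (\<Sum>j\<in>UNIV. if j = i then t * partial j f (x + s *\<^sub>R axis i 1) else 0)"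
        by (intro sum.cong) (auto simp: axis_def)
      then show ?thesis by simp
    qed
    ultimately show "((\<lambda>s. f (x + s *\<^sub>R axis i 1)) has_vector_derivative partial i f (x + s *\<^sub>R axis i 1)) (at s within {a..b})"
      by (simp add: has_vector_derivative_def)
  qed
  have far: "f (x + s *\<^sub>R axis i 1) = 0" if "norm x + R < \<bar>s\<bar>" for x s
  proof (rule ccontr)
    assume "f (x + s *\<^sub>R axis i 1) \<noteq> 0"
    then have "norm (x + s *\<^sub>R axis i 1) \<le> R" by (rule R(2))
    moreover have "norm (s *\<^sub>R axis i 1 :: real^'a) \<le> norm (x + s *\<^sub>R axis i 1) + norm x"
      by (metis add_diff_cancel_left' norm_triangle_ineq4)
    ultimately show False using that by simp
  qed
  have "fiber_integral {..0} i (partial i f) x = f x \<and> fiber_integral UNIV i (partial i f) x = 0" for x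
  proof -
    \<comment> \<open>Large enough for the interval to contain the support of the derivative on the
      line, and for \<open>f\<close> to vanish at both endpoints.\<close>
    define r where "r = norm x + R + R' + 1"
    have r: "0 \<le> r" using R R' by (simp add: r_def add_nonneg_nonneg)
    then have "{..0} \<inter> {-r..r} = {-r..0}" "UNIV \<inter> {-r..r} = {-r..r}" by auto
    moreover have "norm x + R' \<le> r" using R by (simp add: r_def)
    ultimately have "fiber_integral {..0} i (partial i f) x = integral {-r..0} (\<lambda>s. partial i f (x + s *\<^sub>R axis i 1))"
      "fiber_integral UNIV i (partial i f) x = integral {-r..r} (\<lambda>s. partial i f (x + s *\<^sub>R axis i 1))"
      using fiber_integral_eq_integral[OF is_test_partial[OF f] R'(2)] by blast+
    moreover have "f (x + r *\<^sub>R axis i 1) = 0" "f (x + (- r) *\<^sub>R axis i 1) = 0"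
      using r R' by (intro far; simp add: r_def)+
    ultimately show ?thesis using r by (simp only: FTC) simp
  qed
  then show "fiber_integral {..0} i (partial i f) = f" "fiber_integral UNIV i (partial i f) = (\<lambda>x. 0)"
    by auto
qed

text \<open>Symmetry of second derivatives from the antiderivative: \<open>f\<close> is the half
  line integral of \<open>partial i f\<close>, both derivatives pass under this integral, and there
  \<open>partial i\<close> cancels it.\<close>

lemma partial_commute:
  assumes f: "is_test f"
  shows "partial i (partial j f) = partial j (partial i f)"
proof -
  have "partial i (partial j f) = partial i (partial j (fiber_integral {..0} i (partial i f)))"
    by (simp add: fiber_integral_partial_self f)
  also have "\<dots> = fiber_integral {..0} i (partial i (partial j (partial i f)))"
    by (simp add: partial_fiber_integral is_test_partial f)
  also have "\<dots> = partial j (partial i f)"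
    by (simp add: fiber_integral_partial_self is_test_partial f)
  finally show ?thesis .
qed

section \<open>Fubini, bump functions and dual moments\<close>

text \<open>The set where \<open>f\<close> is non-zero is open and a null set, hence empty.\<close>

lemma continuous_nonneg_integral_eq_0:
  fixes f :: "'a::euclidean_space \<Rightarrow> real"
  assumes f: "integrable lborel f" "continuous_on UNIV f" "\<And>x. 0 \<le> f x" "(\<integral>x. f x \<partial>lborel) = 0"
  shows "f x = 0"
proof -
  have [measurable]: "f \<in> borel_measurable borel" using f(2) by (rule borel_measurable_continuous_onI)
  have "AE x in lborel. f x = 0" using integral_nonneg_eq_0_iff_AE[OF f(1)] f(3,4) by simp
  then have "{x. f x \<noteq> 0} \<in> null_sets lborel" by (simp add: AE_iff_null_sets)
  then have "negligible {x. f x \<noteq> 0}" by (simp add: negligible_iff_null_sets null_sets_completionI)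
  moreover have "open {x. f x \<noteq> 0}" using f(2) by (intro open_Collect_neq continuous_intros)
  ultimately have "{x. f x \<noteq> 0} = {}" using open_not_negligible by blast
  then show ?thesis by blast
qed

lemma integral_lborel_shift:
  fixes f :: "'a::euclidean_space \<Rightarrow> real"
  assumes [measurable]: "f \<in> borel_measurable borel"
  shows "(\<integral>x. f (x + c) \<partial>lborel) = (\<integral>x. f x \<partial>lborel)"
proof -
  have "(\<integral>x. f x \<partial>lborel) = (\<integral>x. f x \<partial>distr lborel borel ((+) c))"
    by (simp add: lborel_distr_plus)
  also have "\<dots> = (\<integral>x. f (x + c) \<partial>lborel)"
    by (subst integral_distr) (simp_all add: add.commute)
  finally show ?thesis by simp
qed

text \<open>Fubini's theorem on \<open>\<real>\<^sup>n \<times> \<real>\<close>; combined with translation invariance it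
  avoids splitting \<open>\<real>\<^sup>n\<close> into a product.\<close>

lemma integral_fiber_integral:
  assumes f: "is_test f"
    and g: "continuous_on UNIV g" "\<And>t. g t \<noteq> 0 \<Longrightarrow> \<bar>t\<bar> \<le> r"
  shows "(\<integral>x. g (x $ i) * fiber_integral UNIV i f x \<partial>lborel) = (\<integral>t. g t \<partial>lborel) * (\<integral>x. f x \<partial>lborel)"
proof -
  obtain R where R: "0 < R" "\<And>x. f x \<noteq> 0 \<Longrightarrow> norm x \<le> R" using is_testE[OF f] by blast
  have fcont: "continuous_on UNIV f" using f by (simp add: is_test_def smooth_continuous)
  let ?e = "axis i 1 :: real^'a"
  have cont1: "continuous_on UNIV (\<lambda>(x, s). g (x $ i) * f (x + s *\<^sub>R ?e))"
    unfolding split_beta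
    by (intro continuous_intros continuous_on_compose2[OF fcont] continuous_on_compose2[OF g(1)]) auto
  have cont2: "continuous_on UNIV (\<lambda>(x, s). g (x $ i - s) * f x)"
    unfolding split_beta
    by (intro continuous_intros continuous_on_compose2[OF fcont] continuous_on_compose2[OF g(1)]) auto
  have nth: "\<bar>x $ i\<bar> \<le> norm x" for x :: "real^'a" by (rule component_le_norm_cart)
  \<comment> \<open>\<open>g\<close> bounds \<open>x $ i\<close> and \<open>f\<close> bounds
    \<open>x + s *\<^sub>R ?e\<close>; together they bound \<open>s\<close> and then
    \<open>x\<close>. The weight is needed because the fiber integral is constant along the
    axis.\<close>
  have int1: "integrable (lborel \<Otimes>\<^sub>M lborel) (\<lambda>(x, s). g (x $ i) * f (x + s *\<^sub>R ?e))"
    unfolding lborel_prod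
  proof (rule integrable_continuous_bounded_support[OF cont1])
    fix p :: "(real^'a) \<times> real"
    obtain x s where p: "p = (x, s)" by fastforce
    assume "(case p of (x, s) \<Rightarrow> g (x $ i) * f (x + s *\<^sub>R ?e)) \<noteq> 0"
    then have *: "\<bar>x $ i\<bar> \<le> r" "norm (x + s *\<^sub>R ?e) \<le> R" using p g(2) R(2) by auto
    have "\<bar>x $ i + s\<bar> \<le> R" using nth[of "x + s *\<^sub>R ?e"] * by simp
    then have s: "\<bar>s\<bar> \<le> R + r" using * by linarith
    have "norm x \<le> norm (x + s *\<^sub>R ?e) + norm (s *\<^sub>R ?e)"
      by (metis add_diff_cancel_right' norm_triangle_ineq4)
    then have "norm x \<le> R + (R + r)" using * s by simp
    then show "norm p \<le> R + (R + r) + (R + r)"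
      using s norm_Pair_le[of x s] by (simp add: p)
  qed
  have int2: "integrable (lborel \<Otimes>\<^sub>M lborel) (\<lambda>(x, s). g (x $ i - s) * f x)"
    unfolding lborel_prod
  proof (rule integrable_continuous_bounded_support[OF cont2])
    fix p :: "(real^'a) \<times> real"
    obtain x s where p: "p = (x, s)" by fastforce
    assume "(case p of (x, s) \<Rightarrow> g (x $ i - s) * f x) \<noteq> 0"
    then have *: "\<bar>x $ i - s\<bar> \<le> r" "norm x \<le> R" using p g(2) R(2) by auto
    then have "\<bar>s\<bar> \<le> R + r" using nth[of x] by linarith
    then show "norm p \<le> R + (R + r)"
      using * norm_Pair_le[of x s] by (simp add: p)
  qed
  have [measurable]: "f \<in> borel_measurable borel" "g \<in> borel_measurable borel"
    using fcont g(1) by (auto intro: borel_measurable_continuous_onI)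
  have "(\<integral>x. g (x $ i) * fiber_integral UNIV i f x \<partial>lborel)
      = (\<integral>x. (\<integral>s. g (x $ i) * f (x + s *\<^sub>R ?e) \<partial>lborel) \<partial>lborel)"
    by (simp add: fiber_integral_def set_lebesgue_integral_def)
  also have "\<dots> = (\<integral>s. (\<integral>x. g (x $ i) * f (x + s *\<^sub>R ?e) \<partial>lborel) \<partial>lborel)"
    by (rule lborel_pair.Fubini_integral[OF int1, symmetric])
  \<comment> \<open>Translation along the axis moves the shift from \<open>f\<close> to
    \<open>g\<close>. After another exchange of integrals, \<open>t = x $ i - s\<close> frees the
    integral of \<open>g\<close> from \<open>x\<close>.\<close>
  also have "\<dots> = (\<integral>s. (\<integral>x. g (x $ i - s) * f x \<partial>lborel) \<partial>lborel)"
  proof (rule Bochner_Integration.integral_cong[OF refl])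
    fix s
    show "(\<integral>x. g (x $ i) * f (x + s *\<^sub>R ?e) \<partial>lborel) = (\<integral>x. g (x $ i - s) * f x \<partial>lborel)"
      using integral_lborel_shift[of "\<lambda>x. g (x $ i - s) * f x" "s *\<^sub>R ?e"] by simp
  qed
  also have "\<dots> = (\<integral>x. (\<integral>s. g (x $ i - s) * f x \<partial>lborel) \<partial>lborel)"
    by (rule lborel_pair.Fubini_integral[OF int2])
  also have "\<dots> = (\<integral>x. (\<integral>t. g t \<partial>lborel) * f x \<partial>lborel)"
    using lborel_integral_real_affine[of "-1" g] by simp
  finally show ?thesis by simp
qed

lemma LBINT_derivative_eq_0:
  fixes f :: "real \<Rightarrow> real"
  assumes "\<And>t. (F has_real_derivative f t) (at t)" "continuous_on UNIV f"
    and "\<And>t. F t \<noteq> 0 \<Longrightarrow> \<bar>t\<bar> \<le> r" "\<And>t. f t \<noteq> 0 \<Longrightarrow> \<bar>t\<bar> \<le> r"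
  shows "(\<integral>t. f t \<partial>lborel) = 0"
proof -
  define q where "q = max r 0 + 1"
  have q: "0 \<le> q" "r < q" by (auto simp: q_def)
  have "(LBINT t:UNIV. f t) = integral {-q..q} f"
    using assms(4) q by (intro set_integral_eq_integral_Icc assms(2)) force+
  also have "\<dots> = F q - F (- q)"
    using q assms(1)
    by (intro integral_unique fundamental_theorem_of_calculus)
      (auto simp flip: has_real_derivative_iff_has_vector_derivative intro: has_field_derivative_at_within)
  also have "\<dots> = 0" using assms(3)[of q] assms(3)[of "-q"] q by force
  finally show ?thesis by (simp add: set_lebesgue_integral_def)
qed

section \<open>A smooth function with compact support\<close>

definition flat :: "real poly \<Rightarrow> real \<Rightarrow> real" where
  "flat p t = (if 0 < t then poly p (1 / t) * exp (- (1 / t)) else 0)"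

text \<open>With \<open>y = 1 / t\<close> this is the decay of \<open>p(y) exp(-y)\<close> at
  infinity; on the left the function is 0.\<close>

lemma flat_tendsto_0: "(flat p \<longlongrightarrow> 0) (at 0)"
proof -
  have "((\<lambda>y. \<Sum>k\<le>degree p. coeff p k * (y ^ k / exp y)) \<longlongrightarrow> (\<Sum>k\<le>degree p. coeff p k * 0)) at_top"
    by (intro tendsto_intros tendsto_power_div_exp_0)
  moreover have "(\<Sum>k\<le>degree p. coeff p k * (y ^ k / exp y)) = poly p y * exp (- y)" for y
    by (simp add: poly_altdef sum_distrib_right exp_minus divide_inverse mult.assoc)
  ultimately have "((\<lambda>y. poly p y * exp (- y)) \<longlongrightarrow> 0) at_top" by simp
  then have "((\<lambda>t. poly p (inverse t) * exp (- inverse t)) \<longlongrightarrow> 0) (at_right 0)"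
    by (rule filterlim_compose[OF _ filterlim_inverse_at_top_right])
  then have "(flat p \<longlongrightarrow> 0) (at_right 0)"
    by (rule Lim_transform_eventually)
      (auto simp: eventually_at_filter flat_def inverse_eq_divide)
  moreover have "(flat p \<longlongrightarrow> 0) (at_left 0)"
    by (rule tendsto_eventually) (auto simp: eventually_at_filter flat_def)
  ultimately show ?thesis by (simp add: filterlim_split_at)
qed

text \<open>Differentiating \<open>p(1/t) exp(-1/t)\<close> gives the polynomial
  \<open>X^2 (p - p')\<close>, so the family of all \<open>flat p\<close> is closed under
  derivatives. At 0 the difference quotient is again of this form, namely
  \<open>flat (X p)\<close>.\<close>

lemma flat_has_derivative: "(flat p has_real_derivative flat ([:0, 0, 1:] * (p - pderiv p)) t) (at t)"
proof (cases t "0 :: real" rule: linorder_cases)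
  case less
  have "((\<lambda>t. 0) has_real_derivative 0) (at t)" by simp
  then have "(flat p has_real_derivative 0) (at t)"
    by (rule has_field_derivative_transform_within_open[of _ _ _ "{..<0}"]) (use less in \<open>auto simp: flat_def\<close>)
  then show ?thesis using less by (simp add: flat_def)
next
  case equal
  have "flat ([:0, 1:] * p) = (\<lambda>h. (flat p h - flat p 0) / (h - 0))"
    by (simp add: flat_def fun_eq_iff)
  then have "((\<lambda>h. (flat p h - flat p 0) / (h - 0)) \<longlongrightarrow> 0) (at 0)"
    using flat_tendsto_0[of "[:0, 1:] * p"] by simp
  then show ?thesis using equal by (simp add: has_field_derivative_iff flat_def)
next
  case greater
  have "((\<lambda>t. poly p (1 / t) * exp (- (1 / t))) has_real_derivative
      flat ([:0, 0, 1:] * (p - pderiv p)) t) (at t)"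
    using greater unfolding flat_def
    by (auto intro!: derivative_eq_intros DERIV_chain2[OF poly_DERIV] simp: field_simps power2_eq_square)
  then show ?thesis
    by (rule has_field_derivative_transform_within_open[of _ _ _ "{0<..}"]) (use greater in \<open>auto simp: flat_def\<close>)
qed

text \<open>The scalar \<open>c\<close> in the family \<open>S\<close> absorbs the inner derivative,
  which is \<open>b\<close> for \<open>j = i\<close> and 0 otherwise. The affine argument provides
  for both ends of \<open>bump\<close>.\<close>

lemma smooth_flat: "smooth (\<lambda>x :: real^'n::finite. flat p (a + b * x $ i))"
proof -
  define S where "S = {\<lambda>x :: real^'n. c * flat p (a + b * x $ i) |c p. True}"
  have D: "((\<lambda>x :: real^'n. c * flat p (a + b * x $ i)) has_derivative
      (\<lambda>h. c * (flat ([:0, 0, 1:] * (p - pderiv p)) (a + b * x $ i) * (b * h $ i)))) (at x)" for c p x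
  proof -
    have "((\<lambda>x :: real^'n. a + b * x $ i) has_derivative (\<lambda>h. b * h $ i)) (at x)"
      by (auto intro!: derivative_eq_intros bounded_linear_imp_has_derivative[OF bounded_linear_vec_nth])
    then show ?thesis
      by (intro has_derivative_mult_right has_derivative_compose[OF _ flat_has_derivative[unfolded has_field_derivative_def]])
  qed
  show ?thesis
  proof (rule smooth_coinduct[of _ S])
    have "(\<lambda>x. flat p (a + b * x $ i)) = (\<lambda>x :: real^'n. 1 * flat p (a + b * x $ i))" by simp
    then show "(\<lambda>x. flat p (a + b * x $ i)) \<in> S" unfolding S_def by blast
    fix f and j assume "f \<in> S"
    then obtain c p where f: "f = (\<lambda>x. c * flat p (a + b * x $ i))" by (auto simp: S_def)
    show "f differentiable_on UNIV"
      unfolding f by (rule differentiable_at_imp_differentiable_on) (rule differentiableI[OF D])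
    have "partial j f = (\<lambda>x. c * (flat ([:0, 0, 1:] * (p - pderiv p)) (a + b * x $ i) * (b * axis j 1 $ i)))"
      unfolding f by (rule ext) (rule partial_eqI[OF D])
    also have "\<dots> = (\<lambda>x. (c * b * axis j 1 $ i) * flat ([:0, 0, 1:] * (p - pderiv p)) (a + b * x $ i))"
      by (simp add: algebra_simps)
    finally show "partial j f \<in> S" unfolding S_def by blast
  qed
qed

definition bump :: "real \<Rightarrow> real" where
  "bump t = flat 1 (1 + t) * flat 1 (1 - t)"

lemma bump_pos: "\<bar>t\<bar> < 1 \<Longrightarrow> 0 < bump t"
  and bump_nonneg: "0 \<le> bump t"
  and bump_support: "bump t \<noteq> 0 \<Longrightarrow> \<bar>t\<bar> \<le> 1"
  by (auto simp: bump_def flat_def split: if_splits)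

lemma smooth_bump: "smooth (\<lambda>x :: real^'n::finite. bump (x $ i))"
  using smooth_mult[OF smooth_flat[of 1 1 1 i] smooth_flat[of 1 1 "-1" i]] by (simp add: bump_def)

text \<open>Functions of one variable are handled as functions on \<open>\<real>\<^sup>n\<close> of the coordinate \<open>i\<close>.\<close>

definition is_test_coord :: "'n::finite \<Rightarrow> (real \<Rightarrow> real) \<Rightarrow> bool" where
  "is_test_coord i h \<longleftrightarrow> smooth (\<lambda>x :: real^'n. h (x $ i)) \<and> (\<exists>r. \<forall>t. h t \<noteq> 0 \<longrightarrow> \<bar>t\<bar> \<le> r)"

lemma is_test_coord_continuous:
  assumes "is_test_coord i h"
  shows "continuous_on UNIV h"
proof -
  have "continuous_on UNIV (\<lambda>x. h (x $ i))"
    using assms by (auto simp: is_test_coord_def intro: smooth_continuous)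
  then have "continuous_on UNIV (\<lambda>t. h ((t *\<^sub>R axis i 1) $ i))"
    by (rule continuous_on_compose2) (auto intro!: continuous_intros)
  then show ?thesis by simp
qed

lemma is_test_coord_bump: "is_test_coord i bump"
  unfolding is_test_coord_def using smooth_bump bump_support by blast

lemma is_test_coord_scale: "is_test_coord i h \<Longrightarrow> is_test_coord i (\<lambda>t. c * h t)"
  by (auto simp: is_test_coord_def smooth_scale)

lemma is_test_coord_diff:
  assumes "is_test_coord i g" "is_test_coord i h"
  shows "is_test_coord i (\<lambda>t. g t - h t)"
proof -
  obtain r q where "\<forall>t. g t \<noteq> 0 \<longrightarrow> \<bar>t\<bar> \<le> r" "\<forall>t. h t \<noteq> 0 \<longrightarrow> \<bar>t\<bar> \<le> q"
    using assms by (auto simp: is_test_coord_def)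
  then have "\<forall>t. g t - h t \<noteq> 0 \<longrightarrow> \<bar>t\<bar> \<le> max r q" by (metis diff_zero le_max_iff_disj)
  then show ?thesis using assms by (auto simp: is_test_coord_def intro: smooth_diff)
qed

text \<open>Smoothness is available for functions on \<open>R^n\<close>, so the derivative of
  \<open>h\<close> is read off from the partial derivative along \<open>i\<close>, restricted to
  that axis.\<close>

lemma is_test_coord_derivative:
  fixes i :: "'n::finite"
  assumes h: "is_test_coord i h"
  shows "\<exists>h'. is_test_coord i h' \<and> (\<forall>t. (h has_real_derivative h' t) (at t))"
proof -
  let ?H = "\<lambda>x :: real^'n. h (x $ i)"
  have sm: "smooth ?H" using h by (simp add: is_test_coord_def)
  obtain r where r: "\<And>t. h t \<noteq> 0 \<Longrightarrow> \<bar>t\<bar> \<le> r" using h by (auto simp: is_test_coord_def)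
  define h' where "h' t = partial i ?H (t *\<^sub>R axis i 1)" for t
  have D: "(h has_real_derivative h' t) (at t)" for t
  proof -
    have "((\<lambda>t. ?H (t *\<^sub>R axis i 1)) has_derivative
       (\<lambda>s. \<Sum>j\<in>UNIV. (s *\<^sub>R axis i 1) $ j * partial j ?H (t *\<^sub>R axis i 1))) (at t)"
      by (rule has_derivative_compose[OF _ smooth_has_derivative[OF sm]]) (auto intro!: derivative_eq_intros)
    moreover have "(\<Sum>j\<in>UNIV. (s *\<^sub>R axis i 1) $ j * partial j ?H (t *\<^sub>R axis i 1)) = h' t * s" for s
    proof -
      have "(\<Sum>j\<in>UNIV. (s *\<^sub>R axis i 1) $ j * partial j ?H (t *\<^sub>R axis i 1))
          = (\<Sum>j\<in>UNIV. if j = i then s * partial j ?H (t *\<^sub>R axis i 1) else 0)"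
        by (intro sum.cong) (auto simp: axis_def)
      then show ?thesis by (simp add: h'_def)
    qed
    ultimately show ?thesis by (simp add: has_field_derivative_def)
  qed
  have "partial i ?H = (\<lambda>x. h' (x $ i))"
  proof
    fix x :: "real^'n"
    have "((\<lambda>x. x $ i) has_derivative (\<lambda>y. y $ i)) (at x)"
      by (rule bounded_linear_imp_has_derivative[OF bounded_linear_vec_nth])
    then have "(?H has_derivative (\<lambda>y. h' (x $ i) * y $ i)) (at x)"
      by (rule has_derivative_compose[OF _ D[unfolded has_field_derivative_def]])
    then show "partial i ?H x = h' (x $ i)" by (simp add: partial_eqI)
  qed
  then have "smooth (\<lambda>x :: real^'n. h' (x $ i))" using smooth_partial[OF sm, of i] by simp
  \<comment> \<open>Beyond \<open>r\<close> the function \<open>h\<close> is locally 0, so its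
    derivative inherits the bound of the support.\<close>
  moreover have "\<bar>t\<bar> \<le> r" if "h' t \<noteq> 0" for t
  proof (rule ccontr)
    assume "\<not> \<bar>t\<bar> \<le> r"
    have "((\<lambda>t. 0) has_real_derivative 0) (at t)" by simp
    then have "(h has_real_derivative 0) (at t)"
    proof (rule has_field_derivative_transform_within_open)
      show "open {t :: real. r < \<bar>t\<bar>}" by (intro open_Collect_less continuous_intros)
    qed (use \<open>\<not> \<bar>t\<bar> \<le> r\<close> r in force)+
    then have "h' t = 0" using D DERIV_unique by blast
    with that show False by simp
  qed
  ultimately have "is_test_coord i h'" by (auto simp: is_test_coord_def)
  with D show ?thesis by blast
qed

section \<open>Moments of functions of one variable\<close>

definition moment :: "nat \<Rightarrow> (real \<Rightarrow> real) \<Rightarrow> real" where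
  "moment k h = (\<integral>t. t ^ k * h t \<partial>lborel)"

lemma integrable_moment:
  assumes "is_test_coord i h"
  shows "integrable lborel (\<lambda>t. t ^ k * h t)"
proof -
  obtain r where "\<And>t. h t \<noteq> 0 \<Longrightarrow> \<bar>t\<bar> \<le> r" using assms by (auto simp: is_test_coord_def)
  then show ?thesis
    by (intro integrable_continuous_bounded_support continuous_intros is_test_coord_continuous[OF assms]) auto
qed

lemma moment_scale: "moment k (\<lambda>t. c * h t) = c * moment k h"
  by (simp add: moment_def mult.left_commute)

lemma moment_diff:
  "is_test_coord i g \<Longrightarrow> is_test_coord i h \<Longrightarrow> moment k (\<lambda>t. g t - h t) = moment k g - moment k h"
  by (simp add: moment_def right_diff_distrib Bochner_Integration.integral_diff integrable_moment)

text \<open>The derivative of \<open>t^(k+1) g(t)\<close> has integral 0.\<close>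

lemma moment_derivative:
  assumes g: "is_test_coord i g" "is_test_coord i g'" "\<And>t. (g has_real_derivative g' t) (at t)"
  shows "moment 0 g' = 0" "moment (Suc k) g' = - (real (Suc k) * moment k g)"
proof -
  obtain r where r: "\<And>t. g t \<noteq> 0 \<Longrightarrow> \<bar>t\<bar> \<le> r" using g by (auto simp: is_test_coord_def)
  obtain q where q: "\<And>t. g' t \<noteq> 0 \<Longrightarrow> \<bar>t\<bar> \<le> q" using g by (auto simp: is_test_coord_def)
  note cont = is_test_coord_continuous[OF g(1)] is_test_coord_continuous[OF g(2)]
  have "(\<integral>t. g' t \<partial>lborel) = 0"
    by (rule LBINT_derivative_eq_0[OF g(3) cont(2), of "max r q"]) (use r q in \<open>auto simp: le_max_iff_disj\<close>)
  then show "moment 0 g' = 0" by (simp add: moment_def)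
  have D: "((\<lambda>t. t ^ Suc k * g t) has_real_derivative (real (Suc k) * (t ^ k * g t) + t ^ Suc k * g' t)) (at t)" for t
    using DERIV_mult[OF DERIV_pow[of "Suc k" t] g(3)[of t]] by (simp add: algebra_simps)
  have "(\<integral>t. real (Suc k) * (t ^ k * g t) + t ^ Suc k * g' t \<partial>lborel) = 0"
  proof (rule LBINT_derivative_eq_0[OF D, of "max r q"])
    show "continuous_on UNIV (\<lambda>t. real (Suc k) * (t ^ k * g t) + t ^ Suc k * g' t)"
      by (intro continuous_intros cont)
    show "\<bar>t\<bar> \<le> max r q" if "t ^ Suc k * g t \<noteq> 0" for t
      using that r[of t] by (auto simp: le_max_iff_disj)
    show "\<bar>t\<bar> \<le> max r q" if "real (Suc k) * (t ^ k * g t) + t ^ Suc k * g' t \<noteq> 0" for t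
      using that r[of t] q[of t] by (cases "g t = 0") (auto simp: le_max_iff_disj)
  qed
  then show "moment (Suc k) g' = - (real (Suc k) * moment k g)"
    unfolding moment_def
    using integrable_moment[OF g(1), of k] integrable_moment[OF g(2), of "Suc k"]
    by (simp only: Bochner_Integration.integral_add Bochner_Integration.integral_mult_right
        Bochner_Integration.integrable_mult_right)
qed

lemma bump_integral_pos: "0 < moment 0 bump"
proof -
  have int: "integrable lborel (\<lambda>t. bump t)" using integrable_moment[OF is_test_coord_bump, of 0] by simp
  have "moment 0 bump \<noteq> 0"
  proof
    assume "moment 0 bump = 0"
    then have "bump 0 = 0"
      using is_test_coord_continuous[OF is_test_coord_bump] bump_nonneg
      by (intro continuous_nonneg_integral_eq_0[OF int]) (simp_all add: moment_def)
    then show False using bump_pos[of 0] by simp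
  qed
  moreover have "0 \<le> moment 0 bump"
    by (simp add: moment_def bump_nonneg Bochner_Integration.integral_nonneg)
  ultimately show ?thesis by simp
qed

text \<open>Differentiation moves the first non-zero moment from order \<open>m\<close> to
  \<open>m + 1\<close> and multiplies it by \<open>-(m + 1)\<close>, which the scalar in front of
  \<open>g'\<close> compensates.\<close>

lemma ex_test_moment_unit:
  fixes i :: "'n::finite"
  shows "\<exists>g. is_test_coord i g \<and> (\<forall>k<m. moment k g = 0) \<and> moment m g = 1"
proof (induction m)
  case 0
  let ?g = "\<lambda>t. inverse (moment 0 bump) * bump t"
  have "is_test_coord i ?g" by (intro is_test_coord_scale is_test_coord_bump)
  moreover have "moment 0 ?g = 1" unfolding moment_scale using bump_integral_pos by simp
  ultimately show ?case by blast
next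
  case (Suc m)
  then obtain g where g: "is_test_coord i g" "\<And>k. k < m \<Longrightarrow> moment k g = 0" "moment m g = 1" by blast
  obtain g' where g': "is_test_coord i g'" "\<And>t. (g has_real_derivative g' t) (at t)"
    using is_test_coord_derivative[OF g(1)] by blast
  let ?f = "\<lambda>t. - inverse (real (Suc m)) * g' t"
  have "is_test_coord i ?f" by (intro is_test_coord_scale g')
  moreover have "moment k ?f = 0" if "k < Suc m" for k
    unfolding moment_scale using moment_derivative[OF g(1) g'] g(2) that by (cases k) auto
  moreover have "moment (Suc m) ?f = 1"
    unfolding moment_scale moment_derivative(2)[OF g(1) g'] g(3) by (simp del: of_nat_Suc)
  ultimately show ?case by blast
qed

text \<open>A triangular correction: a function whose first non-zero moment is the one of order
  \<open>m\<close> removes that moment from the earlier functions without disturbing their lower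
  ones.\<close>

lemma ex_dual_moments:
  fixes i :: "'n::finite"
  shows "\<exists>H. \<forall>k<m. is_test_coord i (H k) \<and> (\<forall>r<m. moment r (H k) = (if r = k then 1 else 0))"
proof (induction m)
  case (Suc m)
  then obtain H where H: "\<And>k. k < m \<Longrightarrow> is_test_coord i (H k)"
    "\<And>k r. k < m \<Longrightarrow> r < m \<Longrightarrow> moment r (H k) = (if r = k then 1 else 0)" by blast
  obtain g where g: "is_test_coord i g" "\<And>k. k < m \<Longrightarrow> moment k g = 0" "moment m g = 1"
    using ex_test_moment_unit by blast
  define H' where "H' k = (if k = m then g else (\<lambda>t. H k t - moment m (H k) * g t))" for k
  have "is_test_coord i (H' k) \<and> (\<forall>r<Suc m. moment r (H' k) = (if r = k then 1 else 0))" if "k < Suc m" for k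
  proof (cases "k = m")
    case True
    then show ?thesis using g by (simp add: H'_def less_Suc_eq)
  next
    case False
    with that have k: "k < m" by simp
    have "moment r (H' k) = moment r (H k) - moment m (H k) * moment r g" for r
      using False moment_diff[OF H(1)[OF k] is_test_coord_scale[OF g(1)]] by (simp add: H'_def moment_scale)
    moreover have "is_test_coord i (H' k)"
      using False by (simp add: H'_def is_test_coord_diff is_test_coord_scale H(1)[OF k] g(1))
    ultimately show ?thesis using H(2)[OF k] k g by (auto simp: less_Suc_eq)
  qed
  then show ?case by blast
qed simp

section \<open>Iterated antiderivatives and moments\<close>

lemma integrable_line:
  assumes f: "is_test f"
  shows "integrable lborel (\<lambda>s. f (x + s *\<^sub>R axis i 1))"
proof -
  obtain R where R: "\<And>x. f x \<noteq> 0 \<Longrightarrow> norm x \<le> R" using is_testE[OF f] by blast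
  show ?thesis
  proof (rule integrable_continuous_bounded_support)
    show "continuous_on UNIV (\<lambda>s. f (x + s *\<^sub>R axis i 1))"
      using f by (intro continuous_on_line smooth_continuous is_test_smooth)
    fix s assume "f (x + s *\<^sub>R axis i 1) \<noteq> 0"
    then have "norm (x + s *\<^sub>R axis i 1) \<le> R" by (rule R)
    moreover have "norm (s *\<^sub>R axis i 1 :: real^'a) \<le> norm (x + s *\<^sub>R axis i 1) + norm x"
      by (metis add_diff_cancel_left' norm_triangle_ineq4)
    ultimately show "norm s \<le> R + norm x" by simp
  qed
qed

lemma fiber_integral_UNIV: "fiber_integral UNIV i f x = (\<integral>s. f (x + s *\<^sub>R axis i 1) \<partial>lborel)"
  by (simp add: fiber_integral_def set_lebesgue_integral_def)

lemma fiber_integral_add: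
  "is_test f \<Longrightarrow> is_test g \<Longrightarrow>
    fiber_integral UNIV i (\<lambda>x. f x + g x) x = fiber_integral UNIV i f x + fiber_integral UNIV i g x"
  unfolding fiber_integral_UNIV by (rule Bochner_Integration.integral_add[OF integrable_line integrable_line])

lemma fiber_integral_diff:
  "is_test f \<Longrightarrow> is_test g \<Longrightarrow>
    fiber_integral UNIV i (\<lambda>x. f x - g x) x = fiber_integral UNIV i f x - fiber_integral UNIV i g x"
  unfolding fiber_integral_UNIV by (rule Bochner_Integration.integral_diff[OF integrable_line integrable_line])

lemma fiber_integral_sum:
  "(\<And>k. k \<in> I \<Longrightarrow> is_test (f k)) \<Longrightarrow>
    fiber_integral UNIV i (\<lambda>x. \<Sum>k\<in>I. f k x) x = (\<Sum>k\<in>I. fiber_integral UNIV i (f k) x)"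
  unfolding fiber_integral_UNIV by (rule Bochner_Integration.integral_sum[OF integrable_line])

lemma fiber_integral_scale:
  "fiber_integral UNIV i (\<lambda>x. c * f x) x = c * fiber_integral UNIV i f x"
  by (simp add: fiber_integral_UNIV)

lemma fiber_integral_shift:
  assumes "is_test f"
  shows "fiber_integral UNIV i f (x + t *\<^sub>R axis i 1) = fiber_integral UNIV i f x"
proof -
  have "continuous_on UNIV (\<lambda>s. f (x + s *\<^sub>R axis i 1))"
    using assms by (intro continuous_on_line smooth_continuous is_test_smooth)
  then have [measurable]: "(\<lambda>s. f (x + s *\<^sub>R axis i 1)) \<in> borel_measurable borel"
    by (rule borel_measurable_continuous_onI)
  show ?thesis
    using integral_lborel_shift[of "\<lambda>s. f (x + s *\<^sub>R axis i 1)" t]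
    by (simp add: fiber_integral_UNIV algebra_simps)
qed

lemma norm_le_card:
  fixes x :: "real^'n::finite"
  assumes "\<And>j. \<bar>x $ j\<bar> \<le> R"
  shows "norm x \<le> real CARD('n) * R"
  using norm_le_l1_cart[of x] sum_bounded_above[of UNIV "\<lambda>j. \<bar>x $ j\<bar>" R] assms by simp

text \<open>The antiderivative vanishing at minus infinity is constant beyond the support of
  \<open>f\<close>, with the fiber integral as its value; its support is bounded because this value
  is 0.\<close>

lemma ex_antiderivative:
  assumes f: "is_test f" and zero: "\<And>x. fiber_integral UNIV i f x = 0"
  shows "\<exists>g. is_test g \<and> partial i g = f"
proof -
  obtain R where R: "0 < R" "\<And>x. f x \<noteq> 0 \<Longrightarrow> norm x \<le> R" using is_testE[OF f] by blast
  let ?g = "fiber_integral {..0} i f"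
  have "norm x \<le> real CARD('a) * R" if ne: "?g x \<noteq> 0" for x
  proof (rule norm_le_card, rule ccontr)
    fix j assume j: "\<not> \<bar>x $ j\<bar> \<le> R"
    have vanish: "f (x + s *\<^sub>R axis i 1) = 0" if "R < \<bar>(x + s *\<^sub>R axis i 1) $ j\<bar>" for s
      using R(2)[of "x + s *\<^sub>R axis i 1"] component_le_norm_cart[of "x + s *\<^sub>R axis i 1" j] that by linarith
    have "?g x = 0"
    \<comment> \<open>Either the half line up to \<open>x\<close> contains all points of its line
      where \<open>f\<close> is non-zero, or it contains none of them.\<close>
    proof (cases "j = i \<and> R < x $ j")
      case True
      then have "indicator {..0} s * f (x + s *\<^sub>R axis i 1) = f (x + s *\<^sub>R axis i 1)" for s
        using vanish[of s] by (cases "s \<le> 0") auto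
      then have "?g x = fiber_integral UNIV i f x"
        unfolding fiber_integral_def set_lebesgue_integral_def by (simp only: real_scaleR_def) simp
      then show ?thesis using zero by simp
    next
      case False
      have "f (x + s *\<^sub>R axis i 1) = 0" if "s \<le> 0" for s
        using vanish[of s] False j that by (cases "j = i") (auto simp: axis_def)
      then have "indicator {..0} s * f (x + s *\<^sub>R axis i 1) = 0" for s
        by (cases "s \<le> 0") auto
      then show ?thesis
        unfolding fiber_integral_def set_lebesgue_integral_def by (simp only: real_scaleR_def) simp
    qed
    with ne show False by simp
  qed
  then have "is_test ?g" using smooth_fiber_integral[OF f, of "{..0}"] by (auto simp: is_test_iff)
  moreover have "partial i ?g = f"
    using f by (simp add: partial_fiber_integral fiber_integral_partial_self)
  ultimately show ?thesis by blast
qed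

lemma smooth_coord_power: "smooth (\<lambda>x. (x $ i) ^ k)"
  by (intro smooth_power smooth_nth)

lemma is_test_coord_power_mult: "is_test f \<Longrightarrow> is_test (\<lambda>x. (x $ i) ^ k * f x)"
  by (intro is_test_mult smooth_coord_power)

lemma partial_coord: "partial j (\<lambda>x. x $ i) x = axis j 1 $ i"
  by (rule partial_eqI[OF bounded_linear_imp_has_derivative[OF bounded_linear_vec_nth]])

lemma partial_coord_power:
  "partial i (\<lambda>x. (x $ i) ^ Suc k) x = real (Suc k) * (x $ i) ^ k"
proof (induction k)
  case 0
  show ?case by (simp add: partial_coord)
next
  case (Suc k)
  have "partial i (\<lambda>x. x $ i * (x $ i) ^ Suc k) x
      = x $ i * partial i (\<lambda>x. (x $ i) ^ Suc k) x + partial i (\<lambda>x. x $ i) x * (x $ i) ^ Suc k"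
    by (intro partial_mult smooth_imp_differentiable smooth_coord_power smooth_nth)
  then show ?case using Suc by (simp add: partial_coord algebra_simps)
qed

text \<open>Integration by parts expresses the moment of order \<open>k\<close> of an antiderivative
  by the moment of order \<open>k + 1\<close> of \<open>f\<close>, so each antiderivative uses up
  one vanishing moment.\<close>

lemma ex_iterated_antiderivative:
  assumes "is_test f" "\<And>k x. k < m \<Longrightarrow> fiber_integral UNIV i (\<lambda>y. (y $ i) ^ k * f y) x = 0"
  shows "\<exists>g. is_test g \<and> (partial i ^^ m) g = f"
  using assms
proof (induction m arbitrary: f)
  case (Suc m)
  obtain g where g: "is_test g" "partial i g = f"
    using ex_antiderivative[OF Suc.prems(1)] Suc.prems(2)[of 0] by auto
  have "fiber_integral UNIV i (\<lambda>y. (y $ i) ^ k * g y) x = 0" if "k < m" for k x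
  proof -
    have "partial i (\<lambda>y. (y $ i) ^ Suc k * g y) = (\<lambda>y. (y $ i) ^ Suc k * f y + real (Suc k) * ((y $ i) ^ k * g y))"
      using g by (auto simp: partial_mult smooth_imp_differentiable smooth_coord_power is_test_smooth
        partial_coord_power simp del: power_Suc)
    then have "0 = fiber_integral UNIV i (\<lambda>y. (y $ i) ^ Suc k * f y + real (Suc k) * ((y $ i) ^ k * g y)) x"
      using fiber_integral_partial_self(2)[OF is_test_coord_power_mult[OF g(1), of i "Suc k"], of i] by simp
    also have "\<dots> = fiber_integral UNIV i (\<lambda>y. (y $ i) ^ Suc k * f y) x
        + real (Suc k) * fiber_integral UNIV i (\<lambda>y. (y $ i) ^ k * g y) x"
      using Suc.prems(1) g(1)
      by (simp only: fiber_integral_add is_test_coord_power_mult is_test_mult[OF smooth_const] fiber_integral_scale)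
    also have "fiber_integral UNIV i (\<lambda>y. (y $ i) ^ Suc k * f y) x = 0"
      using that by (intro Suc.prems) simp
    finally show ?thesis by simp
  qed
  then obtain h where "is_test h" "(partial i ^^ m) h = g" using Suc.IH[OF g(1)] by blast
  then show ?case using g by auto
qed auto

text \<open>For \<open>h\<close> dual to the power \<open>t^k\<close>, this is the component of
  \<open>f\<close> that carries its \<open>k\<close>-th moment along the axis
  \<open>i\<close>.\<close>

definition moment_part :: "(real \<Rightarrow> real) \<Rightarrow> nat \<Rightarrow> 'n::finite \<Rightarrow> (real^'n \<Rightarrow> real) \<Rightarrow> real^'n \<Rightarrow> real" where
  "moment_part h k i f x = h (x $ i) * fiber_integral UNIV i (\<lambda>y. (y $ i) ^ k * f y) x"

text \<open>\<open>h\<close> bounds the coordinate \<open>i\<close>, on which the fiber integral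
  does not depend; \<open>f\<close> bounds the other ones.\<close>

lemma is_test_moment_part:
  fixes i :: "'n::finite"
  assumes h: "is_test_coord i h" and f: "is_test f"
  shows "is_test (moment_part h k i f)"
proof -
  obtain r where r: "\<And>t. h t \<noteq> 0 \<Longrightarrow> \<bar>t\<bar> \<le> r" using h by (auto simp: is_test_coord_def)
  obtain R where R: "0 < R" "\<And>x. f x \<noteq> 0 \<Longrightarrow> norm x \<le> R" using is_testE[OF f] by blast
  have "norm x \<le> real CARD('n) * max r R" if ne: "moment_part h k i f x \<noteq> 0" for x
  proof (rule norm_le_card)
    fix j
    show "\<bar>x $ j\<bar> \<le> max r R"
    proof (cases "j = i")
      case True
      then show ?thesis using ne r[of "x $ i"] by (auto simp: moment_part_def)
    next
      case False
      have "\<not> (\<forall>s. f (x + s *\<^sub>R axis i 1) = 0)"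
      proof
        assume "\<forall>s. f (x + s *\<^sub>R axis i 1) = 0"
        with ne show False by (simp add: moment_part_def fiber_integral_UNIV)
      qed
      then obtain s where "f (x + s *\<^sub>R axis i 1) \<noteq> 0" by blast
      then have "norm (x + s *\<^sub>R axis i 1) \<le> R" by (rule R(2))
      then show ?thesis
        using component_le_norm_cart[of "x + s *\<^sub>R axis i 1" j] False by (simp add: axis_def)
    qed
  qed
  moreover have "smooth (moment_part h k i f)"
    unfolding moment_part_def[abs_def] using h f
    by (intro smooth_mult smooth_fiber_integral is_test_coord_power_mult) (auto simp: is_test_coord_def)
  ultimately show ?thesis by (auto simp: is_test_iff)
qed

lemma fiber_integral_coord_mult:
  assumes M: "\<And>t. M (x + t *\<^sub>R axis i 1) = M x"
  shows "fiber_integral UNIV i (\<lambda>y. g (y $ i) * M y) x = (\<integral>t. g t \<partial>lborel) * M x"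
proof -
  have "(\<integral>s. g (x $ i + s) \<partial>lborel) = (\<integral>t. g t \<partial>lborel)"
    using lborel_integral_real_affine[of 1 g "x $ i"] by simp
  then show ?thesis by (simp add: fiber_integral_UNIV M)
qed

text \<open>Subtracting the moment parts kills all moments of order below \<open>m\<close> along
  \<open>i\<close>, and what is left is an iterated derivative.\<close>

lemma moment_part_decomposition:
  fixes i :: "'n::finite"
  assumes H: "\<And>k. k < m \<Longrightarrow> is_test_coord i (H k)"
    "\<And>k r. k < m \<Longrightarrow> r < m \<Longrightarrow> moment r (H k) = (if r = k then 1 else 0)"
    and f: "is_test f"
  shows "\<exists>g. is_test g \<and> f = (\<lambda>x. (\<Sum>k<m. moment_part (H k) k i f x) + (partial i ^^ m) g x)"
proof -
  let ?s = "\<lambda>x. \<Sum>k<m. moment_part (H k) k i f x"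
  have s: "is_test ?s" by (intro is_test_sum is_test_moment_part H f) auto
  have "fiber_integral UNIV i (\<lambda>y. (y $ i) ^ r * (f y - ?s y)) x = 0" if r: "r < m" for r x
  proof -
    let ?M = "\<lambda>k. fiber_integral UNIV i (\<lambda>y. (y $ i) ^ k * f y)"
    have "fiber_integral UNIV i (\<lambda>y. (y $ i) ^ r * moment_part (H k) k i f y) x = (if r = k then ?M k x else 0)"
      if "k < m" for k
    proof -
      have "fiber_integral UNIV i (\<lambda>y. (y $ i) ^ r * moment_part (H k) k i f y) x
          = fiber_integral UNIV i (\<lambda>y. ((y $ i) ^ r * H k (y $ i)) * ?M k y) x"
        by (simp add: moment_part_def mult.assoc)
      also have "\<dots> = (\<integral>t. t ^ r * H k t \<partial>lborel) * ?M k x"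
        by (rule fiber_integral_coord_mult[of "?M k" x i "\<lambda>t. t ^ r * H k t"])
          (intro fiber_integral_shift is_test_coord_power_mult f)
      also have "(\<integral>t. t ^ r * H k t \<partial>lborel) = (if r = k then 1 else 0)"
        using H(2)[OF that r] by (simp add: moment_def)
      finally show ?thesis by simp
    qed
    note M = this
    have "fiber_integral UNIV i (\<lambda>y. (y $ i) ^ r * ?s y) x
        = (\<Sum>k<m. fiber_integral UNIV i (\<lambda>y. (y $ i) ^ r * moment_part (H k) k i f y) x)"
      unfolding sum_distrib_left
      by (intro fiber_integral_sum is_test_coord_power_mult is_test_moment_part H f) simp
    also have "\<dots> = ?M r x" using r by (simp add: M)
    finally show ?thesis
      by (simp only: right_diff_distrib fiber_integral_diff is_test_coord_power_mult f s)
  qed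
  then obtain g where "is_test g" "(partial i ^^ m) g = (\<lambda>x. f x - ?s x)"
    using ex_iterated_antiderivative[OF is_test_diff[OF f s], where m = m and i = i] by blast
  then show ?thesis by (intro exI[of _ g]) (auto simp: fun_eq_iff)
qed

section \<open>Integrals against monomials\<close>

definition monomial_fun :: "('n::finite \<Rightarrow> nat) \<Rightarrow> real^'n \<Rightarrow> real" where
  "monomial_fun \<beta> x = (\<Prod>i\<in>UNIV. (x $ i) ^ \<beta> i)"

lemma smooth_monomial_fun: "smooth (monomial_fun \<beta>)"
  unfolding monomial_fun_def[abs_def] by (intro smooth_prod smooth_coord_power)

text \<open>This is \<open>integral_fiber_integral\<close> with the weight
  \<open>t ^ \<beta> i * h t\<close>, whose integral is 1.\<close>

lemma integral_monomial_moment_part: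
  fixes i :: "'n::finite"
  assumes h: "is_test_coord i h" "moment (\<beta> i) h = 1" and f: "is_test f"
  shows "(\<integral>x. monomial_fun \<beta> x * moment_part h (\<beta> i) i f x \<partial>lborel) = (\<integral>x. monomial_fun \<beta> x * f x \<partial>lborel)"
proof -
  define \<mu> where "\<mu> x = (\<Prod>j\<in>UNIV - {i}. (x $ j) ^ \<beta> j)" for x :: "real^'n"
  have m: "monomial_fun \<beta> x = (x $ i) ^ \<beta> i * \<mu> x" for x
    by (simp add: monomial_fun_def \<mu>_def prod.remove)
  have \<mu>: "\<mu> (x + s *\<^sub>R axis i 1) = \<mu> x" for x s
    unfolding \<mu>_def by (intro prod.cong) (auto simp: axis_def)
  obtain r where r: "\<And>t. h t \<noteq> 0 \<Longrightarrow> \<bar>t\<bar> \<le> r" using h by (auto simp: is_test_coord_def)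
  \<comment> \<open>The factor \<open>\<mu>\<close> does not depend on \<open>x $ i\<close> and
    moves under the fiber integral, completing the monomial there.\<close>
  have "monomial_fun \<beta> x * moment_part h (\<beta> i) i f x
      = ((x $ i) ^ \<beta> i * h (x $ i)) * fiber_integral UNIV i (\<lambda>y. monomial_fun \<beta> y * f y) x" for x
  proof -
    have "fiber_integral UNIV i (\<lambda>y. monomial_fun \<beta> y * f y) x
        = (\<integral>s. \<mu> x * (((x + s *\<^sub>R axis i 1) $ i) ^ \<beta> i * f (x + s *\<^sub>R axis i 1)) \<partial>lborel)"
      unfolding fiber_integral_UNIV m \<mu> by (simp only: mult.assoc mult.left_commute)
    also have "\<dots> = \<mu> x * fiber_integral UNIV i (\<lambda>y. (y $ i) ^ \<beta> i * f y) x"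
      by (simp add: fiber_integral_UNIV)
    finally show ?thesis by (simp add: m moment_part_def algebra_simps)
  qed
  moreover have "(\<integral>x. ((x $ i) ^ \<beta> i * h (x $ i)) * fiber_integral UNIV i (\<lambda>y. monomial_fun \<beta> y * f y) x \<partial>lborel)
      = (\<integral>t. t ^ \<beta> i * h t \<partial>lborel) * (\<integral>x. monomial_fun \<beta> x * f x \<partial>lborel)"
    using r by (intro integral_fiber_integral[of _ "\<lambda>t. t ^ \<beta> i * h t" r] is_test_mult smooth_monomial_fun f
        continuous_intros is_test_coord_continuous[OF h(1)]) auto
  ultimately show ?thesis using h(2) by (simp add: moment_def)
qed

text \<open>The fiber integrals are 0; the weight \<open>bump\<close>, with its non-zero integral,
  turns this into a statement on the full integral.\<close>

lemma integral_partial_eq_0: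
  assumes f: "is_test f"
  shows "(\<integral>x. partial i f x \<partial>lborel) = 0"
proof -
  have "(\<integral>x. bump (x $ i) * fiber_integral UNIV i (partial i f) x \<partial>lborel)
      = (\<integral>t. bump t \<partial>lborel) * (\<integral>x. partial i f x \<partial>lborel)"
    using bump_support is_test_coord_continuous[OF is_test_coord_bump]
    by (intro integral_fiber_integral is_test_partial f)
  then show ?thesis
    using bump_integral_pos by (simp add: fiber_integral_partial_self f moment_def)
qed

lemma integration_by_parts:
  assumes f: "is_test f" and g: "smooth g"
  shows "(\<integral>x. partial i f x * g x \<partial>lborel) = - (\<integral>x. f x * partial i g x \<partial>lborel)"
proof -
  have "partial i (\<lambda>x. g x * f x) = (\<lambda>x. partial i f x * g x + f x * partial i g x)"
    using assms by (auto simp: partial_mult smooth_imp_differentiable is_test_smooth)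
  then have "0 = (\<integral>x. partial i f x * g x + f x * partial i g x \<partial>lborel)"
    using integral_partial_eq_0[OF is_test_mult[OF g f], of i] by simp
  also have "\<dots> = (\<integral>x. partial i f x * g x \<partial>lborel) + (\<integral>x. f x * partial i g x \<partial>lborel)"
    using integrable_test[OF is_test_mult[OF g is_test_partial[OF f, of i]]]
      integrable_test[OF is_test_mult[OF smooth_partial[OF g, of i] f]]
    by (intro Bochner_Integration.integral_add) (simp_all add: mult.commute)
  finally show ?thesis by simp
qed

section \<open>Distributions with vanishing high derivatives\<close>

text \<open>Induction on the number of functionals. If \<open>F i\<close> is non-zero somewhere on
  the common kernel of the others, subtracting a multiple of \<open>F i\<close> from
  \<open>T\<close> restores the hypothesis for the others; if not, \<open>F i\<close> gets
  coefficient 0.\<close>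

lemma linear_factors_through:
  fixes F :: "'i \<Rightarrow> 'a::real_vector \<Rightarrow> real" and T :: "'a \<Rightarrow> 'b::real_vector"
  assumes "finite I" "linear T" "\<And>i. i \<in> I \<Longrightarrow> linear (F i)"
    and "\<And>\<phi>. (\<And>i. i \<in> I \<Longrightarrow> F i \<phi> = 0) \<Longrightarrow> T \<phi> = 0"
  shows "\<exists>c. \<forall>\<phi>. T \<phi> = (\<Sum>i\<in>I. F i \<phi> *\<^sub>R c i)"
  using assms
proof (induction I arbitrary: T rule: finite_induct)
  case (insert i I)
  show ?case
  proof (cases "\<exists>\<phi>0. (\<forall>j\<in>I. F j \<phi>0 = 0) \<and> F i \<phi>0 \<noteq> 0")
    case True
    then obtain \<phi>0 where \<phi>0: "\<And>j. j \<in> I \<Longrightarrow> F j \<phi>0 = 0" "F i \<phi>0 \<noteq> 0" by blast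
    define d where "d = (1 / F i \<phi>0) *\<^sub>R T \<phi>0"
    note lin = insert.prems(1,2)
    have lin': "linear (\<lambda>\<phi>. T \<phi> - F i \<phi> *\<^sub>R d)"
      using lin(1) lin(2)[of i]
      by (intro linearI) (simp_all add: linear_add linear_scale algebra_simps)
    have vanish: "T \<phi> - F i \<phi> *\<^sub>R d = 0" if "\<And>j. j \<in> I \<Longrightarrow> F j \<phi> = 0" for \<phi>
    proof -
      let ?\<psi> = "\<phi> - (F i \<phi> / F i \<phi>0) *\<^sub>R \<phi>0"
      have "F j ?\<psi> = 0" if "j \<in> insert i I" for j
        using that \<phi>0 \<open>\<And>j. j \<in> I \<Longrightarrow> F j \<phi> = 0\<close> lin(2)[of j]
        by (auto simp: linear_diff linear_scale)
      then have "T ?\<psi> = 0" by (rule insert.prems(3))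
      then show ?thesis using lin(1) by (simp add: linear_diff linear_scale d_def)
    qed
    obtain c where c: "\<And>\<phi>. T \<phi> - F i \<phi> *\<^sub>R d = (\<Sum>j\<in>I. F j \<phi> *\<^sub>R c j)"
      using insert.IH[OF lin' _ vanish] lin(2) by auto
    have "T \<phi> = (\<Sum>j\<in>insert i I. F j \<phi> *\<^sub>R (c(i := d)) j)" for \<phi>
    proof -
      have "(\<Sum>j\<in>I. F j \<phi> *\<^sub>R (c(i := d)) j) = (\<Sum>j\<in>I. F j \<phi> *\<^sub>R c j)"
        using insert.hyps by (intro sum.cong) auto
      then show ?thesis using insert.hyps c[of \<phi>] by (simp add: algebra_simps)
    qed
    then show ?thesis by blast
  next
    case False
    have "\<exists>c. \<forall>\<phi>. T \<phi> = (\<Sum>j\<in>I. F j \<phi> *\<^sub>R c j)"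
      using insert.prems False by (intro insert.IH) auto
    then obtain c where c: "\<And>\<phi>. T \<phi> = (\<Sum>j\<in>I. F j \<phi> *\<^sub>R c j)" by blast
    have "T \<phi> = (\<Sum>j\<in>insert i I. F j \<phi> *\<^sub>R (c(i := 0)) j)" for \<phi>
    proof -
      have "(\<Sum>j\<in>I. F j \<phi> *\<^sub>R (c(i := 0)) j) = (\<Sum>j\<in>I. F j \<phi> *\<^sub>R c j)"
        using insert.hyps by (intro sum.cong) auto
      then show ?thesis using insert.hyps c[of \<phi>] by simp
    qed
    then show ?thesis by blast
  qed
qed simp

section \<open>Splitting a test function along all axes\<close>

lemma apply_test_sum: "apply_test (\<Sum>k\<in>I. \<phi> k) x = (\<Sum>k\<in>I. apply_test (\<phi> k) x)"
  by (induction I rule: infinite_finite_induct)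
    (simp_all add: zero_test_function.rep_eq plus_test_function.rep_eq)

lemma apply_test_partial_power: "apply_test ((partial_test i ^^ m) \<phi>) = (partial i ^^ m) (apply_test \<phi>)"
  by (induction m) (simp_all add: partial_test.rep_eq)

definition moment_parts ::
    "('n \<Rightarrow> nat \<Rightarrow> real \<Rightarrow> real) \<Rightarrow> ('n \<Rightarrow> nat) \<Rightarrow> 'n::finite list \<Rightarrow> (real^'n \<Rightarrow> real) \<Rightarrow> real^'n \<Rightarrow> real" where
  "moment_parts H \<beta> is f = foldr (\<lambda>i. moment_part (H i (\<beta> i)) (\<beta> i) i) is f"

lemma moment_parts_simps [simp]:
  "moment_parts H \<beta> [] f = f"
  "moment_parts H \<beta> (i # is) f = moment_part (H i (\<beta> i)) (\<beta> i) i (moment_parts H \<beta> is f)"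
  by (simp_all add: moment_parts_def)

lemma moment_parts_cong: "(\<And>i. i \<in> set is \<Longrightarrow> \<beta> i = \<gamma> i) \<Longrightarrow> moment_parts H \<beta> is f = moment_parts H \<gamma> is f"
  by (induction "is") simp_all

lemma is_test_moment_parts:
  "is_test f \<Longrightarrow> (\<And>i. i \<in> set is \<Longrightarrow> is_test_coord i (H i (\<beta> i))) \<Longrightarrow> is_test (moment_parts H \<beta> is f)"
  by (induction "is") (simp_all add: is_test_moment_part)

lemma integral_monomial_moment_parts:
  assumes "is_test f"
    and "\<And>i. i \<in> set is \<Longrightarrow> is_test_coord i (H i (\<beta> i)) \<and> moment (\<beta> i) (H i (\<beta> i)) = 1"
  shows "(\<integral>x. monomial_fun \<beta> x * moment_parts H \<beta> is f x \<partial>lborel) = (\<integral>x. monomial_fun \<beta> x * f x \<partial>lborel)"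
  using assms
  by (induction "is") (simp_all add: integral_monomial_moment_part is_test_moment_parts)

text \<open>Each direction splits off one factor of its own coordinate, and the remaining factor
  loses its dependence on that coordinate. Over all directions only a scalar multiple of a fixed
  product is left.\<close>

lemma moment_parts_separate:
  fixes H :: "'n::finite \<Rightarrow> nat \<Rightarrow> real \<Rightarrow> real"
  assumes "distinct is"
  shows "\<exists>R. (\<forall>x. moment_parts H \<beta> is f x = (\<Prod>i\<in>set is. H i (\<beta> i) (x $ i)) * R x) \<and>
    (\<forall>x t. \<forall>i\<in>set is. R (x + t *\<^sub>R axis i 1) = R x)"
  using assms
proof (induction "is")
  case (Cons i "is")
  then obtain R where R: "\<And>x. moment_parts H \<beta> is f x = (\<Prod>i\<in>set is. H i (\<beta> i) (x $ i)) * R x"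
    "\<And>x t j. j \<in> set is \<Longrightarrow> R (x + t *\<^sub>R axis j 1) = R x"
    by (metis distinct.simps(2))
  have i: "i \<notin> set is" using Cons.prems by simp
  define R' where "R' = fiber_integral UNIV i (\<lambda>y. (y $ i) ^ \<beta> i * R y)"
  have "moment_parts H \<beta> (i # is) f x = (\<Prod>i\<in>set (i # is). H i (\<beta> i) (x $ i)) * R' x" for x
  proof -
    have *: "(\<Prod>j\<in>set is. H j (\<beta> j) ((x + s *\<^sub>R axis i 1) $ j)) = (\<Prod>j\<in>set is. H j (\<beta> j) (x $ j))" for s
      using i by (intro prod.cong) (auto simp: axis_def)
    have "fiber_integral UNIV i (\<lambda>y. (y $ i) ^ \<beta> i * moment_parts H \<beta> is f y) x
        = (\<integral>s. (\<Prod>j\<in>set is. H j (\<beta> j) (x $ j)) *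
            (((x + s *\<^sub>R axis i 1) $ i) ^ \<beta> i * R (x + s *\<^sub>R axis i 1)) \<partial>lborel)"
      unfolding fiber_integral_UNIV R(1) * by (simp only: mult.left_commute)
    also have "\<dots> = (\<Prod>j\<in>set is. H j (\<beta> j) (x $ j)) * R' x"
      by (simp add: R'_def fiber_integral_UNIV)
    finally show ?thesis using i by (simp add: moment_part_def)
  qed
  moreover have "R' (x + t *\<^sub>R axis j 1) = R' x" if "j \<in> set (i # is)" for x t j
  proof (cases "j = i")
    case True
    \<comment> \<open>\<open>R\<close> is not known to be a test function, so
      \<open>fiber_integral_shift\<close> does not apply and the substitution is done
      directly.\<close>
    show ?thesis
      using lborel_integral_real_affine[of 1 "\<lambda>s. (x $ i + s) ^ \<beta> i * R (x + s *\<^sub>R axis i 1)" t]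
      by (simp add: True R'_def fiber_integral_UNIV scaleR_add_left add.assoc)
  next
    case False
    then have "R (x + t *\<^sub>R axis j 1 + s *\<^sub>R axis i 1) = R (x + s *\<^sub>R axis i 1)" for s
      using R(2)[of j "x + s *\<^sub>R axis i 1" t] that by (simp add: add.commute add.left_commute)
    then show ?thesis using False by (simp add: R'_def fiber_integral_UNIV axis_def)
  qed
  ultimately show ?case by blast
qed auto

lemma axis_invariant_imp_const:
  fixes R :: "real^'n::finite \<Rightarrow> 'b"
  assumes "\<And>x t i. R (x + t *\<^sub>R axis i 1) = R x"
  shows "R x = R 0"
proof -
  have "R (\<Sum>i\<in>J. x $ i *\<^sub>R axis i 1) = R 0" for J
    by (induction J rule: infinite_finite_induct) (simp_all add: assms add.commute[of "_ *\<^sub>R _"])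
  from this[of UNIV] show ?thesis
    by (simp add: basis_expansion flip: scalar_mult_eq_scaleR)
qed

definition cube_bump :: "real^'n::finite \<Rightarrow> real" where
  "cube_bump x = (\<Prod>i\<in>UNIV. bump (x $ i))"

lemma cube_bump_nonneg: "0 \<le> cube_bump x"
  by (simp add: cube_bump_def prod_nonneg bump_nonneg)

lemma cube_bump_pos: "(\<And>i. \<bar>x $ i\<bar> < 1) \<Longrightarrow> 0 < cube_bump x"
  by (simp add: cube_bump_def prod_pos bump_pos)

lemma is_test_cube_bump: "is_test (cube_bump :: real^'n::finite \<Rightarrow> real)"
proof -
  have "smooth (cube_bump :: real^'n \<Rightarrow> real)"
    unfolding cube_bump_def[abs_def] by (intro smooth_prod smooth_bump)
  moreover have "norm x \<le> real CARD('n) * 1" if "cube_bump x \<noteq> 0" for x :: "real^'n"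
    using that by (intro norm_le_card bump_support) (auto simp: cube_bump_def)
  ultimately show ?thesis by (auto simp: is_test_iff)
qed

text \<open>The integrand is the square of \<open>f\<close> times a non-negative weight that is
  positive on the open cube.\<close>

lemma smooth_zero_on_cube:
  assumes f: "smooth f" and "(\<integral>x. f x * (f x * cube_bump x) \<partial>lborel) = 0" and x: "\<And>i. \<bar>x $ i\<bar> < 1"
  shows "f x = 0"
proof -
  have t: "is_test (\<lambda>x. f x * (f x * cube_bump x))"
    by (intro is_test_mult f is_test_cube_bump)
  have "f x * (f x * cube_bump x) = 0"
    by (rule continuous_nonneg_integral_eq_0[OF integrable_test[OF t] smooth_continuous[OF is_test_smooth[OF t]] _ assms(2)])
      (simp add: cube_bump_nonneg flip: mult.assoc)
  then show ?thesis using cube_bump_pos[OF x] by simp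
qed

lemma ex_test_monomial_integral: "\<exists>f. is_test f \<and> (\<integral>x. monomial_fun \<beta> x * f x \<partial>lborel) \<noteq> 0"
proof (intro exI conjI notI)
  show "is_test (\<lambda>x. monomial_fun \<beta> x * cube_bump x)"
    by (intro is_test_mult smooth_monomial_fun is_test_cube_bump)
  assume "(\<integral>x. monomial_fun \<beta> x * (monomial_fun \<beta> x * cube_bump x) \<partial>lborel) = 0"
  \<comment> \<open>At this interior point of the cube no coordinate is 0, so no monomial
    vanishes.\<close>
  then have "monomial_fun \<beta> (\<chi> i. 1 / 2) = 0"
    by (rule smooth_zero_on_cube[OF smooth_monomial_fun]) simp
  then show False by (simp add: monomial_fun_def)
qed

text \<open>At each direction the current function splits into moment parts and an
  \<open>m\<close>-fold derivative; \<open>T\<close> kills the latter, so it is non-zero on one of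
  the parts, whose order is recorded in \<open>\<beta>\<close>.\<close>

lemma ex_moment_parts_nonzero:
  fixes T :: "'n::finite test_function \<Rightarrow> real^'m::finite"
  assumes T: "linear T" "\<And>i \<phi>. T ((partial_test i ^^ m) \<phi>) = 0"
    and H: "\<And>i k. k < m \<Longrightarrow> is_test_coord i (H i k)"
      "\<And>i k r. k < m \<Longrightarrow> r < m \<Longrightarrow> moment r (H i k) = (if r = k then 1 else 0)"
    and f: "is_test f" "T (Abs_test f) \<noteq> 0" and "distinct is"
  shows "\<exists>\<beta>. (\<forall>i\<in>set is. \<beta> i < m) \<and> T (Abs_test (moment_parts H \<beta> is f)) \<noteq> 0"
  using \<open>distinct is\<close>
proof (induction "is")
  case (Cons i "is")
  then obtain \<beta> where \<beta>: "\<And>i. i \<in> set is \<Longrightarrow> \<beta> i < m" "T (Abs_test (moment_parts H \<beta> is f)) \<noteq> 0" by auto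
  let ?g = "moment_parts H \<beta> is f"
  have g: "is_test ?g" using \<beta>(1) by (intro is_test_moment_parts f H)
  obtain h where h: "is_test h"
    "?g = (\<lambda>x. (\<Sum>k<m. moment_part (H i k) k i ?g x) + (partial i ^^ m) h x)"
    using moment_part_decomposition[of m i "H i", OF H(1) H(2) g] by auto
  have parts: "is_test (moment_part (H i k) k i ?g)" if "k < m" for k
    using that by (intro is_test_moment_part H g)
  have "Abs_test ?g = (\<Sum>k<m. Abs_test (moment_part (H i k) k i ?g)) + (partial_test i ^^ m) (Abs_test h)"
  proof (rule apply_test_inject[THEN iffD1], rule ext)
    fix x
    have "apply_test ((\<Sum>k<m. Abs_test (moment_part (H i k) k i ?g)) + (partial_test i ^^ m) (Abs_test h)) x
        = (\<Sum>k<m. moment_part (H i k) k i ?g x) + (partial i ^^ m) h x"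
      using h(1) parts by (simp add: plus_test_function.rep_eq apply_test_sum apply_test_partial_power)
    also have "\<dots> = ?g x" using fun_cong[OF h(2), of x] by simp
    finally show "apply_test (Abs_test ?g) x
        = apply_test ((\<Sum>k<m. Abs_test (moment_part (H i k) k i ?g)) + (partial_test i ^^ m) (Abs_test h)) x"
      using g by simp
  qed
  then have "T (Abs_test ?g) = (\<Sum>k<m. T (Abs_test (moment_part (H i k) k i ?g)))"
    using T by (simp add: linear_add linear_sum)
  then obtain k where k: "k < m" "T (Abs_test (moment_part (H i k) k i ?g)) \<noteq> 0"
    using \<beta>(2) by (metis (no_types, lifting) lessThan_iff sum.neutral)
  \<comment> \<open>The new direction does not occur in the old list, so setting its order leaves
    the earlier parts unchanged.\<close>
  have "moment_parts H (\<beta>(i := k)) is f = ?g"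
    using Cons.prems by (intro moment_parts_cong) auto
  then have "T (Abs_test (moment_parts H (\<beta>(i := k)) (i # is) f)) \<noteq> 0" using k by simp
  moreover have "\<forall>j\<in>set (i # is). (\<beta>(i := k)) j < m" using \<beta>(1) k(1) by auto
  ultimately show ?case by blast
qed (use f in auto)

text \<open>If \<open>T \<phi>\<close> were non-zero, \<open>T\<close> would be non-zero on a
  function obtained from \<open>\<phi>\<close> by taking moment parts along all axes. That function
  is a scalar multiple of a product \<open>?G\<close> independent of \<open>\<phi>\<close>, and the
  scalar is fixed by the moment of \<open>\<phi>\<close> for the monomial \<open>\<beta>\<close>,
  which is 0.\<close>

lemma vanishes_on_zero_moments:
  fixes T :: "'n::finite test_function \<Rightarrow> real^'m::finite"
  assumes T: "linear T" "\<And>i \<phi>. T ((partial_test i ^^ m) \<phi>) = 0"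
    and zero: "\<And>\<beta>. (\<And>i. \<beta> i < m) \<Longrightarrow> (\<integral>x. monomial_fun \<beta> x * apply_test \<phi> x \<partial>lborel) = 0"
  shows "T \<phi> = 0"
proof (rule ccontr)
  assume ne: "T \<phi> \<noteq> 0"
  let ?f = "apply_test \<phi>"
  have "\<exists>H. \<forall>k<m. is_test_coord i (H k) \<and> (\<forall>r<m. moment r (H k) = (if r = k then 1 else 0))" for i :: 'n
    by (rule ex_dual_moments)
  then obtain H :: "'n \<Rightarrow> nat \<Rightarrow> real \<Rightarrow> real" where
    "\<forall>i. \<forall>k<m. is_test_coord i (H i k) \<and> (\<forall>r<m. moment r (H i k) = (if r = k then 1 else 0))" by metis
  then have H: "\<And>i k. k < m \<Longrightarrow> is_test_coord i (H i k)"
    "\<And>i k r. k < m \<Longrightarrow> r < m \<Longrightarrow> moment r (H i k) = (if r = k then 1 else 0)" by blast+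
  obtain l :: "'n list" where l: "set l = UNIV" "distinct l"
    using finite_distinct_list[of "UNIV :: 'n set"] by auto
  have "T (Abs_test ?f) \<noteq> 0" using ne by (simp add: apply_test_inverse)
  then obtain \<beta> where \<beta>: "\<And>i. \<beta> i < m" "T (Abs_test (moment_parts H \<beta> l ?f)) \<noteq> 0"
    using ex_moment_parts_nonzero[OF T H is_test_apply_test _ l(2)] l(1) by blast
  let ?G = "\<lambda>x :: real^'n. \<Prod>i\<in>UNIV. H i (\<beta> i) (x $ i)"
  have multiple: "\<exists>c. moment_parts H \<beta> l f = (\<lambda>x. c * ?G x)" for f
  proof -
    obtain R where R: "\<And>x. moment_parts H \<beta> l f x = ?G x * R x" "\<And>x t i. R (x + t *\<^sub>R axis i 1) = R x"
      using moment_parts_separate[OF l(2), of H \<beta> f] l(1) by auto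
    have "moment_parts H \<beta> l f x = R 0 * ?G x" for x
      using R(1)[of x] axis_invariant_imp_const[of R x, OF R(2)] by simp
    then show ?thesis by blast
  qed
  have int: "(\<integral>x. monomial_fun \<beta> x * moment_parts H \<beta> l f x \<partial>lborel) = (\<integral>x. monomial_fun \<beta> x * f x \<partial>lborel)"
    if "is_test f" for f
    using that \<beta>(1) by (intro integral_monomial_moment_parts) (auto simp: H)
  \<comment> \<open>An auxiliary test function with non-zero moment shows that \<open>?G\<close> has
    one too, without factorising its integral.\<close>
  obtain f0 where f0: "is_test f0" "(\<integral>x. monomial_fun \<beta> x * f0 x \<partial>lborel) \<noteq> 0"
    using ex_test_monomial_integral by blast
  obtain c0 where c0: "moment_parts H \<beta> l f0 = (\<lambda>x. c0 * ?G x)" using multiple by blast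
  obtain c where c: "moment_parts H \<beta> l ?f = (\<lambda>x. c * ?G x)" using multiple by blast
  have "c0 * (\<integral>x. monomial_fun \<beta> x * ?G x \<partial>lborel) \<noteq> 0"
    using int[OF f0(1)] f0(2) by (simp add: c0 mult.left_commute)
  moreover have "c * (\<integral>x. monomial_fun \<beta> x * ?G x \<partial>lborel) = 0"
    using int[OF is_test_apply_test[of \<phi>]] zero[of \<beta>] \<beta>(1) by (simp add: c mult.left_commute)
  ultimately have "c = 0" by auto
  then have "moment_parts H \<beta> l ?f = apply_test 0" by (simp add: c zero_test_function.rep_eq)
  then have "Abs_test (moment_parts H \<beta> l ?f) = 0" by (simp add: apply_test_inverse)
  with \<beta>(2) T(1) show False by (simp add: linear_0)
qed

lemma integral_test_scaleR_polynomial: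
  fixes c :: "('n::finite \<Rightarrow> nat) \<Rightarrow> real^'m::finite"
  shows "(\<integral>x. apply_test \<phi> x *\<^sub>R (\<Sum>\<beta>\<in>I. monomial_fun \<beta> x *\<^sub>R c \<beta>) \<partial>lborel)
    = (\<Sum>\<beta>\<in>I. (\<integral>x. monomial_fun \<beta> x * apply_test \<phi> x \<partial>lborel) *\<^sub>R c \<beta>)"
proof -
  have int: "integrable lborel (\<lambda>x. monomial_fun \<beta> x * apply_test \<phi> x)" for \<beta>
    by (intro integrable_test is_test_mult smooth_monomial_fun) simp
  have "(\<integral>x. apply_test \<phi> x *\<^sub>R (\<Sum>\<beta>\<in>I. monomial_fun \<beta> x *\<^sub>R c \<beta>) \<partial>lborel)
      = (\<integral>x. (\<Sum>\<beta>\<in>I. (monomial_fun \<beta> x * apply_test \<phi> x) *\<^sub>R c \<beta>) \<partial>lborel)"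
    by (simp add: scaleR_sum_right mult.commute)
  also have "\<dots> = (\<Sum>\<beta>\<in>I. \<integral>x. (monomial_fun \<beta> x * apply_test \<phi> x) *\<^sub>R c \<beta> \<partial>lborel)"
    by (intro Bochner_Integration.integral_sum integrable_scaleR_left int)
  also have "\<dots> = (\<Sum>\<beta>\<in>I. (\<integral>x. monomial_fun \<beta> x * apply_test \<phi> x \<partial>lborel) *\<^sub>R c \<beta>)"
    by (simp add: int)
  finally show ?thesis .
qed

text \<open>\<open>v\<close> vanishes wherever finitely many monomial moments do, hence is a
  combination of them, and such a combination is integration against a polynomial.\<close>

lemma distribution_polynomial:
  fixes v :: "('n::finite, 'm::finite) distribution"
  assumes v: "\<And>i \<phi>. apply_dist v ((partial_test i ^^ m) \<phi>) = 0"
  shows "v \<in> regular_dist ` polynomials_upto (CARD('n) * m)"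
proof -
  define I where "I = {\<beta> :: 'n \<Rightarrow> nat. \<forall>i. \<beta> i < m}"
  \<comment> \<open>The exponents in \<open>I\<close> are bounded one by one; the total degree bound
    is a crude one that contains them all.\<close>
  let ?J = "{\<beta> :: 'n \<Rightarrow> nat. (\<Sum>i\<in>UNIV. \<beta> i) \<le> CARD('n) * m}"
  have IJ: "I \<subseteq> ?J"
  proof
    fix \<beta> assume "\<beta> \<in> I"
    then have "\<beta> i \<le> m" for i by (simp add: I_def less_imp_le)
    then show "\<beta> \<in> ?J" using sum_bounded_above[of UNIV \<beta> m] by simp
  qed
  have J: "finite ?J" by (rule finite_multi_indices)
  have T: "linear (apply_dist v)" using apply_dist[of v] by (simp add: is_distribution_def)
  define F where "F \<beta> \<phi> = (\<integral>x. monomial_fun \<beta> x * apply_test \<phi> x \<partial>lborel)" for \<beta> and \<phi> :: "'n test_function"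
  have "integrable lborel (\<lambda>x. monomial_fun \<beta> x * apply_test \<phi> x)" for \<beta> and \<phi> :: "'n test_function"
    by (intro integrable_test is_test_mult smooth_monomial_fun) simp
  then have linF: "linear (F \<beta>)" for \<beta>
    by (intro linearI) (simp_all add: F_def plus_test_function.rep_eq scaleR_test_function.rep_eq
        distrib_left mult.left_commute)
  have "apply_dist v \<phi> = 0" if "\<And>\<beta>. \<beta> \<in> I \<Longrightarrow> F \<beta> \<phi> = 0" for \<phi>
    using that by (intro vanishes_on_zero_moments[OF T v]) (simp add: F_def I_def)
  then obtain c where c: "\<And>\<phi>. apply_dist v \<phi> = (\<Sum>\<beta>\<in>I. F \<beta> \<phi> *\<^sub>R c \<beta>)"
    using linear_factors_through[OF finite_subset[OF IJ J] T linF, of "\<lambda>\<beta>. \<beta>"] by blast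
  define d where "d \<beta> = (if \<beta> \<in> I then c \<beta> else 0)" for \<beta>
  define p where "p = (\<lambda>x. \<Sum>\<beta>\<in>?J. monomial_fun \<beta> x *\<^sub>R d \<beta>)"
  have p: "p \<in> polynomials_upto (CARD('n) * m)"
    by (auto simp: polynomials_upto_def p_def monomial_fun_def)
  have "apply_dist v \<phi> = apply_dist (regular_dist p) \<phi>" for \<phi>
  proof -
    have "apply_dist v \<phi> = (\<Sum>\<beta>\<in>?J. F \<beta> \<phi> *\<^sub>R d \<beta>)"
      unfolding c by (rule sum.mono_neutral_cong_left[OF J IJ]) (auto simp: d_def)
    also have "\<dots> = (\<integral>x. apply_test \<phi> x *\<^sub>R p x \<partial>lborel)"
      by (simp add: p_def integral_test_scaleR_polynomial F_def)
    finally show ?thesis using locally_integrable_polynomial[OF p] by (simp add: regular_dist.rep_eq)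
  qed
  then have "v = regular_dist p" by (intro apply_dist_inject[THEN iffD1] ext)
  with p show ?thesis by blast
qed

section \<open>The nullspace\<close>

lemma apply_dist_sum: "apply_dist (\<Sum>i\<in>I. v i) \<phi> = (\<Sum>i\<in>I. apply_dist (v i) \<phi>)"
  by (induction I rule: infinite_finite_induct)
    (simp_all add: zero_distribution.rep_eq plus_distribution.rep_eq)

lemma apply_dist_eqI: "(\<And>\<phi>. apply_dist u \<phi> = apply_dist v \<phi>) \<Longrightarrow> u = v"
  by (metis apply_dist_inject ext)

lemma apply_diff_op:
  assumes "\<And>i. linear (A i)"
  shows "apply_dist (diff_op A v) \<phi> = - (\<Sum>i\<in>UNIV. A i (apply_dist v (partial_test i \<phi>)))"
  using assms
  by (simp add: diff_op_def apply_dist_sum comp_dist.rep_eq partial_dist.rep_eq linear_neg sum_negf)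

lemma nullspace_iff:
  assumes "\<And>i. linear (A i)"
  shows "v \<in> nullspace A \<longleftrightarrow> (\<forall>\<phi>. (\<Sum>i\<in>UNIV. A i (apply_dist v (partial_test i \<phi>))) = 0)"
proof -
  have "v \<in> nullspace A \<longleftrightarrow> (\<forall>\<phi>. apply_dist (diff_op A v) \<phi> = 0)"
    by (auto simp: nullspace_def zero_distribution.rep_eq intro: apply_dist_eqI)
  then show ?thesis by (simp add: apply_diff_op assms)
qed

lemma subspace_nullspace:
  assumes A: "\<And>i. linear (A i)"
  shows "subspace (nullspace A)"
  by (rule subspaceI) (simp_all add: nullspace_iff A zero_distribution.rep_eq plus_distribution.rep_eq
      scaleR_distribution.rep_eq linear_0 linear_add linear_scale sum.distrib flip: scaleR_sum_right)

section \<open>Solutions of elliptic operators are polynomials\<close>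

lemma partial_test_commute: "partial_test i (partial_test j \<phi>) = partial_test j (partial_test i \<phi>)"
  by (rule apply_test_inject[THEN iffD1]) (simp add: partial_test.rep_eq partial_commute)

text \<open>Commuting derivatives can be indexed by multisets, as the arrays of
  \<open>homogeneous_solutions\<close> are.\<close>

interpretation partial_test: comp_fun_commute partial_test
  by standard (simp add: fun_eq_iff partial_test_commute)

lemma fold_mset_replicate: "fold_mset partial_test \<phi> (replicate_mset k i) = (partial_test i ^^ k) \<phi>"
  by (induction k) simp_all

lemma complexify_of_real:
  assumes "linear L"
  shows "complexify L (\<chi> j. complex_of_real (x $ j)) = (\<chi> j. complex_of_real (L x $ j))"
proof -
  have "(\<chi> i. 0) = (0 :: real^'a)" by (simp add: vec_eq_iff)
  then show ?thesis
    unfolding complexify_def by (simp add: linear_0[OF assms] complex_of_real_def)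
qed

lemma C_elliptic_imp_polynomials:
  fixes A :: "'n::finite \<Rightarrow> real^'N::finite \<Rightarrow> real^'K::finite"
  assumes A: "\<And>i. linear (A i)" and ell: "C_elliptic A"
  shows "\<exists>l. nullspace A \<subseteq> regular_dist ` polynomials_upto l"
proof -
  obtain k where k: "homogeneous_solutions A UNIV k = {0}"
    using homogeneous_solutions_eventually_zero[of A, OF A ell] by blast
  have "apply_dist v ((partial_test i ^^ k) \<phi>) = 0" if v: "v \<in> nullspace A" for v i \<phi>
  proof -
    let ?D = "\<lambda>M. apply_dist v (fold_mset partial_test \<phi> M)"
    \<comment> \<open>Up to the sign \<open>(-1)^k\<close>, common to all entries, these are the
      derivatives of \<open>v\<close> of order \<open>k\<close> evaluated at
      \<open>\<phi>\<close>.\<close>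
    define w where "w M = (if size M = k then \<chi> j. complex_of_real (?D M $ j) else 0)" for M :: "'n multiset"
    have "(\<Sum>i\<in>UNIV. complexify (A i) (w (add_mset i M))) = 0" for M
    proof (cases "Suc (size M) = k")
      case True
      \<comment> \<open>The equation for \<open>v\<close>, tested with the derivative of
        \<open>\<phi>\<close> indexed by \<open>M\<close>.\<close>
      have "(\<Sum>i\<in>UNIV. A i (?D (add_mset i M))) = 0"
        using v by (simp add: nullspace_iff A)
      then have "(\<Sum>i\<in>UNIV. A i (?D (add_mset i M)) $ j) = 0" for j
        by (metis sum_component zero_index)
      then have "(\<Sum>i\<in>UNIV. complex_of_real (A i (?D (add_mset i M)) $ j)) = 0" for j
        by (metis of_real_0 of_real_sum)
      then show ?thesis
        using True by (simp add: w_def complexify_of_real A vec_eq_iff)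
    next
      case False
      then show ?thesis by (simp add: w_def complexify_zero A)
    qed
    then have "w \<in> homogeneous_solutions A UNIV k"
      by (simp add: homogeneous_solutions_def w_def)
    then have "w (replicate_mset k i) = 0" using k by simp
    then show ?thesis by (simp add: w_def vec_eq_iff fold_mset_replicate)
  qed
  then show ?thesis using distribution_polynomial by blast
qed

text \<open>Monomials times unit vectors span the polynomials, and the expansion is carried over to
  distributions by testing both sides.\<close>

lemma polynomials_imp_finite_dimensional:
  fixes A :: "'n::finite \<Rightarrow> real^'N::finite \<Rightarrow> real^'K::finite"
  assumes A: "\<And>i. linear (A i)" and l: "nullspace A \<subseteq> regular_dist ` polynomials_upto l"
  shows "finite_dimensional (nullspace A)"
proof -
  let ?J = "{\<beta> :: 'n \<Rightarrow> nat. (\<Sum>i\<in>UNIV. \<beta> i) \<le> l}"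
  have J: "finite ?J" by (rule finite_multi_indices)
  define q where "q \<beta> j = (\<lambda>x. monomial_fun \<beta> x *\<^sub>R (axis j 1 :: real^'N))" for \<beta> :: "'n \<Rightarrow> nat" and j
  have q: "q \<beta> j \<in> polynomials_upto l" if "\<beta> \<in> ?J" for \<beta> j
  proof -
    have "q \<beta> j = (\<lambda>x. \<Sum>\<gamma>\<in>?J. monomial_fun \<gamma> x *\<^sub>R (if \<gamma> = \<beta> then axis j 1 else 0))"
      using that J by (simp add: q_def if_distrib[of "\<lambda>c. _ *\<^sub>R c"] sum.delta cong: if_cong)
    then show ?thesis
      unfolding polynomials_upto_def monomial_fun_def
      by (intro CollectI exI[of _ "\<lambda>\<gamma>. if \<gamma> = \<beta> then axis j 1 else 0"])
  qed
  have "regular_dist p \<in> span ((\<lambda>(\<beta>, j). regular_dist (q \<beta> j)) ` (?J \<times> UNIV))"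
    if p: "p \<in> polynomials_upto l" for p
  proof -
    obtain c where c: "p = (\<lambda>x. \<Sum>\<beta>\<in>?J. monomial_fun \<beta> x *\<^sub>R c \<beta>)"
      using p by (auto simp: polynomials_upto_def monomial_fun_def)
    have "regular_dist p = (\<Sum>\<beta>\<in>?J. \<Sum>j\<in>UNIV. (c \<beta> $ j) *\<^sub>R regular_dist (q \<beta> j))"
    proof (rule apply_dist_eqI)
      fix \<phi> :: "'n test_function"
      let ?F = "\<lambda>\<beta>. \<integral>x. monomial_fun \<beta> x * apply_test \<phi> x \<partial>lborel"
      have "apply_dist (regular_dist p) \<phi> = (\<Sum>\<beta>\<in>?J. ?F \<beta> *\<^sub>R c \<beta>)"
        using locally_integrable_polynomial[OF p]
        by (simp add: regular_dist.rep_eq c integral_test_scaleR_polynomial)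
      also have "\<dots> = (\<Sum>\<beta>\<in>?J. \<Sum>j\<in>UNIV. (c \<beta> $ j) *\<^sub>R ?F \<beta> *\<^sub>R axis j 1)"
      proof (rule sum.cong[OF refl])
        fix \<beta>
        have "?F \<beta> *\<^sub>R c \<beta> = ?F \<beta> *\<^sub>R (\<Sum>j\<in>UNIV. (c \<beta> $ j) *\<^sub>R axis j 1)"
          by (simp add: basis_expansion flip: scalar_mult_eq_scaleR)
        then show "?F \<beta> *\<^sub>R c \<beta> = (\<Sum>j\<in>UNIV. (c \<beta> $ j) *\<^sub>R ?F \<beta> *\<^sub>R axis j 1)"
          by (simp add: scaleR_sum_right mult.commute)
      qed
      also have "\<dots> = (\<Sum>\<beta>\<in>?J. \<Sum>j\<in>UNIV. (c \<beta> $ j) *\<^sub>R apply_dist (regular_dist (q \<beta> j)) \<phi>)"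
      proof (intro sum.cong refl arg_cong[where f = "scaleR _"])
        fix \<beta> j assume "\<beta> \<in> ?J"
        then show "?F \<beta> *\<^sub>R axis j 1 = apply_dist (regular_dist (q \<beta> j)) \<phi>"
          using locally_integrable_polynomial[OF q, of \<beta> j]
            integral_test_scaleR_polynomial[of \<phi> "\<lambda>_. axis j 1" "{\<beta>}"]
          by (simp add: regular_dist.rep_eq q_def)
      qed
      also have "\<dots> = apply_dist (\<Sum>\<beta>\<in>?J. \<Sum>j\<in>UNIV. (c \<beta> $ j) *\<^sub>R regular_dist (q \<beta> j)) \<phi>"
        by (simp add: apply_dist_sum scaleR_distribution.rep_eq)
      finally show "apply_dist (regular_dist p) \<phi> = \<dots>" .
    qed
    then show ?thesis by (auto intro!: span_sum span_scale intro: span_base)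
  qed
  then have "nullspace A \<subseteq> span ((\<lambda>(\<beta>, j). regular_dist (q \<beta> j)) ` (?J \<times> UNIV))" using l by blast
  then show ?thesis
    using real_vector.subspace_eq_span[OF subspace_nullspace[of A, OF A]] J
    unfolding finite_dimensional_def by (metis finite_SigmaI finite_code finite_imageI)
qed

section \<open>Powers of a complex linear form as solutions\<close>

definition complex_form :: "complex^'n \<Rightarrow> real^'n::finite \<Rightarrow> complex" where
  "complex_form \<xi> x = (\<Sum>i\<in>UNIV. \<xi> $ i * complex_of_real (x $ i))"

lemma complex_form_axis: "complex_form \<xi> (s *\<^sub>R axis i 1) = \<xi> $ i * complex_of_real s"
proof -
  have "complex_form \<xi> (s *\<^sub>R axis i 1) = (\<Sum>j\<in>UNIV. if j = i then \<xi> $ j * complex_of_real s else 0)"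
    unfolding complex_form_def by (intro sum.cong) (auto simp: axis_def)
  then show ?thesis by simp
qed

lemma bounded_linear_complex_form: "bounded_linear (complex_form \<xi>)"
  unfolding complex_form_def[abs_def]
  by (intro bounded_linear_sum bounded_linear_const_mult bounded_linear_compose[OF bounded_linear_of_real bounded_linear_vec_nth])

lemma complex_form_power_has_derivative:
  "((\<lambda>x. Re (complex_form \<xi> x ^ k * c)) has_derivative
    (\<lambda>h. Re (of_nat k * complex_form \<xi> h * complex_form \<xi> x ^ (k - 1) * c))) (at x)"
proof -
  have "(complex_form \<xi> has_derivative complex_form \<xi>) (at x)"
    by (rule bounded_linear_imp_has_derivative[OF bounded_linear_complex_form])
  from has_derivative_power[OF this, of k]
  have "((\<lambda>x. complex_form \<xi> x ^ k) has_derivative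
      (\<lambda>h. of_nat k * complex_form \<xi> h * complex_form \<xi> x ^ (k - 1))) (at x)" .
  then show ?thesis
    by (intro bounded_linear.has_derivative[OF bounded_linear_Re] has_derivative_mult_left)
qed

text \<open>For \<open>k = 0\<close> the truncated exponent \<open>k - 1\<close> is harmless because
  of the factor \<open>of_nat k\<close>.\<close>

lemma partial_complex_form_power:
  "partial i (\<lambda>x. Re (complex_form \<xi> x ^ k * c)) =
    (\<lambda>x. Re (complex_form \<xi> x ^ (k - 1) * (of_nat k * \<xi> $ i * c)))"
proof
  fix x
  show "partial i (\<lambda>x. Re (complex_form \<xi> x ^ k * c)) x = Re (complex_form \<xi> x ^ (k - 1) * (of_nat k * \<xi> $ i * c))"
    using partial_eqI[OF complex_form_power_has_derivative[of \<xi> k c x], of i] complex_form_axis[of \<xi> 1 i]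
    by (simp add: mult_ac)
qed

lemma smooth_complex_form_power: "smooth (\<lambda>x. Re (complex_form \<xi> x ^ k * c))"
proof (rule smooth_coinduct[of _ "{\<lambda>x. Re (complex_form \<xi> x ^ k * c) |k c. True}"])
  fix f :: "real^'a \<Rightarrow> real" and i assume "f \<in> {\<lambda>x. Re (complex_form \<xi> x ^ k * c) |k c. True}"
  then obtain k c where f: "f = (\<lambda>x. Re (complex_form \<xi> x ^ k * c))" by blast
  show "f differentiable_on UNIV"
    unfolding f by (rule differentiable_at_imp_differentiable_on) (rule differentiableI[OF complex_form_power_has_derivative])
  show "partial i f \<in> {\<lambda>x. Re (complex_form \<xi> x ^ k * c) |k c. True}"
    unfolding f partial_complex_form_power by blast
qed blast

text \<open>The real part of \<open>(\<xi> . x)^k \<eta>\<close>; the pairing is bilinear, without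
  conjugation, so that its derivatives are the components of \<open>\<xi>\<close>.\<close>

definition plane_power :: "complex^'n \<Rightarrow> complex^'m \<Rightarrow> nat \<Rightarrow> real^'n::finite \<Rightarrow> real^'m::finite" where
  "plane_power \<xi> \<eta> k x = (\<chi> l. Re (complex_form \<xi> x ^ k * \<eta> $ l))"

lemma locally_integrable_plane_power: "locally_integrable (plane_power \<xi> \<eta> k)"
proof -
  have "continuous_on K (plane_power \<xi> \<eta> k)" for K
    unfolding plane_power_def[abs_def]
    by (intro continuous_on_vec_lambda smooth_continuous smooth_complex_form_power)
  then show ?thesis
    by (auto simp: locally_integrable_def set_integrable_def intro!: borel_integrable_compact)
qed

lemma apply_dist_plane_power:
  "apply_dist (regular_dist (plane_power \<xi> \<eta> k)) \<phi> = (\<integral>x. apply_test \<phi> x *\<^sub>R plane_power \<xi> \<eta> k x \<partial>lborel)"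
  and integrable_plane_power: "integrable lborel (\<lambda>x. apply_test \<phi> x *\<^sub>R plane_power \<xi> \<eta> k x)"
  using locally_integrable_plane_power[of \<xi> \<eta> k]
    integrable_test_scaleR(1)[OF locally_integrable_plane_power compact_supp_apply_test subset_refl]
  by (simp_all add: regular_dist.rep_eq)

text \<open>A real linear map commutes with taking real parts once it is extended complex
  linearly.\<close>

lemma linear_plane_power:
  assumes "linear L"
  shows "L (plane_power \<xi> \<eta> k x) = plane_power \<xi> (complexify L \<eta>) k x"
proof -
  have "plane_power \<xi> \<eta> k x = (\<chi> l. Re ((complex_form \<xi> x ^ k *s \<eta>) $ l))"
    by (simp add: plane_power_def)
  then have "L (plane_power \<xi> \<eta> k x) $ l = Re (complexify L (complex_form \<xi> x ^ k *s \<eta>) $ l)" for l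
    by (simp add: complexify_def)
  then show ?thesis
    by (simp add: vec_eq_iff complexify_scale assms plane_power_def)
qed

text \<open>After integration by parts the operator acts on the polynomial and produces the vector
  \<open>symbol A \<xi> \<eta>\<close>, up to the scalar \<open>k (\<xi> . x)^(k-1)\<close>.\<close>

lemma plane_power_in_nullspace:
  assumes A: "\<And>i. linear (A i)" and "symbol A \<xi> \<eta> = 0"
  shows "regular_dist (plane_power \<xi> \<eta> k) \<in> nullspace A"
proof -
  have "(\<Sum>i\<in>UNIV. A i (apply_dist (regular_dist (plane_power \<xi> \<eta> k)) (partial_test i \<phi>))) = 0" for \<phi>
  proof -
    let ?f = "apply_test \<phi>"
    have "A i (apply_dist (regular_dist (plane_power \<xi> \<eta> k)) (partial_test i \<phi>)) $ l
        = - (\<integral>x. ?f x * Re (complex_form \<xi> x ^ (k - 1) * (of_nat k * \<xi> $ i * complexify (A i) \<eta> $ l)) \<partial>lborel)" for i l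
    proof -
      let ?\<zeta> = "complexify (A i) \<eta>"
      have "A i (apply_dist (regular_dist (plane_power \<xi> \<eta> k)) (partial_test i \<phi>))
          = (\<integral>x. A i (partial i ?f x *\<^sub>R plane_power \<xi> \<eta> k x) \<partial>lborel)"
        unfolding apply_dist_plane_power partial_test.rep_eq[symmetric]
        by (rule integral_bounded_linear[OF linear_conv_bounded_linear[THEN iffD1, OF A] integrable_plane_power, symmetric])
      also have "\<dots> = (\<integral>x. partial i ?f x *\<^sub>R plane_power \<xi> ?\<zeta> k x \<partial>lborel)"
        by (simp add: linear_scale[OF A] linear_plane_power[OF A])
      also have "\<dots> $ l = (\<integral>x. (partial i ?f x *\<^sub>R plane_power \<xi> ?\<zeta> k x) $ l \<partial>lborel)"
        unfolding partial_test.rep_eq[symmetric]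
        by (rule integral_bounded_linear[OF bounded_linear_vec_nth integrable_plane_power, symmetric])
      also have "\<dots> = (\<integral>x. partial i ?f x * Re (complex_form \<xi> x ^ k * ?\<zeta> $ l) \<partial>lborel)"
        by (simp add: plane_power_def)
      also have "\<dots> = - (\<integral>x. ?f x * partial i (\<lambda>x. Re (complex_form \<xi> x ^ k * ?\<zeta> $ l)) x \<partial>lborel)"
        by (intro integration_by_parts smooth_complex_form_power) simp
      finally show ?thesis by (simp only: partial_complex_form_power)
    qed
    note comp = this
    have "(\<Sum>i\<in>UNIV. A i (apply_dist (regular_dist (plane_power \<xi> \<eta> k)) (partial_test i \<phi>))) $ l = 0" for l
    proof -
      let ?c = "\<lambda>i. of_nat k * \<xi> $ i * complexify (A i) \<eta> $ l"
      have "(\<Sum>i\<in>UNIV. \<integral>x. ?f x * Re (complex_form \<xi> x ^ (k - 1) * ?c i) \<partial>lborel)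
          = (\<integral>x. (\<Sum>i\<in>UNIV. ?f x * Re (complex_form \<xi> x ^ (k - 1) * ?c i)) \<partial>lborel)"
      proof (rule Bochner_Integration.integral_sum[symmetric])
        fix i
        have "integrable lborel (\<lambda>x. Re (complex_form \<xi> x ^ (k - 1) * ?c i) * ?f x)"
          by (intro integrable_test is_test_mult smooth_complex_form_power) simp
        then show "integrable lborel (\<lambda>x. ?f x * Re (complex_form \<xi> x ^ (k - 1) * ?c i))"
          by (simp only: mult.commute)
      qed
      also have "\<dots> = (\<integral>x. ?f x * Re (complex_form \<xi> x ^ (k - 1) * (\<Sum>i\<in>UNIV. ?c i)) \<partial>lborel)"
        by (simp only: sum_distrib_left Re_sum)
      also have "(\<Sum>i\<in>UNIV. ?c i) = of_nat k * symbol A \<xi> \<eta> $ l"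
        by (simp add: symbol_def sum_distrib_left mult.assoc)
      finally show ?thesis using assms(2) by (simp add: comp sum_negf)
    qed
    then show ?thesis by (simp add: vec_eq_iff)
  qed
  then show ?thesis by (simp add: nullspace_iff A)
qed

section \<open>Finite dimension forces ellipticity\<close>

lemma symbol_scale:
  assumes "\<And>i. linear (A i)"
  shows "symbol A (c *s \<xi>) (d *s \<eta>) = (c * d) *s symbol A \<xi> \<eta>"
  by (simp add: symbol_def complexify_scale assms vec.scale_sum_right mult_ac)

lemma symbol_diff:
  assumes "\<And>i. linear (A i)"
  shows "symbol A \<xi> (\<eta> - \<zeta>) = symbol A \<xi> \<eta> - symbol A \<xi> \<zeta>"
proof -
  have "symbol A \<xi> (\<eta> - \<zeta> + \<zeta>) = symbol A \<xi> (\<eta> - \<zeta>) + symbol A \<xi> \<zeta>"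
    by (simp only: symbol_def complexify_add[OF assms] vector_add_ldistrib sum.distrib)
  then show ?thesis by simp
qed

text \<open>Normalised so that on the axis \<open>i\<close> the form is the coordinate
  \<open>s\<close> itself and the component \<open>j\<close> of a plane power is
  \<open>s^k\<close>.\<close>

lemma not_C_ellipticE:
  assumes A: "\<And>i. linear (A i)" and "\<not> C_elliptic A"
  obtains \<xi> \<eta> i j where "symbol A \<xi> \<eta> = 0" "\<xi> $ i = 1" "\<eta> $ j = 1"
proof -
  obtain \<xi> \<eta>1 \<eta>2 where *: "\<xi> \<noteq> 0" "symbol A \<xi> \<eta>1 = symbol A \<xi> \<eta>2" "\<eta>1 \<noteq> \<eta>2"
    using assms(2) by (auto simp: C_elliptic_def inj_def)
  obtain i where i: "\<xi> $ i \<noteq> 0" using *(1) by (auto simp: vec_eq_iff)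
  obtain j where j: "(\<eta>1 - \<eta>2) $ j \<noteq> 0" using *(3) by (auto simp: vec_eq_iff)
  have "symbol A (inverse (\<xi> $ i) *s \<xi>) (inverse ((\<eta>1 - \<eta>2) $ j) *s (\<eta>1 - \<eta>2)) = 0"
    using *(2) by (simp add: symbol_scale A symbol_diff)
  moreover have "(inverse (\<xi> $ i) *s \<xi>) $ i = 1" using i by simp
  moreover have "(inverse ((\<eta>1 - \<eta>2) $ j) *s (\<eta>1 - \<eta>2)) $ j = 1"
    using j by (simp only: vector_smult_component left_inverse not_False_eq_True)
  ultimately show ?thesis by (rule that)
qed

text \<open>A linear relation among the plane powers, restricted to the component \<open>j\<close>
  and to the axis \<open>i\<close>, is a polynomial in \<open>s\<close> that vanishes on an
  interval.\<close>

lemma finite_dimensional_imp_C_elliptic: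
  fixes A :: "'n::finite \<Rightarrow> real^'N::finite \<Rightarrow> real^'K::finite"
  assumes A: "\<And>i. linear (A i)" and fin: "finite_dimensional (nullspace A)"
  shows "C_elliptic A"
proof (rule ccontr)
  assume "\<not> C_elliptic A"
  then obtain \<xi> \<eta> i j where *: "symbol A \<xi> \<eta> = 0" and i: "\<xi> $ i = 1" and j: "\<eta> $ j = 1"
    using not_C_ellipticE[of A, OF A] by blast
  let ?v = "\<lambda>k. regular_dist (plane_power \<xi> \<eta> k)"
  obtain B where B: "finite B" "span B = nullspace A" using fin by (auto simp: finite_dimensional_def)
  have "?v k \<in> span B" for k using plane_power_in_nullspace[of A, OF A *] B(2) by simp
  then obtain n c where nc: "\<exists>k<n. c k \<noteq> 0" "(\<Sum>k<n. c k *\<^sub>R ?v k) = 0"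
    using real_vector.ex_linear_relation[OF B(1), of ?v] by blast
  define f where "f x = (\<Sum>k<n. c k * Re (complex_form \<xi> x ^ k * \<eta> $ j))" for x
  have f: "smooth f"
    unfolding f_def[abs_def] by (intro smooth_sum smooth_scale smooth_complex_form_power)
  \<comment> \<open>Testing the relation with \<open>f\<close> itself, cut off by
    \<open>cube_bump\<close>, makes the integral of \<open>f\<close> squared against this weight
    vanish.\<close>
  define \<phi> where "\<phi> = Abs_test (\<lambda>x. f x * cube_bump x)"
  have \<phi>: "apply_test \<phi> = (\<lambda>x. f x * cube_bump x)"
    unfolding \<phi>_def by (intro apply_Abs_test is_test_mult f is_test_cube_bump)
  have int: "integrable lborel (\<lambda>x. apply_test \<phi> x * Re (complex_form \<xi> x ^ k * \<eta> $ j))" for k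
  proof -
    have "integrable lborel (\<lambda>x. Re (complex_form \<xi> x ^ k * \<eta> $ j) * apply_test \<phi> x)"
      by (intro integrable_test is_test_mult smooth_complex_form_power) simp
    then show ?thesis by (simp only: mult.commute)
  qed
  have "apply_dist (?v k) \<phi> $ j = (\<integral>x. apply_test \<phi> x * Re (complex_form \<xi> x ^ k * \<eta> $ j) \<partial>lborel)" for k
  proof -
    have "apply_dist (?v k) \<phi> $ j = (\<integral>x. (apply_test \<phi> x *\<^sub>R plane_power \<xi> \<eta> k x) $ j \<partial>lborel)"
      unfolding apply_dist_plane_power
      by (rule integral_bounded_linear[OF bounded_linear_vec_nth integrable_plane_power, symmetric])
    then show ?thesis by (simp add: plane_power_def)
  qed
  moreover have "(\<Sum>k<n. c k * apply_dist (?v k) \<phi> $ j) = apply_dist (\<Sum>k<n. c k *\<^sub>R ?v k) \<phi> $ j"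
    by (simp add: apply_dist_sum scaleR_distribution.rep_eq)
  ultimately have "0 = (\<Sum>k<n. c k * (\<integral>x. apply_test \<phi> x * Re (complex_form \<xi> x ^ k * \<eta> $ j) \<partial>lborel))"
    by (simp add: nc(2) zero_distribution.rep_eq)
  also have "\<dots> = (\<Sum>k<n. \<integral>x. c k * (apply_test \<phi> x * Re (complex_form \<xi> x ^ k * \<eta> $ j)) \<partial>lborel)"
    by (simp only: Bochner_Integration.integral_mult_right[OF int])
  also have "\<dots> = (\<integral>x. (\<Sum>k<n. c k * (apply_test \<phi> x * Re (complex_form \<xi> x ^ k * \<eta> $ j))) \<partial>lborel)"
    by (intro Bochner_Integration.integral_sum[symmetric] integrable_mult_right int)
  also have "\<dots> = (\<integral>x. f x * (f x * cube_bump x) \<partial>lborel)"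
    by (simp only: mult.left_commute[of "c _"] flip: sum_distrib_left f_def) (simp only: \<phi> mult.commute)
  finally have zero: "f x = 0" if "\<And>i. \<bar>x $ i\<bar> < 1" for x
    using smooth_zero_on_cube[OF f _ that] by simp
  \<comment> \<open>The restriction of \<open>f\<close> to the axis \<open>i\<close>, by the
    normalisation of \<open>\<xi>\<close> and \<open>\<eta>\<close>.\<close>
  define p where "p = (\<Sum>k<n. monom (c k) k)"
  have "poly p s = 0" if "s \<in> {0<..<1}" for s
  proof -
    have "f (s *\<^sub>R axis i 1) = 0" using that by (intro zero) (simp add: axis_def)
    then have "(\<Sum>k<n. c k * Re (complex_of_real s ^ k)) = 0"
      by (simp add: f_def complex_form_axis i j)
    then show ?thesis
      by (simp add: p_def poly_sum poly_monom flip: of_real_power)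
  qed
  then have "{0<..<1} \<subseteq> {s. poly p s = 0}" by blast
  moreover have "infinite {0<..<1 :: real}" by (rule infinite_Ioo) simp
  ultimately have "infinite {s. poly p s = 0}" using finite_subset by blast
  then have "p = 0" using poly_roots_finite[of p] by blast
  then have "c k = 0" if "k < n" for k
  proof -
    have "coeff p k = c k" using that by (simp add: p_def coeff_sum)
    with \<open>p = 0\<close> show ?thesis by simp
  qed
  with nc(1) show False by blast
qed

theorem theorem2p6:
  fixes A :: "'n::finite \<Rightarrow> real^'N::finite \<Rightarrow> real^'K::finite"
  assumes "\<And>i. linear (A i)"
  shows "(finite_dimensional (nullspace A) \<longleftrightarrow> C_elliptic A) \<and>
         (C_elliptic A \<longleftrightarrow> (\<exists>l. nullspace A \<subseteq> regular_dist ` polynomials_upto l))"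
  using finite_dimensional_imp_C_elliptic[of A] C_elliptic_imp_polynomials[of A]
    polynomials_imp_finite_dimensional[of A] assms by blast

end
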